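(* The theory $\mathsf{H}$ proves the principle of countable saturation $\mathsf{CSAT}$: for every type $\sigma$ and every (possibly external) formula $\Phi(n^0,x^\sigma)$ in the language of $\mathsf{E\text{-}HA}^{\omega}_{\mathrm{st}}$ (possibly with additional free variables), $$\mathsf{H}\ \vdash\ \forall^{\mathrm{st}} n^0\,\exists x^\sigma\,\Phi(n,x)\ \to\ \exists f^{0\to\sigma}\,\forall^{\mathrm{st}} n^0\,\Phi(n,f(n)).$$
   Context: **Base system.** $\mathsf{E\text{-}HA}^{\omega}$ is extensional Heyting arithmetic in all finite types (intuitionistic logic, constants of G\"odel's $\mathsf{T}$, full induction schema). Only equality at type $0$ is primitive; equality at higher types is defined extensionally. $\sigma^*$ is the type of finite sequences of objects of type $\sigma$ (primitive or suitably coded); $x\in y$, for $y$ of type $\sigma^*$, means that $x$ equals one of the components of $y$. Finite sequences stand in for finite sets: $\emptyset$ is the empty sequence, $\cup$ is concatenation, $\{x\}$ is the length-one sequence with component $x$. Underlined letters denote (possibly empty) tuples of variables or terms. **The system $\mathsf{E\text{-}HA}^{\omega}_{\mathrm{st}}$.** Its language adds to that of $\mathsf{E\text{-}HA}^{\omega}$ a unary predicate $\mathrm{st}^\sigma$ and quantifiers $\forall^{\mathrm{st}}x^\sigma,\exists^{\mathrm{st}}x^\sigma$ for every type $\sigma$. Formulas without these new symbols are internal (written with small Greek letters); general formulas may be external (written with capital Greek letters). The system consists of $\mathsf{E\text{-}HA}^{\omega}$ (with its induction schema for internal formulas only), intuitionistic logic for all formulas, and: (1) $\forall^{\mathrm{st}}x\,\Phi(x)\leftrightarrow\forall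 x(\mathrm{st}(x)\to\Phi(x))$ and $\exists^{\mathrm{st}}x\,\Phi(x)\leftrightarrow\exists x(\mathrm{st}(x)\land\Phi(x))$; (2) $\mathrm{st}(x)\land x=y\to\mathrm{st}(y)$; $\mathrm{st}(t)$ for each closed term $t$ of $\mathsf{T}$; $\mathrm{st}(f)\land\mathrm{st}(x)\to\mathrm{st}(fx)$; (3) external induction: $\big(\Phi(0)\land\forall^{\mathrm{st}}x^0(\Phi(x)\to\Phi(x+1))\big)\to\forall^{\mathrm{st}}x^0\,\Phi(x)$, for arbitrary external formulas $\Phi$. **The $D_{\mathrm{st}}$-interpretation.** For $Y$ a finite sequence of functions with values of sequence type, put $Y[x]:=\bigcup_{y\in Y}y(x)$ (iterated for several arguments, componentwise for tuples). To each formula $\Phi(\underline a)$ one associates $\Phi(\underline a)^{D_{\mathrm{st}}}\equiv\exists^{\mathrm{st}}\underline x\,\forall^{\mathrm{st}}\underline y\,\varphi_{D_{\mathrm{st}}}(\underline x,\underline y,\underline a)$, with $\varphi_{D_{\mathrm{st}}}$ internal and all variables in $\underline x$ of sequence type, by recursion: - $\varphi(\underline a)^{D_{\mathrm{st}}}:\equiv\varphi(\underline a)$ for internal atomic $\varphi$; $\mathrm{st}^\sigma(u)^{D_{\mathrm{st}}}:\equiv\exists^{\mathrm{st}}x^{\sigma^*}\,u\in_\sigma x$. If $\Phi(\underline a)^{D_{\mathrm{st}}}\equiv\exists^{\mathrm{st}}\underline x\forall^{\mathrm{st}}\underline y\,\varphi_{D_{\mathrm{st}}}(\underline x,\underline y,\underline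 a)$ and $\Psi(\underline b)^{D_{\mathrm{st}}}\equiv\exists^{\mathrm{st}}\underline u\forall^{\mathrm{st}}\underline v\,\psi_{D_{\mathrm{st}}}(\underline u,\underline v,\underline b)$: - $(\Phi\land\Psi)^{D_{\mathrm{st}}}:\equiv\exists^{\mathrm{st}}\underline x,\underline u\,\forall^{\mathrm{st}}\underline y,\underline v\,(\varphi_{D_{\mathrm{st}}}(\underline x,\underline y,\underline a)\land\psi_{D_{\mathrm{st}}}(\underline u,\underline v,\underline b))$; - $(\Phi\lor\Psi)^{D_{\mathrm{st}}}:\equiv\exists^{\mathrm{st}}\underline x,\underline u\,\forall^{\mathrm{st}}\underline y,\underline v\,(\varphi_{D_{\mathrm{st}}}(\underline x,\underline y,\underline a)\lor\psi_{D_{\mathrm{st}}}(\underline u,\underline v,\underline b))$; - $(\Phi\to\Psi)^{D_{\mathrm{st}}}:\equiv\exists^{\mathrm{st}}\underline U,\underline Y\,\forall^{\mathrm{st}}\underline x,\underline v\,(\forall\underline y\in\underline Y[\underline x,\underline v]\,\varphi_{D_{\mathrm{st}}}(\underline x,\underline y,\underline a)\to\psi_{D_{\mathrm{st}}}(\underline U[\underline x],\underline v,\underline b))$. If $\Phi(z,\underline a)^{D_{\mathrm{st}}}\equiv\exists^{\mathrm{st}}\underline x\forall^{\mathrm{st}}\underline y\,\varphi_{D_{\mathrm{st}}}(\underline x,\underline y,z,\underline a)$ with $z$ not among $\underline a$: - $(\forall z\Phi)^{D_{\mathrm{st}}}:\equiv\exists^{\mathrm{st}}\underline x\forall^{\mathrm{st}}\underline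 y\,\forall z\,\varphi_{D_{\mathrm{st}}}(\underline x,\underline y,z,\underline a)$; - $(\exists z\Phi)^{D_{\mathrm{st}}}:\equiv\exists^{\mathrm{st}}\underline x\forall^{\mathrm{st}}\underline y\,\exists z\,\forall\underline y'\in\underline y\,\varphi_{D_{\mathrm{st}}}(\underline x,\underline y',z,\underline a)$; - $(\forall^{\mathrm{st}}z\Phi)^{D_{\mathrm{st}}}:\equiv\exists^{\mathrm{st}}\underline X\forall^{\mathrm{st}}z,\underline y\,\varphi_{D_{\mathrm{st}}}(\underline X[z],\underline y,z,\underline a)$; - $(\exists^{\mathrm{st}}z\Phi)^{D_{\mathrm{st}}}:\equiv\exists^{\mathrm{st}}\underline x,z\,\forall^{\mathrm{st}}\underline y\,\exists z'\in z\,\forall\underline y'\in\underline y\,\varphi_{D_{\mathrm{st}}}(\underline x,\underline y',z',\underline a)$. **The theory $\mathsf{H}$** is $\mathsf{E\text{-}HA}^{\omega}_{\mathrm{st}}$ together with the schema $\Phi\leftrightarrow\Phi^{D_{\mathrm{st}}}$ for all external formulas $\Phi$. *)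

theory Defs
  imports Main
begin

section \<open>Types, terms and formulas\<close>

text \<open>
  Finite sequence types are primitive. Terms are those of Goedel's T in combinator form, so they
  contain no binders; variables are de Bruijn indices. Contexts are lists of types whose head is
  the type of the variable with index 0. The constants \<open>Kc\<close> and \<open>Sc\<close> are the projector and the
  distributor, \<open>Rc\<close> is the recursor for numbers and \<open>Lc\<close> the one for sequences.
\<close>

datatype ty = Nat | Fun ty ty (infixr \<open>\<rightarrow>\<close> 65) | Seq ty

datatype const =
    Zero | Succ
  | Kc ty ty | Sc ty ty ty
  | Rc ty
  | NilC ty | ConsC ty
  | Lc ty ty

primrec cty :: "const \<Rightarrow> ty" where
  "cty Zero = Nat"
| "cty Succ = Nat \<rightarrow> Nat"
| "cty (Kc \<sigma> \<tau>) = \<sigma> \<rightarrow> \<tau> \<rightarrow> \<sigma>"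
| "cty (Sc \<rho> \<sigma> \<tau>) = (\<rho> \<rightarrow> \<sigma> \<rightarrow> \<tau>) \<rightarrow> (\<rho> \<rightarrow> \<sigma>) \<rightarrow> \<rho> \<rightarrow> \<tau>"
| "cty (Rc \<sigma>) = \<sigma> \<rightarrow> (\<sigma> \<rightarrow> Nat \<rightarrow> \<sigma>) \<rightarrow> Nat \<rightarrow> \<sigma>"
| "cty (NilC \<sigma>) = Seq \<sigma>"
| "cty (ConsC \<sigma>) = \<sigma> \<rightarrow> Seq \<sigma> \<rightarrow> Seq \<sigma>"
| "cty (Lc \<sigma> \<tau>) = \<tau> \<rightarrow> (\<tau> \<rightarrow> \<sigma> \<rightarrow> \<tau>) \<rightarrow> Seq \<sigma> \<rightarrow> \<tau>"

datatype tm = Var nat | Con const | App tm tm (infixl \<open>\<cdot>\<close> 100)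

primrec wt :: "ty list \<Rightarrow> tm \<Rightarrow> ty \<Rightarrow> bool" where
  "wt \<Gamma> (Var i) \<tau> \<longleftrightarrow> i < length \<Gamma> \<and> \<Gamma> ! i = \<tau>"
| "wt \<Gamma> (Con c) \<tau> \<longleftrightarrow> cty c = \<tau>"
| "wt \<Gamma> (s \<cdot> t) \<tau> \<longleftrightarrow> (\<exists>\<sigma>. wt \<Gamma> s (\<sigma> \<rightarrow> \<tau>) \<and> wt \<Gamma> t \<sigma>)"

datatype fm =
    Eq tm tm  \<comment> \<open>equality at type 0\<close>
  | Fls
  | St ty tm
  | And fm fm
  | Or fm fm
  | Imp fm fm
  | All ty fm
  | Ex ty fm
  | AllSt ty fm
  | ExSt ty fm

abbreviation Iff :: "fm \<Rightarrow> fm \<Rightarrow> fm" where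
  "Iff \<Phi> \<Psi> \<equiv> And (Imp \<Phi> \<Psi>) (Imp \<Psi> \<Phi>)"

primrec wff :: "ty list \<Rightarrow> fm \<Rightarrow> bool" where
  "wff \<Gamma> (Eq s t) \<longleftrightarrow> wt \<Gamma> s Nat \<and> wt \<Gamma> t Nat"
| "wff \<Gamma> Fls \<longleftrightarrow> True"
| "wff \<Gamma> (St \<sigma> t) \<longleftrightarrow> wt \<Gamma> t \<sigma>"
| "wff \<Gamma> (And \<Phi> \<Psi>) \<longleftrightarrow> wff \<Gamma> \<Phi> \<and> wff \<Gamma> \<Psi>"
| "wff \<Gamma> (Or \<Phi> \<Psi>) \<longleftrightarrow> wff \<Gamma> \<Phi> \<and> wff \<Gamma> \<Psi>"
| "wff \<Gamma> (Imp \<Phi> \<Psi>) \<longleftrightarrow> wff \<Gamma> \<Phi> \<and> wff \<Gamma> \<Psi>"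
| "wff \<Gamma> (All \<sigma> \<Phi>) \<longleftrightarrow> wff (\<sigma> # \<Gamma>) \<Phi>"
| "wff \<Gamma> (Ex \<sigma> \<Phi>) \<longleftrightarrow> wff (\<sigma> # \<Gamma>) \<Phi>"
| "wff \<Gamma> (AllSt \<sigma> \<Phi>) \<longleftrightarrow> wff (\<sigma> # \<Gamma>) \<Phi>"
| "wff \<Gamma> (ExSt \<sigma> \<Phi>) \<longleftrightarrow> wff (\<sigma> # \<Gamma>) \<Phi>"

primrec internal :: "fm \<Rightarrow> bool" where
  "internal (Eq s t) \<longleftrightarrow> True"
| "internal Fls \<longleftrightarrow> True"
| "internal (St \<sigma> t) \<longleftrightarrow> False"
| "internal (And \<Phi> \<Psi>) \<longleftrightarrow> internal \<Phi> \<and> internal \<Psi>"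
| "internal (Or \<Phi> \<Psi>) \<longleftrightarrow> internal \<Phi> \<and> internal \<Psi>"
| "internal (Imp \<Phi> \<Psi>) \<longleftrightarrow> internal \<Phi> \<and> internal \<Psi>"
| "internal (All \<sigma> \<Phi>) \<longleftrightarrow> internal \<Phi>"
| "internal (Ex \<sigma> \<Phi>) \<longleftrightarrow> internal \<Phi>"
| "internal (AllSt \<sigma> \<Phi>) \<longleftrightarrow> False"
| "internal (ExSt \<sigma> \<Phi>) \<longleftrightarrow> False"


section \<open>Substitution\<close>

primrec tsubst :: "(nat \<Rightarrow> tm) \<Rightarrow> tm \<Rightarrow> tm" where
  "tsubst \<theta> (Var i) = \<theta> i"
| "tsubst \<theta> (Con c) = Con c"
| "tsubst \<theta> (s \<cdot> t) = tsubst \<theta> s \<cdot> tsubst \<theta> t"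

abbreviation tlift :: "tm \<Rightarrow> tm" where
  "tlift \<equiv> tsubst (\<lambda>i. Var (Suc i))"

definition up :: "(nat \<Rightarrow> tm) \<Rightarrow> nat \<Rightarrow> tm" where
  "up \<theta> = case_nat (Var 0) (\<lambda>i. tlift (\<theta> i))"

primrec fsubst :: "(nat \<Rightarrow> tm) \<Rightarrow> fm \<Rightarrow> fm" where
  "fsubst \<theta> (Eq s t) = Eq (tsubst \<theta> s) (tsubst \<theta> t)"
| "fsubst \<theta> Fls = Fls"
| "fsubst \<theta> (St \<sigma> t) = St \<sigma> (tsubst \<theta> t)"
| "fsubst \<theta> (And \<Phi> \<Psi>) = And (fsubst \<theta> \<Phi>) (fsubst \<theta> \<Psi>)"
| "fsubst \<theta> (Or \<Phi> \<Psi>) = Or (fsubst \<theta> \<Phi>) (fsubst \<theta> \<Psi>)"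
| "fsubst \<theta> (Imp \<Phi> \<Psi>) = Imp (fsubst \<theta> \<Phi>) (fsubst \<theta> \<Psi>)"
| "fsubst \<theta> (All \<sigma> \<Phi>) = All \<sigma> (fsubst (up \<theta>) \<Phi>)"
| "fsubst \<theta> (Ex \<sigma> \<Phi>) = Ex \<sigma> (fsubst (up \<theta>) \<Phi>)"
| "fsubst \<theta> (AllSt \<sigma> \<Phi>) = AllSt \<sigma> (fsubst (up \<theta>) \<Phi>)"
| "fsubst \<theta> (ExSt \<sigma> \<Phi>) = ExSt \<sigma> (fsubst (up \<theta>) \<Phi>)"

abbreviation flift :: "fm \<Rightarrow> fm" where
  "flift \<equiv> fsubst (\<lambda>i. Var (Suc i))"

text \<open>
  Tuples are listed from the outermost variable to the innermost one, so the last component of a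
  tuple of bound variables has the smallest index. \<open>plug [t\<^sub>1, \<dots>, t\<^sub>n] d \<Phi>\<close> replaces the \<open>n\<close>
  innermost variables of \<open>\<Phi>\<close> by \<open>t\<^sub>1, \<dots>, t\<^sub>n\<close>, where the remaining variables of \<open>\<Phi>\<close> are to be found
  below \<open>d\<close> further variables in the new context. \<open>vars o n\<close> is the tuple formed by a block of \<open>n\<close>
  consecutive variables inside of which there are \<open>o\<close> further ones.
\<close>

definition plug :: "tm list \<Rightarrow> nat \<Rightarrow> fm \<Rightarrow> fm" where
  "plug ts d = fsubst (\<lambda>i. if i < length ts then rev ts ! i else Var (i - length ts + d))"

definition vars :: "nat \<Rightarrow> nat \<Rightarrow> tm list" where
  "vars off n = map Var (rev [off..<off + n])"


section \<open>Lambda abstraction and some closed terms\<close>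

primrec tyof :: "ty list \<Rightarrow> tm \<Rightarrow> ty" where
  "tyof \<Gamma> (Var i) = \<Gamma> ! i"
| "tyof \<Gamma> (Con c) = cty c"
| "tyof \<Gamma> (s \<cdot> t) = (case tyof \<Gamma> s of Fun \<sigma> \<tau> \<Rightarrow> \<tau> | _ \<Rightarrow> Nat)"

text \<open>
  Bracket abstraction: for \<open>t\<close> in context \<open>\<sigma> # \<Gamma>\<close>, \<open>lam \<Gamma> \<sigma> t\<close> is a term in context \<open>\<Gamma>\<close> that
  denotes the function sending the variable with index 0 to \<open>t\<close>.
\<close>

fun lam :: "ty list \<Rightarrow> ty \<Rightarrow> tm \<Rightarrow> tm" where
  "lam \<Gamma> \<sigma> (Var 0) = Con (Sc \<sigma> (\<sigma> \<rightarrow> \<sigma>) \<sigma>) \<cdot> Con (Kc \<sigma> (\<sigma> \<rightarrow> \<sigma>)) \<cdot> Con (Kc \<sigma> \<sigma>)"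
| "lam \<Gamma> \<sigma> (Var (Suc i)) = Con (Kc (\<Gamma> ! i) \<sigma>) \<cdot> Var i"
| "lam \<Gamma> \<sigma> (Con c) = Con (Kc (cty c) \<sigma>) \<cdot> Con c"
| "lam \<Gamma> \<sigma> (s \<cdot> t) =
     Con (Sc \<sigma> (tyof (\<sigma> # \<Gamma>) t) (tyof (\<sigma> # \<Gamma>) (s \<cdot> t))) \<cdot> lam \<Gamma> \<sigma> s \<cdot> lam \<Gamma> \<sigma> t"

text \<open>\<open>add \<cdot> i \<cdot> k = R i (\<lambda>r j. S r) k\<close>\<close>

definition add :: tm where
  "add = lam [] Nat (Con (Rc Nat) \<cdot> Var 0 \<cdot>
           lam [Nat] Nat (lam [Nat, Nat] Nat (Con Succ \<cdot> Var 1)))"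

text \<open>\<open>len \<sigma> \<cdot> s = L 0 (\<lambda>r a. S r) s\<close>\<close>

definition len :: "ty \<Rightarrow> tm" where
  "len \<sigma> = Con (Lc \<sigma> Nat) \<cdot> Con Zero \<cdot> lam [] Nat (lam [Nat] \<sigma> (Con Succ \<cdot> Var 1))"

primrec zero :: "ty \<Rightarrow> tm" where
  "zero Nat = Con Zero"
| "zero (\<sigma> \<rightarrow> \<tau>) = Con (Kc \<tau> \<sigma>) \<cdot> zero \<tau>"
| "zero (Seq \<sigma>) = Con (NilC \<sigma>)"

text \<open>
  \<open>proj \<sigma> \<cdot> s = L (\<lambda>i. 0) (\<lambda>r a i. R a (\<lambda>b j. r j) i) s\<close>, so \<open>proj \<sigma> \<cdot> s \<cdot> i\<close> is the component of
  \<open>s\<close> with number \<open>i\<close>, counting from 0 (and the zero object of type \<open>\<sigma>\<close> if there is none).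
\<close>

definition proj :: "ty \<Rightarrow> tm" where
  "proj \<sigma> = Con (Lc \<sigma> (Nat \<rightarrow> \<sigma>)) \<cdot> (Con (Kc \<sigma> Nat) \<cdot> zero \<sigma>) \<cdot>
     lam [] (Nat \<rightarrow> \<sigma>) (lam [Nat \<rightarrow> \<sigma>] \<sigma>
       (Con (Rc \<sigma>) \<cdot> Var 0 \<cdot>
         lam [\<sigma>, Nat \<rightarrow> \<sigma>] \<sigma> (lam [\<sigma>, \<sigma>, Nat \<rightarrow> \<sigma>] Nat (Var 3 \<cdot> Var 0))))"

text \<open>\<open>append \<sigma> \<cdot> s \<cdot> t = L t (\<lambda>r a. cons a r) s\<close>\<close>

definition append :: "ty \<Rightarrow> tm" where
  "append \<sigma> = lam [] (Seq \<sigma>) (lam [Seq \<sigma>] (Seq \<sigma>)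
     (Con (Lc \<sigma> (Seq \<sigma>)) \<cdot> Var 0 \<cdot>
       lam [Seq \<sigma>, Seq \<sigma>] (Seq \<sigma>) (lam [Seq \<sigma>, Seq \<sigma>, Seq \<sigma>] \<sigma> (Con (ConsC \<sigma>) \<cdot> Var 0 \<cdot> Var 1)) \<cdot>
       Var 1))"

text \<open>
  \<open>bapp \<sigma> \<tau> \<cdot> Y \<cdot> x = L nil (\<lambda>r y. append (y x) r) Y\<close>, which is \<open>Y[x]\<close>, the union of all \<open>y(x)\<close>
  with \<open>y \<in> Y\<close>, for \<open>Y\<close> of type \<open>Seq (\<sigma> \<rightarrow> Seq \<tau>)\<close>.
\<close>

definition bapp :: "ty \<Rightarrow> ty \<Rightarrow> tm" where
  "bapp \<sigma> \<tau> =
    (let T = Seq (\<sigma> \<rightarrow> Seq \<tau>) in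
     lam [] T (lam [T] \<sigma>
       (Con (Lc (\<sigma> \<rightarrow> Seq \<tau>) (Seq \<tau>)) \<cdot> Con (NilC \<tau>) \<cdot>
         lam [\<sigma>, T] (Seq \<tau>) (lam [Seq \<tau>, \<sigma>, T] (\<sigma> \<rightarrow> Seq \<tau>)
           (append \<tau> \<cdot> (Var 0 \<cdot> Var 2) \<cdot> Var 1)) \<cdot>
         Var 1)))"


section \<open>Defined internal formulas\<close>

text \<open>\<open>i < j\<close> is expressed by the existence of \<open>k\<close> with \<open>S i + k = j\<close>.\<close>

definition less :: "tm \<Rightarrow> tm \<Rightarrow> fm" where
  "less i j = Ex Nat (Eq (add \<cdot> (Con Succ \<cdot> tlift i) \<cdot> Var 0) (tlift j))"

text \<open>
  Extensional equality: at function types it is pointwise, at sequence types it means same length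
  and equal components.
\<close>

primrec eq :: "ty \<Rightarrow> tm \<Rightarrow> tm \<Rightarrow> fm" where
  "eq Nat s t = Eq s t"
| "eq (\<sigma> \<rightarrow> \<tau>) s t = All \<sigma> (eq \<tau> (tlift s \<cdot> Var 0) (tlift t \<cdot> Var 0))"
| "eq (Seq \<sigma>) s t = And (Eq (len \<sigma> \<cdot> s) (len \<sigma> \<cdot> t))
     (All Nat (Imp (less (Var 0) (len \<sigma> \<cdot> tlift s))
       (eq \<sigma> (proj \<sigma> \<cdot> tlift s \<cdot> Var 0) (proj \<sigma> \<cdot> tlift t \<cdot> Var 0))))"

definition mem :: "ty \<Rightarrow> tm \<Rightarrow> tm \<Rightarrow> fm" where
  "mem \<sigma> s t = Ex Nat (And (less (Var 0) (len \<sigma> \<cdot> tlift t)) (eq \<sigma> (tlift s) (proj \<sigma> \<cdot> tlift t \<cdot> Var 0)))"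

definition ball :: "ty \<Rightarrow> tm \<Rightarrow> fm \<Rightarrow> fm" where
  "ball \<sigma> t \<Phi> = All \<sigma> (Imp (mem \<sigma> (Var 0) (tlift t)) \<Phi>)"

definition bex :: "ty \<Rightarrow> tm \<Rightarrow> fm \<Rightarrow> fm" where
  "bex \<sigma> t \<Phi> = Ex \<sigma> (And (mem \<sigma> (Var 0) (tlift t)) \<Phi>)"

text \<open>The bounds of a tuple of bounded quantifiers are given in the context outside of all of them.\<close>

fun balls :: "ty list \<Rightarrow> tm list \<Rightarrow> fm \<Rightarrow> fm" where
  "balls (\<sigma> # \<sigma>s) (t # ts) \<Phi> = ball \<sigma> t (balls \<sigma>s (map tlift ts) \<Phi>)"
| "balls _ _ \<Phi> = \<Phi>"


section \<open>Intuitionistic logic\<close>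

text \<open>
  Natural deduction for many-sorted intuitionistic logic over a given set of axioms. The quantifiers
  relativized to standard objects have no rules; they are governed by axioms.
\<close>

inductive nd :: "(ty list \<Rightarrow> fm \<Rightarrow> bool) \<Rightarrow> ty list \<Rightarrow> fm list \<Rightarrow> fm \<Rightarrow> bool" for Ax where
  Axm: "Ax \<Gamma> \<Phi> \<Longrightarrow> nd Ax \<Gamma> \<Delta> \<Phi>"
| Asm: "\<Phi> \<in> set \<Delta> \<Longrightarrow> wff \<Gamma> \<Phi> \<Longrightarrow> nd Ax \<Gamma> \<Delta> \<Phi>"
| FlsE: "nd Ax \<Gamma> \<Delta> Fls \<Longrightarrow> wff \<Gamma> \<Phi> \<Longrightarrow> nd Ax \<Gamma> \<Delta> \<Phi>"
| AndI: "nd Ax \<Gamma> \<Delta> \<Phi> \<Longrightarrow> nd Ax \<Gamma> \<Delta> \<Psi> \<Longrightarrow> nd Ax \<Gamma> \<Delta> (And \<Phi> \<Psi>)"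
| AndE1: "nd Ax \<Gamma> \<Delta> (And \<Phi> \<Psi>) \<Longrightarrow> nd Ax \<Gamma> \<Delta> \<Phi>"
| AndE2: "nd Ax \<Gamma> \<Delta> (And \<Phi> \<Psi>) \<Longrightarrow> nd Ax \<Gamma> \<Delta> \<Psi>"
| OrI1: "nd Ax \<Gamma> \<Delta> \<Phi> \<Longrightarrow> wff \<Gamma> \<Psi> \<Longrightarrow> nd Ax \<Gamma> \<Delta> (Or \<Phi> \<Psi>)"
| OrI2: "nd Ax \<Gamma> \<Delta> \<Psi> \<Longrightarrow> wff \<Gamma> \<Phi> \<Longrightarrow> nd Ax \<Gamma> \<Delta> (Or \<Phi> \<Psi>)"
| OrE: "nd Ax \<Gamma> \<Delta> (Or \<Phi> \<Psi>) \<Longrightarrow> nd Ax \<Gamma> (\<Phi> # \<Delta>) \<chi> \<Longrightarrow> nd Ax \<Gamma> (\<Psi> # \<Delta>) \<chi> \<Longrightarrow> nd Ax \<Gamma> \<Delta> \<chi>"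
| ImpI: "wff \<Gamma> \<Phi> \<Longrightarrow> nd Ax \<Gamma> (\<Phi> # \<Delta>) \<Psi> \<Longrightarrow> nd Ax \<Gamma> \<Delta> (Imp \<Phi> \<Psi>)"
| ImpE: "nd Ax \<Gamma> \<Delta> (Imp \<Phi> \<Psi>) \<Longrightarrow> nd Ax \<Gamma> \<Delta> \<Phi> \<Longrightarrow> nd Ax \<Gamma> \<Delta> \<Psi>"
| AllI: "nd Ax (\<sigma> # \<Gamma>) (map flift \<Delta>) \<Phi> \<Longrightarrow> nd Ax \<Gamma> \<Delta> (All \<sigma> \<Phi>)"
| AllE: "nd Ax \<Gamma> \<Delta> (All \<sigma> \<Phi>) \<Longrightarrow> wt \<Gamma> t \<sigma> \<Longrightarrow> nd Ax \<Gamma> \<Delta> (plug [t] 0 \<Phi>)"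
| ExI: "wff (\<sigma> # \<Gamma>) \<Phi> \<Longrightarrow> wt \<Gamma> t \<sigma> \<Longrightarrow> nd Ax \<Gamma> \<Delta> (plug [t] 0 \<Phi>) \<Longrightarrow> nd Ax \<Gamma> \<Delta> (Ex \<sigma> \<Phi>)"
| ExE: "nd Ax \<Gamma> \<Delta> (Ex \<sigma> \<Phi>) \<Longrightarrow> nd Ax (\<sigma> # \<Gamma>) (\<Phi> # map flift \<Delta>) (flift \<chi>) \<Longrightarrow> wff \<Gamma> \<chi>
    \<Longrightarrow> nd Ax \<Gamma> \<Delta> \<chi>"


section \<open>The base system and its extension with a standardness predicate\<close>

inductive EHA :: "ty list \<Rightarrow> fm \<Rightarrow> bool" where
  refl: "wt \<Gamma> s Nat \<Longrightarrow> EHA \<Gamma> (Eq s s)"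
| sym: "wt \<Gamma> s Nat \<Longrightarrow> wt \<Gamma> t Nat \<Longrightarrow> EHA \<Gamma> (Imp (Eq s t) (Eq t s))"
| trans: "wt \<Gamma> s Nat \<Longrightarrow> wt \<Gamma> t Nat \<Longrightarrow> wt \<Gamma> u Nat \<Longrightarrow>
    EHA \<Gamma> (Imp (Eq s t) (Imp (Eq t u) (Eq s u)))"
| ext: "wt \<Gamma> f (\<sigma> \<rightarrow> \<tau>) \<Longrightarrow> wt \<Gamma> s \<sigma> \<Longrightarrow> wt \<Gamma> t \<sigma> \<Longrightarrow>
    EHA \<Gamma> (Imp (eq \<sigma> s t) (eq \<tau> (f \<cdot> s) (f \<cdot> t)))"
| Succ_inj: "wt \<Gamma> s Nat \<Longrightarrow> wt \<Gamma> t Nat \<Longrightarrow>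
    EHA \<Gamma> (Imp (Eq (Con Succ \<cdot> s) (Con Succ \<cdot> t)) (Eq s t))"
| Succ_Zero: "wt \<Gamma> s Nat \<Longrightarrow> EHA \<Gamma> (Imp (Eq (Con Succ \<cdot> s) (Con Zero)) Fls)"
| K: "wt \<Gamma> s \<sigma> \<Longrightarrow> wt \<Gamma> t \<tau> \<Longrightarrow> EHA \<Gamma> (eq \<sigma> (Con (Kc \<sigma> \<tau>) \<cdot> s \<cdot> t) s)"
| S: "wt \<Gamma> s (\<rho> \<rightarrow> \<sigma> \<rightarrow> \<tau>) \<Longrightarrow> wt \<Gamma> t (\<rho> \<rightarrow> \<sigma>) \<Longrightarrow> wt \<Gamma> u \<rho> \<Longrightarrow>
    EHA \<Gamma> (eq \<tau> (Con (Sc \<rho> \<sigma> \<tau>) \<cdot> s \<cdot> t \<cdot> u) (s \<cdot> u \<cdot> (t \<cdot> u)))"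
| R_Zero: "wt \<Gamma> s \<sigma> \<Longrightarrow> wt \<Gamma> t (\<sigma> \<rightarrow> Nat \<rightarrow> \<sigma>) \<Longrightarrow>
    EHA \<Gamma> (eq \<sigma> (Con (Rc \<sigma>) \<cdot> s \<cdot> t \<cdot> Con Zero) s)"
| R_Succ: "wt \<Gamma> s \<sigma> \<Longrightarrow> wt \<Gamma> t (\<sigma> \<rightarrow> Nat \<rightarrow> \<sigma>) \<Longrightarrow> wt \<Gamma> u Nat \<Longrightarrow>
    EHA \<Gamma> (eq \<sigma> (Con (Rc \<sigma>) \<cdot> s \<cdot> t \<cdot> (Con Succ \<cdot> u)) (t \<cdot> (Con (Rc \<sigma>) \<cdot> s \<cdot> t \<cdot> u) \<cdot> u))"
| L_Nil: "wt \<Gamma> s \<tau> \<Longrightarrow> wt \<Gamma> t (\<tau> \<rightarrow> \<sigma> \<rightarrow> \<tau>) \<Longrightarrow>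
    EHA \<Gamma> (eq \<tau> (Con (Lc \<sigma> \<tau>) \<cdot> s \<cdot> t \<cdot> Con (NilC \<sigma>)) s)"
| L_Cons: "wt \<Gamma> s \<tau> \<Longrightarrow> wt \<Gamma> t (\<tau> \<rightarrow> \<sigma> \<rightarrow> \<tau>) \<Longrightarrow> wt \<Gamma> a \<sigma> \<Longrightarrow> wt \<Gamma> u (Seq \<sigma>) \<Longrightarrow>
    EHA \<Gamma> (eq \<tau> (Con (Lc \<sigma> \<tau>) \<cdot> s \<cdot> t \<cdot> (Con (ConsC \<sigma>) \<cdot> a \<cdot> u)) (t \<cdot> (Con (Lc \<sigma> \<tau>) \<cdot> s \<cdot> t \<cdot> u) \<cdot> a))"
| Seq_cases:
    "EHA \<Gamma> (All (Seq \<sigma>) (Or (eq (Seq \<sigma>) (Var 0) (Con (NilC \<sigma>)))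
       (Ex \<sigma> (Ex (Seq \<sigma>) (eq (Seq \<sigma>) (Var 2) (Con (ConsC \<sigma>) \<cdot> Var 1 \<cdot> Var 0))))))"
| induction: "wff (Nat # \<Gamma>) \<phi> \<Longrightarrow> internal \<phi> \<Longrightarrow>
    EHA \<Gamma> (Imp (And (plug [Con Zero] 0 \<phi>) (All Nat (Imp \<phi> (plug [Con Succ \<cdot> Var 0] 1 \<phi>))))
             (All Nat \<phi>))"

inductive EHAst :: "ty list \<Rightarrow> fm \<Rightarrow> bool" where
  EHA: "EHA \<Gamma> \<phi> \<Longrightarrow> EHAst \<Gamma> \<phi>"
| AllSt: "wff (\<sigma> # \<Gamma>) \<Phi> \<Longrightarrow> EHAst \<Gamma> (Iff (AllSt \<sigma> \<Phi>) (All \<sigma> (Imp (St \<sigma> (Var 0)) \<Phi>)))"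
| ExSt: "wff (\<sigma> # \<Gamma>) \<Phi> \<Longrightarrow> EHAst \<Gamma> (Iff (ExSt \<sigma> \<Phi>) (Ex \<sigma> (And (St \<sigma> (Var 0)) \<Phi>)))"
| St_eq: "wt \<Gamma> s \<sigma> \<Longrightarrow> wt \<Gamma> t \<sigma> \<Longrightarrow> EHAst \<Gamma> (Imp (And (St \<sigma> s) (eq \<sigma> s t)) (St \<sigma> t))"
| St_closed: "wt [] t \<sigma> \<Longrightarrow> EHAst \<Gamma> (St \<sigma> t)"
| St_App: "wt \<Gamma> f (\<sigma> \<rightarrow> \<tau>) \<Longrightarrow> wt \<Gamma> s \<sigma> \<Longrightarrow>
    EHAst \<Gamma> (Imp (And (St (\<sigma> \<rightarrow> \<tau>) f) (St \<sigma> s)) (St \<tau> (f \<cdot> s)))"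
| external_induction: "wff (Nat # \<Gamma>) \<Phi> \<Longrightarrow>
    EHAst \<Gamma> (Imp (And (plug [Con Zero] 0 \<Phi>) (AllSt Nat (Imp \<Phi> (plug [Con Succ \<cdot> Var 0] 1 \<Phi>))))
               (AllSt Nat \<Phi>))"


section \<open>The interpretation\<close>

text \<open>
  \<open>Seq (htype [\<sigma>\<^sub>1, \<dots>, \<sigma>\<^sub>n] \<tau>)\<close> is the type of those \<open>Y\<close> for which \<open>Y[x\<^sub>1, \<dots>, x\<^sub>n] = Y[x\<^sub>1]\<dots>[x\<^sub>n]\<close>, with
  \<open>x\<^sub>i\<close> of type \<open>\<sigma>\<^sub>i\<close>, makes sense and is of type \<open>Seq \<tau>\<close>. For \<open>n = 0\<close> this term is \<open>Y\<close> itself.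
\<close>

primrec htype :: "ty list \<Rightarrow> ty \<Rightarrow> ty" where
  "htype [] \<tau> = \<tau>"
| "htype (\<sigma> # \<sigma>s) \<tau> = \<sigma> \<rightarrow> Seq (htype \<sigma>s \<tau>)"

fun happ :: "ty list \<Rightarrow> ty \<Rightarrow> tm \<Rightarrow> tm list \<Rightarrow> tm" where
  "happ (\<sigma> # \<sigma>s) \<tau> Y (x # xs) = happ \<sigma>s \<tau> (bapp \<sigma> (htype \<sigma>s \<tau>) \<cdot> Y \<cdot> x) xs"
| "happ _ _ Y _ = Y"

definition happs :: "ty list \<Rightarrow> ty list \<Rightarrow> tm list \<Rightarrow> tm list \<Rightarrow> tm list" where
  "happs \<sigma>s \<tau>s Ys xs = map2 (\<lambda>\<tau> Y. happ \<sigma>s \<tau> Y xs) \<tau>s Ys"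

text \<open>
  \<open>dst \<Phi> = (xs, ys, \<phi>)\<close> means that the interpretation of \<open>\<Phi>\<close> is \<open>\<exists>\<^sup>s\<^sup>tx \<forall>\<^sup>s\<^sup>ty \<phi>\<close>, where the types of
  the tuple \<open>y\<close> are \<open>ys\<close> and those of the tuple \<open>x\<close> are \<open>map Seq xs\<close>. In \<open>\<phi>\<close> the variables \<open>y\<close> are
  innermost, followed by \<open>x\<close>, followed by the free variables of \<open>\<Phi>\<close>.

  The comments list the variables of the scope in which the components of \<open>\<Phi>\<close> are placed, from
  outermost to innermost; they determine the offsets.
\<close>

primrec dst :: "fm \<Rightarrow> ty list \<times> ty list \<times> fm" where
  "dst (Eq s t) = ([], [], Eq s t)"
| "dst Fls = ([], [], Fls)"
| "dst (St \<sigma> t) = ([\<sigma>], [], mem \<sigma> (tlift t) (Var 0))"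
| "dst (And \<Phi> \<Psi>) =
    (let (xs, ys, \<phi>) = dst \<Phi>; (us, vs, \<psi>) = dst \<Psi>;
         m = length xs; k = length ys; p = length us; q = length vs
     in \<comment> \<open>\<open>x, u, y, v\<close>\<close>
       (xs @ us, ys @ vs,
        And (plug (vars (q + k + p) m @ vars q k) (q + k + p + m) \<phi>)
            (plug (vars (q + k) p @ vars 0 q) (q + k + p + m) \<psi>)))"
| "dst (Or \<Phi> \<Psi>) =
    (let (xs, ys, \<phi>) = dst \<Phi>; (us, vs, \<psi>) = dst \<Psi>;
         m = length xs; k = length ys; p = length us; q = length vs
     in \<comment> \<open>\<open>x, u, y, v\<close>\<close>
       (xs @ us, ys @ vs,
        Or (plug (vars (q + k + p) m @ vars q k) (q + k + p + m) \<phi>)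
           (plug (vars (q + k) p @ vars 0 q) (q + k + p + m) \<psi>)))"
| "dst (Imp \<Phi> \<Psi>) =
    (let (xs, ys, \<phi>) = dst \<Phi>; (us, vs, \<psi>) = dst \<Psi>;
         m = length xs; k = length ys; p = length us; q = length vs;
         X = map Seq xs
     in \<comment> \<open>\<open>U, Y, x, v\<close>, and then \<open>y\<close> around \<open>\<phi>\<close>\<close>
       (map (htype X) us @ map (htype (X @ vs)) ys, X @ vs,
        Imp (balls ys (happs (X @ vs) ys (vars (q + m) k) (vars q m @ vars 0 q))
              (plug (vars (k + q) m @ vars 0 k) (k + q + m + k + p) \<phi>))
            (plug (happs X us (vars (q + m + k) p) (vars q m) @ vars 0 q) (q + m + k + p) \<psi>)))"
| "dst (All \<sigma> \<Phi>) =
    (let (xs, ys, \<phi>) = dst \<Phi>; m = length xs; k = length ys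
     in \<comment> \<open>\<open>x, y, z\<close>\<close>
       (xs, ys,
        All \<sigma> (plug ([Var 0] @ vars (1 + k) m @ vars 1 k) (1 + k + m) \<phi>)))"
| "dst (Ex \<sigma> \<Phi>) =
    (let (xs, ys, \<phi>) = dst \<Phi>; m = length xs; k = length ys
     in \<comment> \<open>\<open>x, y, z, y'\<close>\<close>
       (xs, map Seq ys,
        Ex \<sigma> (balls ys (vars 1 k)
          (plug ([Var k] @ vars (k + 1 + k) m @ vars 0 k) (k + 1 + k + m) \<phi>))))"
| "dst (AllSt \<sigma> \<Phi>) =
    (let (xs, ys, \<phi>) = dst \<Phi>; m = length xs; k = length ys
     in \<comment> \<open>\<open>X, z, y\<close>\<close>
       (map (htype [\<sigma>]) xs, \<sigma> # ys,
        plug ([Var k] @ happs [\<sigma>] xs (vars (k + 1) m) [Var k] @ vars 0 k) (k + 1 + m) \<phi>))"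
| "dst (ExSt \<sigma> \<Phi>) =
    (let (xs, ys, \<phi>) = dst \<Phi>; m = length xs; k = length ys
     in \<comment> \<open>\<open>x, z, y, z', y'\<close>\<close>
       (xs @ [\<sigma>], map Seq ys,
        bex \<sigma> (Var k) (balls ys (vars 1 k)
          (plug ([Var k] @ vars (k + 1 + k + 1) m @ vars 0 k) (k + 1 + k + 1 + m) \<phi>))))"

definition Dst :: "fm \<Rightarrow> fm" where
  "Dst \<Phi> = (let (xs, ys, \<phi>) = dst \<Phi> in foldr ExSt (map Seq xs) (foldr AllSt ys \<phi>))"


section \<open>The theory H\<close>

inductive HAx :: "ty list \<Rightarrow> fm \<Rightarrow> bool" where
  EHAst: "EHAst \<Gamma> \<Phi> \<Longrightarrow> HAx \<Gamma> \<Phi>"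
| characterization: "wff \<Gamma> \<Phi> \<Longrightarrow> HAx \<Gamma> (Iff \<Phi> (Dst \<Phi>))"

text \<open>Provability in H of a formula with free variables in the context \<open>\<Gamma>\<close>.\<close>

definition H_proves :: "ty list \<Rightarrow> fm \<Rightarrow> bool" where
  "H_proves \<Gamma> \<Phi> \<longleftrightarrow> nd HAx \<Gamma> [] \<Phi>"

text \<open>
  In \<open>\<Phi>(n, x)\<close> the variable \<open>x\<close> has index 0 and \<open>n\<close> has index 1. In the conclusion, \<open>\<Phi>(n, f n)\<close> is
  in the scope of \<open>f\<close> (index 1) and \<open>n\<close> (index 0).
\<close>

definition CSAT :: "ty \<Rightarrow> fm \<Rightarrow> fm" where
  "CSAT \<sigma> \<Phi> = Imp (AllSt Nat (Ex \<sigma> \<Phi>))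
                  (Ex (Nat \<rightarrow> \<sigma>) (AllSt Nat (plug [Var 0, Var 1 \<cdot> Var 0] 2 \<Phi>)))"

end

theory Submission
  imports Defs
begin

text \<open>
  Write \<open>\<exists>\<^sup>s\<^sup>tx \<forall>\<^sup>s\<^sup>ty \<phi>(x, y, n, z)\<close> for the interpretation of \<open>\<Phi>(n, z)\<close>. The interpretation turns the premise
  \<open>\<forall>\<^sup>s\<^sup>tn \<exists>z \<Phi>(n, z)\<close> into
    \<open>\<exists>\<^sup>s\<^sup>tX \<forall>\<^sup>s\<^sup>tn, y \<exists>z \<forall>y' \<in> y. \<phi>(X[n], y', n, z)\<close>
  and the conclusion \<open>\<exists>f \<forall>\<^sup>s\<^sup>tn \<Phi>(n, f n)\<close> into
    \<open>\<exists>\<^sup>s\<^sup>tX \<forall>\<^sup>s\<^sup>ts, y \<exists>f \<forall>n \<in> s \<forall>y' \<in> y. \<phi>(X[n], y', n, f n)\<close>.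
  Since H proves every formula equivalent to its interpretation, it is enough to derive the second
  formula from the first one. The same \<open>X\<close> works. Fix \<open>X\<close> and \<open>y\<close>, and let \<open>\<chi>(n, z)\<close> be the internal
  formula \<open>\<forall>y' \<in> y. \<phi>(X[n], y', n, z)\<close> (\<open>kernel\<close> below). All that remains is a finite choice: if every
  standard \<open>n\<close> has some \<open>z\<close> with \<open>\<chi>(n, z)\<close>, then for every standard finite sequence \<open>s\<close> of numbers some
  function \<open>f\<close> satisfies \<open>\<chi>(n, f n)\<close> for all components \<open>n\<close> of \<open>s\<close>. This is \<open>prv_choice_on_seq\<close>. The
  interpretation has thus absorbed all uses of idealization and of choice for standard objects.

  The finite choice is proved by external induction on \<open>k\<close>: there is an \<open>f\<close> that is correct at the
  components of \<open>s\<close> with number below \<open>k\<close>. These components are standard, because \<open>s\<close> and their numbers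
  are, so the hypothesis on \<open>\<chi>\<close> applies to the next one and yields a value; \<open>f\<close> is then changed at
  that single argument. As a component may occur several times in \<open>s\<close>, it matters that \<open>\<chi>\<close>, being
  internal, respects extensional equality (\<open>prv_Leibniz\<close>). That a function can be changed at one argument
  (\<open>prv_updated\<close>) is proved by internal induction on the argument. This avoids a term that decides
  equality of numbers: the case distinction at \<open>n\<close> comes out of the same induction.

  The remaining work concerns the encoding. The interpretation has to be shown to commute with
  substitution (\<open>dst_fsubst\<close>), since the conclusion speaks of \<open>\<Phi>(n, f n)\<close>, and to preserve
  well-formedness (\<open>wff_dst\<close>), since the rules of deduction ask for it. The two interpretations displayed
  above are then computed by composing substitutions.
\<close>

section \<open>Parallel substitution\<close>

lemma tsubst_tsubst [simp]: "tsubst \<theta>' (tsubst \<theta> t) = tsubst (\<lambda>i. tsubst \<theta>' (\<theta> i)) t"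
  by (induction t) auto

lemma tsubst_Var [simp]: "tsubst Var t = t"
  by (induction t) auto

lemma up_0 [simp]: "up \<theta> 0 = Var 0"
  and up_Suc [simp]: "up \<theta> (Suc i) = tlift (\<theta> i)"
  by (auto simp: up_def)

lemma up_Var [simp]: "up Var = Var"
  by (auto simp: up_def fun_eq_iff split: nat.split)

text \<open>
  Pushing a substitution under a binder is functorial, which makes \<open>fsubst\<close> an action of parallel
  substitutions.
\<close>

lemma up_comp: "up (\<lambda>i. tsubst \<theta>' (\<theta> i)) = (\<lambda>i. tsubst (up \<theta>') (up \<theta> i))"
proof
  fix i show "up (\<lambda>i. tsubst \<theta>' (\<theta> i)) i = tsubst (up \<theta>') (up \<theta> i)"
    by (cases i) auto
qed

lemma fsubst_fsubst [simp]: "fsubst \<theta>' (fsubst \<theta> \<phi>) = fsubst (\<lambda>i. tsubst \<theta>' (\<theta> i)) \<phi>"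
  by (induction \<phi> arbitrary: \<theta> \<theta>') (auto simp: up_comp)

lemma fsubst_Var [simp]: "fsubst Var \<phi> = \<phi>"
  by (induction \<phi>) auto

lemma tsubst_closed: "wt [] t \<tau> \<Longrightarrow> tsubst \<theta> t = t"
  by (induction t arbitrary: \<tau>) auto

text \<open>
  The \<open>n\<close>-fold iterate of \<open>up\<close>, in a form that can be evaluated at each index.
\<close>

definition upn :: "nat \<Rightarrow> (nat \<Rightarrow> tm) \<Rightarrow> nat \<Rightarrow> tm" where
  "upn n \<theta> i = (if i < n then Var i else tsubst (\<lambda>j. Var (j + n)) (\<theta> (i - n)))"

lemma upn_0 [simp]: "upn 0 \<theta> = \<theta>"
  by (auto simp: upn_def fun_eq_iff)

lemma upn_Suc: "upn (Suc n) \<theta> = up (upn n \<theta>)"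
proof
  fix i show "upn (Suc n) \<theta> i = up (upn n \<theta>) i"
    by (cases i) (auto simp: upn_def)
qed

lemma upn_up: "upn n (up \<theta>) = upn (Suc n) \<theta>"
  by (induction n) (auto simp: upn_Suc)

lemma upn_upn [simp]: "upn n (upn m \<theta>) = upn (n + m) \<theta>"
  by (induction n) (auto simp: upn_Suc)

section \<open>Typing\<close>

lemma wt_unique: "wt \<Gamma> t \<sigma> \<Longrightarrow> wt \<Gamma> t \<tau> \<Longrightarrow> \<sigma> = \<tau>"
  by (induction t arbitrary: \<sigma> \<tau>) fastforce+

lemma wt_tyof: "wt \<Gamma> t \<tau> \<Longrightarrow> tyof \<Gamma> t = \<tau>"
  by (induction t arbitrary: \<tau>) fastforce+

lemma wt_tsubst: "wt \<Gamma> t \<tau> \<Longrightarrow> (\<And>i. i < length \<Gamma> \<Longrightarrow> wt \<Gamma>' (\<theta> i) (\<Gamma> ! i)) \<Longrightarrow> wt \<Gamma>' (tsubst \<theta> t) \<tau>"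
  by (induction t arbitrary: \<tau>) fastforce+

lemma wt_tlift [simp, intro]: "wt \<Gamma> t \<tau> \<Longrightarrow> wt (\<sigma> # \<Gamma>) (tlift t) \<tau>"
  by (erule wt_tsubst) auto

lemma wt_shift2 [simp]: "wt \<Gamma> t \<tau> \<Longrightarrow> wt (\<rho> # \<sigma> # \<Gamma>) (tsubst (\<lambda>i. Var (Suc (Suc i))) t) \<tau>"
  by (erule wt_tsubst) auto

lemma wt_shift3 [simp]:
  "wt \<Gamma> t \<tau> \<Longrightarrow> wt (\<rho> # \<sigma> # \<upsilon> # \<Gamma>) (tsubst (\<lambda>i. Var (Suc (Suc (Suc i)))) t) \<tau>"
  by (erule wt_tsubst) auto

lemma wt_weak: "wt [] t \<tau> \<Longrightarrow> wt \<Gamma> t \<tau>"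
  using wt_tsubst[of "[]" t \<tau> \<Gamma> Var] by simp

lemma wt_up:
  assumes "\<And>i. i < length \<Gamma> \<Longrightarrow> wt \<Gamma>' (\<theta> i) (\<Gamma> ! i)" and "i < length (\<sigma> # \<Gamma>)"
  shows "wt (\<sigma> # \<Gamma>') (up \<theta> i) ((\<sigma> # \<Gamma>) ! i)"
  using assms by (cases i) auto

lemma wff_fsubst:
  "wff \<Gamma> \<phi> \<Longrightarrow> (\<And>i. i < length \<Gamma> \<Longrightarrow> wt \<Gamma>' (\<theta> i) (\<Gamma> ! i)) \<Longrightarrow> wff \<Gamma>' (fsubst \<theta> \<phi>)"
proof (induction \<phi> arbitrary: \<Gamma> \<Gamma>' \<theta>)
  case (All \<sigma> \<phi>)
  have "wff (\<sigma> # \<Gamma>') (fsubst (up \<theta>) \<phi>)"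
    using All.prems(1) by (intro All.IH[of "\<sigma> # \<Gamma>"] wt_up[OF All.prems(2)]) simp_all
  then show ?case by simp
next
  case (Ex \<sigma> \<phi>)
  have "wff (\<sigma> # \<Gamma>') (fsubst (up \<theta>) \<phi>)"
    using Ex.prems(1) by (intro Ex.IH[of "\<sigma> # \<Gamma>"] wt_up[OF Ex.prems(2)]) simp_all
  then show ?case by simp
next
  case (AllSt \<sigma> \<phi>)
  have "wff (\<sigma> # \<Gamma>') (fsubst (up \<theta>) \<phi>)"
    using AllSt.prems(1) by (intro AllSt.IH[of "\<sigma> # \<Gamma>"] wt_up[OF AllSt.prems(2)]) simp_all
  then show ?case by simp
next
  case (ExSt \<sigma> \<phi>)
  have "wff (\<sigma> # \<Gamma>') (fsubst (up \<theta>) \<phi>)"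
    using ExSt.prems(1) by (intro ExSt.IH[of "\<sigma> # \<Gamma>"] wt_up[OF ExSt.prems(2)]) simp_all
  then show ?case by simp
qed (auto intro: wt_tsubst)

lemma wff_flift [simp, intro]: "wff \<Gamma> \<phi> \<Longrightarrow> wff (\<sigma> # \<Gamma>) (flift \<phi>)"
  by (erule wff_fsubst) auto

lemma wt_AppI: "wt \<Gamma> s (\<sigma> \<rightarrow> \<tau>) \<Longrightarrow> wt \<Gamma> t \<sigma> \<Longrightarrow> wt \<Gamma> (s \<cdot> t) \<tau>"
  by auto

text \<open>
  The type of the argument is computed instead of guessed, so that rewriting with this equation decides
  typing for the concrete closed combinators.
\<close>

lemma wt_App_tyof: "wt \<Gamma> (s \<cdot> t) \<tau> \<longleftrightarrow> wt \<Gamma> s (tyof \<Gamma> t \<rightarrow> \<tau>) \<and> wt \<Gamma> t (tyof \<Gamma> t)"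
  by (auto dest: wt_tyof)

lemma wt_lam: "wt (\<sigma> # \<Gamma>) t \<tau> \<Longrightarrow> wt \<Gamma> (lam \<Gamma> \<sigma> t) (\<sigma> \<rightarrow> \<tau>)"
proof (induction \<Gamma> \<sigma> t arbitrary: \<tau> rule: lam.induct)
  case (4 \<Gamma> \<sigma> s t)
  then obtain \<rho> where st: "wt (\<sigma> # \<Gamma>) s (\<rho> \<rightarrow> \<tau>)" "wt (\<sigma> # \<Gamma>) t \<rho>" by auto
  have "tyof (\<sigma> # \<Gamma>) t = \<rho>" "tyof (\<sigma> # \<Gamma>) (s \<cdot> t) = \<tau>"
    using st by (auto dest!: wt_tyof)
  with 4 st show ?case by (auto simp del: tyof.simps)
qed auto

lemma wt_zero: "wt [] (zero \<sigma>) \<sigma>"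
  by (induction \<sigma>) auto

lemma wt_add: "wt [] add (Nat \<rightarrow> Nat \<rightarrow> Nat)"
  by (simp add: add_def wt_App_tyof eval_nat_numeral del: wt.simps(3))

lemma wt_len: "wt [] (len \<sigma>) (Seq \<sigma> \<rightarrow> Nat)"
  by (simp add: len_def wt_App_tyof eval_nat_numeral del: wt.simps(3))

lemma wt_proj: "wt [] (proj \<sigma>) (Seq \<sigma> \<rightarrow> Nat \<rightarrow> \<sigma>)"
  by (simp add: proj_def wt_App_tyof eval_nat_numeral wt_zero wt_tyof[OF wt_zero] del: wt.simps(3))

lemma wt_append: "wt [] (append \<sigma>) (Seq \<sigma> \<rightarrow> Seq \<sigma> \<rightarrow> Seq \<sigma>)"
  by (simp add: append_def wt_App_tyof eval_nat_numeral del: wt.simps(3))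

lemma wt_bapp: "wt [] (bapp \<sigma> \<tau>) (Seq (\<sigma> \<rightarrow> Seq \<tau>) \<rightarrow> \<sigma> \<rightarrow> Seq \<tau>)"
proof -
  let ?T = "Seq (\<sigma> \<rightarrow> Seq \<tau>)"
  let ?s = "lam [\<sigma>, ?T] (Seq \<tau>) (lam [Seq \<tau>, \<sigma>, ?T] (\<sigma> \<rightarrow> Seq \<tau>) (append \<tau> \<cdot> (Var 0 \<cdot> Var 2) \<cdot> Var 1))"
  have "wt [\<sigma>, ?T] ?s (Seq \<tau> \<rightarrow> (\<sigma> \<rightarrow> Seq \<tau>) \<rightarrow> Seq \<tau>)"
    by (rule wt_lam)+ (simp add: wt_App_tyof eval_nat_numeral wt_append[THEN wt_weak] del: wt.simps(3))
  then have "wt [\<sigma>, ?T] (Con (Lc (\<sigma> \<rightarrow> Seq \<tau>) (Seq \<tau>)) \<cdot> Con (NilC \<tau>) \<cdot> ?s \<cdot> Var 1) (Seq \<tau>)"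
    by (intro wt_AppI) (assumption | simp)+
  then show ?thesis
    unfolding bapp_def Let_def by (intro wt_lam)
qed

lemmas closed_wt = wt_add wt_len wt_proj wt_bapp wt_zero
lemmas closed_wt_weak [simp] = closed_wt[THEN wt_weak]
lemmas closed_tsubst [simp] = closed_wt[THEN tsubst_closed]

lemma fsubst_less [simp]: "fsubst \<theta> (less s t) = less (tsubst \<theta> s) (tsubst \<theta> t)"
  by (simp add: less_def)

lemma fsubst_eq [simp]: "fsubst \<theta> (eq \<sigma> s t) = eq \<sigma> (tsubst \<theta> s) (tsubst \<theta> t)"
  by (induction \<sigma> arbitrary: s t \<theta>) simp_all

lemma fsubst_mem [simp]: "fsubst \<theta> (mem \<sigma> s t) = mem \<sigma> (tsubst \<theta> s) (tsubst \<theta> t)"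
  by (simp add: mem_def)

lemma fsubst_ball [simp]: "fsubst \<theta> (ball \<sigma> t \<phi>) = ball \<sigma> (tsubst \<theta> t) (fsubst (up \<theta>) \<phi>)"
  by (simp add: ball_def)

lemma fsubst_bex [simp]: "fsubst \<theta> (bex \<sigma> t \<phi>) = bex \<sigma> (tsubst \<theta> t) (fsubst (up \<theta>) \<phi>)"
  by (simp add: bex_def)

lemma fsubst_balls [simp]:
  "length \<sigma>s = length ts \<Longrightarrow>
    fsubst \<theta> (balls \<sigma>s ts \<phi>) = balls \<sigma>s (map (tsubst \<theta>) ts) (fsubst (upn (length ts) \<theta>) \<phi>)"
  by (induction \<sigma>s ts \<phi> arbitrary: \<theta> rule: balls.induct) (simp_all add: upn_up comp_def)

lemma wt_App2: "wt \<Gamma> c (\<rho> \<rightarrow> \<sigma> \<rightarrow> \<tau>) \<Longrightarrow> wt \<Gamma> (c \<cdot> s \<cdot> t) \<upsilon> \<longleftrightarrow> wt \<Gamma> s \<rho> \<and> wt \<Gamma> t \<sigma> \<and> \<upsilon> = \<tau>"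
  by (auto dest: wt_unique)

lemma wt_len_App [simp]: "wt \<Gamma> (len \<sigma> \<cdot> s) \<tau> \<longleftrightarrow> wt \<Gamma> s (Seq \<sigma>) \<and> \<tau> = Nat"
  by (auto intro!: exI[of _ "Seq \<sigma>"] dest: wt_unique[OF closed_wt_weak(2)])

lemmas wt_closed_App2 [simp] =
  wt_App2[OF closed_wt_weak(1)] wt_App2[OF closed_wt_weak(3)] wt_App2[OF closed_wt_weak(4)]

lemma wt_Succ_App [simp]: "wt \<Gamma> (Con Succ \<cdot> s) \<tau> \<longleftrightarrow> wt \<Gamma> s Nat \<and> \<tau> = Nat"
  by auto

text \<open>
  The equation for applications introduces an existential quantifier over types, which the rules for
  particular heads above do not.
\<close>

declare wt.simps(3) [simp del]

lemma wff_less [simp]: "wt \<Gamma> s Nat \<Longrightarrow> wt \<Gamma> t Nat \<Longrightarrow> wff \<Gamma> (less s t)"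
  by (auto simp: less_def)

lemma wff_eq [simp]: "wt \<Gamma> s \<sigma> \<Longrightarrow> wt \<Gamma> t \<sigma> \<Longrightarrow> wff \<Gamma> (eq \<sigma> s t)"
proof (induction \<sigma> arbitrary: \<Gamma> s t)
  case (Fun \<sigma> \<tau>)
  have "wt (\<sigma> # \<Gamma>) (tlift u \<cdot> Var 0) \<tau>" if "wt \<Gamma> u (\<sigma> \<rightarrow> \<tau>)" for u
    by (rule wt_AppI[OF wt_tlift[OF that]]) simp
  then show ?case using Fun by simp
qed auto

lemma wff_mem [simp]: "wt \<Gamma> s \<sigma> \<Longrightarrow> wt \<Gamma> t (Seq \<sigma>) \<Longrightarrow> wff \<Gamma> (mem \<sigma> s t)"
  by (simp add: mem_def)

lemma wff_ball [simp]: "wt \<Gamma> t (Seq \<sigma>) \<Longrightarrow> wff (\<sigma> # \<Gamma>) \<phi> \<Longrightarrow> wff \<Gamma> (ball \<sigma> t \<phi>)"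
  by (simp add: ball_def)

lemma wff_bex [simp]: "wt \<Gamma> t (Seq \<sigma>) \<Longrightarrow> wff (\<sigma> # \<Gamma>) \<phi> \<Longrightarrow> wff \<Gamma> (bex \<sigma> t \<phi>)"
  by (simp add: bex_def)

text \<open>
  The bounds live outside of all the quantifiers, whereas the body is below one new variable for each
  of them, the last one innermost.
\<close>

lemma wff_balls:
  "list_all2 (wt \<Gamma>) ts (map Seq \<sigma>s) \<Longrightarrow> wff (rev \<sigma>s @ \<Gamma>) \<phi> \<Longrightarrow> wff \<Gamma> (balls \<sigma>s ts \<phi>)"
proof (induction \<sigma>s ts \<phi> arbitrary: \<Gamma> rule: balls.induct)
  case (1 \<sigma> \<sigma>s t ts \<phi>)
  have "list_all2 (wt (\<sigma> # \<Gamma>)) (map tlift ts) (map Seq \<sigma>s)"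
    using "1.prems"(1) by (auto simp: list_all2_map1 elim!: list_all2_mono)
  with 1 show ?case by simp
qed auto

lemma internal_fsubst [simp]: "internal (fsubst \<theta> \<phi>) = internal \<phi>"
  by (induction \<phi> arbitrary: \<theta>) auto

lemma internal_eq [simp]: "internal (eq \<sigma> s t)"
  by (induction \<sigma> arbitrary: s t) (auto simp: less_def)

lemma internal_mem [simp]: "internal (mem \<sigma> s t)"
  by (simp add: mem_def less_def)

lemma internal_balls [simp]: "internal (balls \<sigma>s ts \<phi>) = internal \<phi>"
  by (induction \<sigma>s ts \<phi> rule: balls.induct) (auto simp: ball_def)

lemma internal_bex [simp]: "internal (bex \<sigma> t \<phi>) = internal \<phi>"
  by (simp add: bex_def)

section \<open>The interpretation commutes with substitution and preserves well-formedness\<close>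

text \<open>
  The substitution underlying \<open>plug\<close>. Having a name for it, compositions of nested \<open>plug\<close>s can be
  evaluated to a single list of terms.
\<close>

definition psub :: "tm list \<Rightarrow> nat \<Rightarrow> nat \<Rightarrow> tm" where
  "psub ts d i = (if i < length ts then rev ts ! i else Var (i - length ts + d))"

lemma plug_psub: "plug ts d = fsubst (psub ts d)"
  by (simp add: plug_def psub_def[abs_def])

text \<open>
  Here \<open>d\<close> counts the variables of the new scope, so that below them \<open>\<theta>\<close> acts only on the terms \<open>ts\<close> and
  on the variables that \<open>plug\<close> leaves alone.
\<close>

lemma fsubst_upn_plug:
  assumes "e = d" "n = length ts"
  shows "fsubst (upn e \<theta>) (plug ts d \<phi>) = plug (map (tsubst (upn e \<theta>)) ts) d (fsubst (upn n \<theta>) \<phi>)"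
proof -
  have "tsubst (upn d \<theta>) (psub ts d i) =
      tsubst (psub (map (tsubst (upn d \<theta>)) ts) d) (upn (length ts) \<theta> i)" for i
  proof (cases "i < length ts")
    case True
    then show ?thesis by (simp add: psub_def upn_def rev_nth)
  next
    case False
    then obtain j where "i = length ts + j"
      using le_Suc_ex not_less by blast
    then show ?thesis by (simp add: psub_def[abs_def] upn_def)
  qed
  then show ?thesis unfolding plug_psub assms by simp
qed

lemma upn_less [simp]: "i < n \<Longrightarrow> upn n \<theta> i = Var i"
  by (simp add: upn_def)

lemma length_vars [simp]: "length (vars off n) = n"
  by (simp add: vars_def)

lemma vars_fixed [simp]: "off + n \<le> N \<Longrightarrow> map (tsubst (upn N \<theta>)) (vars off n) = vars off n"
  by (auto simp: vars_def upn_def)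

lemma tsubst_happ: "tsubst \<theta> (happ \<sigma>s \<tau> Y xs) = happ \<sigma>s \<tau> (tsubst \<theta> Y) (map (tsubst \<theta>) xs)"
  by (induction \<sigma>s \<tau> Y xs rule: happ.induct) auto

lemma map_tsubst_happs [simp]:
  "map (tsubst \<theta>) (happs \<sigma>s \<tau>s Ys xs) = happs \<sigma>s \<tau>s (map (tsubst \<theta>) Ys) (map (tsubst \<theta>) xs)"
  unfolding happs_def by (induction \<tau>s Ys rule: list_induct2') (auto simp: tsubst_happ)

lemma length_happs [simp]: "length (happs \<sigma>s \<tau>s Ys xs) = min (length \<tau>s) (length Ys)"
  by (simp add: happs_def)

text \<open>
  All tuples introduced by the interpretation are variables bound by it or closed terms applied to
  these, so a substitution for the free variables passes through to the matrices of the components.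
\<close>

lemma dst_fsubst:
  "dst \<Phi> = (xs, ys, \<phi>) \<Longrightarrow>
    dst (fsubst \<theta> \<Phi>) = (xs, ys, fsubst (upn (length xs + length ys) \<theta>) \<phi>)"
proof (induction \<Phi> arbitrary: \<theta> xs ys \<phi>)
  case (St \<sigma> t)
  then show ?case by (auto simp: upn_Suc)
next
  case (And \<Phi> \<Psi>)
  obtain xs1 ys1 \<phi>1 xs2 ys2 \<phi>2 where "dst \<Phi> = (xs1, ys1, \<phi>1)" "dst \<Psi> = (xs2, ys2, \<phi>2)"
    by (metis prod_cases3)
  with And show ?case by (auto simp: Let_def fsubst_upn_plug)
next
  case (Or \<Phi> \<Psi>)
  obtain xs1 ys1 \<phi>1 xs2 ys2 \<phi>2 where "dst \<Phi> = (xs1, ys1, \<phi>1)" "dst \<Psi> = (xs2, ys2, \<phi>2)"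
    by (metis prod_cases3)
  with Or show ?case by (auto simp: Let_def fsubst_upn_plug)
next
  case (Imp \<Phi> \<Psi>)
  obtain xs1 ys1 \<phi>1 xs2 ys2 \<phi>2 where "dst \<Phi> = (xs1, ys1, \<phi>1)" "dst \<Psi> = (xs2, ys2, \<phi>2)"
    by (metis prod_cases3)
  with Imp show ?case by (auto simp: Let_def fsubst_upn_plug)
next
  case (All \<sigma> \<Phi>)
  obtain xs1 ys1 \<phi>1 where "dst \<Phi> = (xs1, ys1, \<phi>1)"
    by (metis prod_cases3)
  with All show ?case by (auto simp: Let_def fsubst_upn_plug upn_up upn_Suc[symmetric]) 
next
  case (Ex \<sigma> \<Phi>)
  obtain xs1 ys1 \<phi>1 where "dst \<Phi> = (xs1, ys1, \<phi>1)"
    by (metis prod_cases3)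
  with Ex show ?case by (auto simp: Let_def fsubst_upn_plug upn_up upn_Suc[symmetric])
next
  case (AllSt \<sigma> \<Phi>)
  obtain xs1 ys1 \<phi>1 where "dst \<Phi> = (xs1, ys1, \<phi>1)"
    by (metis prod_cases3)
  with AllSt show ?case by (auto simp: Let_def fsubst_upn_plug upn_up upn_Suc[symmetric])
next
  case (ExSt \<sigma> \<Phi>)
  obtain xs1 ys1 \<phi>1 where "dst \<Phi> = (xs1, ys1, \<phi>1)"
    by (metis prod_cases3)
  with ExSt show ?case by (auto simp: Let_def fsubst_upn_plug upn_up upn_Suc[symmetric])
qed auto

lemma internal_plug [simp]: "internal (plug ts d \<phi>) = internal \<phi>"
  by (simp add: plug_psub)

lemma internal_dst: "dst \<Phi> = (xs, ys, \<phi>) \<Longrightarrow> internal \<phi>"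
  by (induction \<Phi> arbitrary: xs ys \<phi>) (auto simp: Let_def split: prod.splits)

text \<open>
  \<open>G\<close> is the block of variables in the new context inside of which the untouched variables are found.
\<close>

lemma wff_plug:
  assumes "wff (rev \<tau>s @ \<Gamma>) \<phi>" "list_all2 (wt \<Gamma>') ts \<tau>s" "\<Gamma>' = G @ \<Gamma>" "d = length G"
  shows "wff \<Gamma>' (plug ts d \<phi>)"
  unfolding plug_psub
proof (rule wff_fsubst[OF assms(1)])
  fix i assume i: "i < length (rev \<tau>s @ \<Gamma>)"
  have l: "length ts = length \<tau>s" using assms(2) by (rule list_all2_lengthD)
  have "list_all2 (wt \<Gamma>') (rev ts) (rev \<tau>s)" using assms(2) by simp
  then show "wt \<Gamma>' (psub ts d i) ((rev \<tau>s @ \<Gamma>) ! i)"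
    using i l assms(3,4) by (auto simp: psub_def nth_append list_all2_conv_all_nth)
qed

lemma wt_vars:
  "\<Gamma> = A @ rev \<tau>s @ B \<Longrightarrow> off = length A \<Longrightarrow> n = length \<tau>s \<Longrightarrow> list_all2 (wt \<Gamma>) (vars off n) \<tau>s"
  by (auto simp: vars_def list_all2_conv_all_nth rev_nth nth_append)

lemma wt_happ:
  "wt \<Gamma> Y (Seq (htype \<sigma>s \<tau>)) \<Longrightarrow> list_all2 (wt \<Gamma>) xs \<sigma>s \<Longrightarrow> wt \<Gamma> (happ \<sigma>s \<tau> Y xs) (Seq \<tau>)"
  by (induction \<sigma>s \<tau> Y xs rule: happ.induct) auto

lemma wt_happs:
  assumes "list_all2 (wt \<Gamma>) Ys (map Seq (map (htype \<sigma>s) \<tau>s))" "list_all2 (wt \<Gamma>) xs \<sigma>s"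
  shows "list_all2 (wt \<Gamma>) (happs \<sigma>s \<tau>s Ys xs) (map Seq \<tau>s)"
  using assms by (auto simp: happs_def list_all2_conv_all_nth intro!: wt_happ)

text \<open>
  The two components of a conjunction or disjunction, placed into the common scope \<open>x, u, y, v\<close>.
\<close>

lemma wff_plug_pair:
  assumes w: "wff (rev (xs1 @ ys1) @ \<Gamma>) \<phi>1" "wff (rev (xs2 @ ys2) @ \<Gamma>) \<phi>2"
    and l: "m = length xs1" "k = length ys1" "p = length xs2" "q = length ys2"
    and G: "G = rev ys2 @ rev ys1 @ rev xs2 @ rev xs1 @ \<Gamma>"
  shows "wff G (plug (vars (q + k + p) m @ vars q k) (q + k + p + m) \<phi>1)"
    and "wff G (plug (vars (q + k) p @ vars 0 q) (q + k + p + m) \<phi>2)"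
proof -
  have v: "list_all2 (wt G) (vars (q + k + p) m) xs1" "list_all2 (wt G) (vars q k) ys1"
    "list_all2 (wt G) (vars (q + k) p) xs2" "list_all2 (wt G) (vars 0 q) ys2"
    by (rule wt_vars[of _ "rev ys2 @ rev ys1 @ rev xs2"] wt_vars[of _ "rev ys2 @ rev ys1"]
        wt_vars[of _ "rev ys2"] wt_vars[of _ "[]"]; simp add: l G)+
  show "wff G (plug (vars (q + k + p) m @ vars q k) (q + k + p + m) \<phi>1)"
    by (rule wff_plug[OF w(1), where G="rev ys2 @ rev ys1 @ rev xs2 @ rev xs1"])
      (intro list_all2_appendI v, simp_all add: l G)
  show "wff G (plug (vars (q + k) p @ vars 0 q) (q + k + p + m) \<phi>2)"
    by (rule wff_plug[OF w(2), where G="rev ys2 @ rev ys1 @ rev xs2 @ rev xs1"])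
      (intro list_all2_appendI v, simp_all add: l G)
qed

text \<open>
  In each case the context of the matrix is split into the blocks named in the definition of \<open>dst\<close>, and
  the offsets of the tuples are the lengths of the blocks to their right.
\<close>

lemma wff_dst:
  "wff \<Gamma> \<Phi> \<Longrightarrow> dst \<Phi> = (xs, ys, \<phi>) \<Longrightarrow> wff (rev ys @ rev (map Seq xs) @ \<Gamma>) \<phi>"
proof (induction \<Phi> arbitrary: \<Gamma> xs ys \<phi>)
  case (St \<sigma> t)
  then show ?case by auto
next
  case (And \<Phi> \<Psi>)
  obtain xs1 ys1 \<phi>1 xs2 ys2 \<phi>2 where d: "dst \<Phi> = (xs1, ys1, \<phi>1)" "dst \<Psi> = (xs2, ys2, \<phi>2)"
    by (metis prod_cases3)
  have "wff (rev (map Seq xs1 @ ys1) @ \<Gamma>) \<phi>1" "wff (rev (map Seq xs2 @ ys2) @ \<Gamma>) \<phi>2"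
    using And.IH d And.prems by auto
  note wff_plug_pair[OF this, of "length xs1" "length ys1" "length xs2" "length ys2", OF _ _ _ _ HOL.refl]
  then show ?case using And.prems d by (auto simp: Let_def rev_map)
next
  case (Or \<Phi> \<Psi>)
  obtain xs1 ys1 \<phi>1 xs2 ys2 \<phi>2 where d: "dst \<Phi> = (xs1, ys1, \<phi>1)" "dst \<Psi> = (xs2, ys2, \<phi>2)"
    by (metis prod_cases3)
  have "wff (rev (map Seq xs1 @ ys1) @ \<Gamma>) \<phi>1" "wff (rev (map Seq xs2 @ ys2) @ \<Gamma>) \<phi>2"
    using Or.IH d Or.prems by auto
  note wff_plug_pair[OF this, of "length xs1" "length ys1" "length xs2" "length ys2", OF _ _ _ _ HOL.refl]
  then show ?case using Or.prems d by (auto simp: Let_def rev_map)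
next
  case (Imp \<Phi> \<Psi>)
  obtain xs1 ys1 \<phi>1 xs2 ys2 \<phi>2 where d: "dst \<Phi> = (xs1, ys1, \<phi>1)" "dst \<Psi> = (xs2, ys2, \<phi>2)"
    by (metis prod_cases3)
  let ?X = "map Seq xs1" and ?V = "map Seq xs2"
  let ?U = "map Seq (map (htype ?X) xs2)" and ?Y = "map Seq (map (htype (?X @ ys2)) ys1)"
  let ?G = "rev ys2 @ rev ?X @ rev ?Y @ rev ?U @ \<Gamma>"
  let ?q = "length ys2" and ?m = "length xs1" and ?k = "length ys1" and ?p = "length xs2"
  have w: "wff (rev (?X @ ys1) @ \<Gamma>) \<phi>1" "wff (rev (?V @ ys2) @ \<Gamma>) \<phi>2"
    using Imp.IH d Imp.prems by auto
  have v: "list_all2 (wt ?G) (vars ?q ?m) ?X"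
    "list_all2 (wt ?G) (vars 0 ?q) ys2"
    "list_all2 (wt ?G) (vars (?q + ?m) ?k) ?Y"
    "list_all2 (wt ?G) (vars (?q + ?m + ?k) ?p) ?U"
    by (rule wt_vars[of _ "rev ys2 @ rev ?X @ rev ?Y"] wt_vars[of _ "rev ys2 @ rev ?X"]
        wt_vars[of _ "rev ys2"] wt_vars[of _ "[]"]; simp)+
  have v2: "list_all2 (wt (rev ys1 @ ?G)) (vars (?k + ?q) ?m) ?X"
    "list_all2 (wt (rev ys1 @ ?G)) (vars 0 ?k) ys1"
    by (rule wt_vars[of _ "rev ys1 @ rev ys2"] wt_vars[of _ "[]"]; simp)+
  have "wff (rev ys1 @ ?G) (plug (vars (?k + ?q) ?m @ vars 0 ?k) (?k + ?q + ?m + ?k + ?p) \<phi>1)"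
    by (rule wff_plug[OF w(1), where G="rev ys1 @ rev ys2 @ rev ?X @ rev ?Y @ rev ?U"])
      (intro list_all2_appendI v2, simp_all)
  moreover have "list_all2 (wt ?G)
      (happs (?X @ ys2) ys1 (vars (?q + ?m) ?k) (vars ?q ?m @ vars 0 ?q)) (map Seq ys1)"
    by (rule wt_happs[OF v(3)]) (intro list_all2_appendI v)
  ultimately have "wff ?G (balls ys1 (happs (?X @ ys2) ys1 (vars (?q + ?m) ?k) (vars ?q ?m @ vars 0 ?q))
     (plug (vars (?k + ?q) ?m @ vars 0 ?k) (?k + ?q + ?m + ?k + ?p) \<phi>1))"
    by (rule wff_balls[rotated])
  moreover have "wff ?G (plug (happs ?X xs2 (vars (?q + ?m + ?k) ?p) (vars ?q ?m) @ vars 0 ?q)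
      (?q + ?m + ?k + ?p) \<phi>2)"
    by (rule wff_plug[OF w(2), where G="rev ys2 @ rev ?X @ rev ?Y @ rev ?U"])
      (auto intro!: list_all2_appendI v wt_happs simp del: map_map)
  ultimately show ?case using Imp.prems d by (auto simp: Let_def rev_map)
next
  case (All \<sigma> \<Phi>)
  obtain xs1 ys1 \<phi>1 where d: "dst \<Phi> = (xs1, ys1, \<phi>1)"
    by (metis prod_cases3)
  let ?X = "map Seq xs1"
  let ?G = "\<sigma> # rev ys1 @ rev ?X @ \<Gamma>"
  let ?m = "length xs1" and ?k = "length ys1"
  have w: "wff (rev ([\<sigma>] @ ?X @ ys1) @ \<Gamma>) \<phi>1"
    using All.IH[OF _ d] All.prems by auto
  have v: "list_all2 (wt ?G) (vars (1 + ?k) ?m) ?X" "list_all2 (wt ?G) (vars 1 ?k) ys1"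
    by (rule wt_vars[of _ "\<sigma> # rev ys1"] wt_vars[of _ "[\<sigma>]"]; simp)+
  have "wff ?G (plug ([Var 0] @ vars (1 + ?k) ?m @ vars 1 ?k) (1 + ?k + ?m) \<phi>1)"
    by (rule wff_plug[OF w, where G="\<sigma> # rev ys1 @ rev ?X"]) (intro list_all2_appendI v, simp_all)
  then show ?case using All.prems d by (auto simp: Let_def rev_map)
next
  case (Ex \<sigma> \<Phi>)
  obtain xs1 ys1 \<phi>1 where d: "dst \<Phi> = (xs1, ys1, \<phi>1)"
    by (metis prod_cases3)
  let ?X = "map Seq xs1" and ?Y = "map Seq ys1"
  let ?G = "\<sigma> # rev ?Y @ rev ?X @ \<Gamma>"
  let ?m = "length xs1" and ?k = "length ys1"
  have w: "wff (rev ([\<sigma>] @ ?X @ ys1) @ \<Gamma>) \<phi>1"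
    using Ex.IH[OF _ d] Ex.prems by auto
  have v: "list_all2 (wt (rev ys1 @ ?G)) (vars (?k + 1 + ?k) ?m) ?X"
    "list_all2 (wt (rev ys1 @ ?G)) (vars 0 ?k) ys1"
    "list_all2 (wt ?G) (vars 1 ?k) ?Y"
    by (rule wt_vars[of _ "rev ys1 @ \<sigma> # rev ?Y"] wt_vars[of _ "[]"] wt_vars[of _ "[\<sigma>]"]; simp)+
  have "wff (rev ys1 @ ?G) (plug ([Var ?k] @ vars (?k + 1 + ?k) ?m @ vars 0 ?k) (?k + 1 + ?k + ?m) \<phi>1)"
    by (rule wff_plug[OF w, where G="rev ys1 @ \<sigma> # rev ?Y @ rev ?X"])
      (intro list_all2_appendI v, simp_all add: nth_append)
  then have "wff ?G (balls ys1 (vars 1 ?k)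
      (plug ([Var ?k] @ vars (?k + 1 + ?k) ?m @ vars 0 ?k) (?k + 1 + ?k + ?m) \<phi>1))"
    by (rule wff_balls[OF v(3)])
  then show ?case using Ex.prems d by (auto simp: Let_def rev_map)
next
  case (AllSt \<sigma> \<Phi>)
  obtain xs1 ys1 \<phi>1 where d: "dst \<Phi> = (xs1, ys1, \<phi>1)"
    by (metis prod_cases3)
  let ?X = "map Seq (map (htype [\<sigma>]) xs1)" and ?V = "map Seq xs1"
  let ?G = "rev ys1 @ \<sigma> # rev ?X @ \<Gamma>"
  let ?m = "length xs1" and ?k = "length ys1"
  have w: "wff (rev ([\<sigma>] @ ?V @ ys1) @ \<Gamma>) \<phi>1"
    using AllSt.IH[OF _ d] AllSt.prems by auto
  have v: "list_all2 (wt ?G) (vars (?k + 1) ?m) ?X" "list_all2 (wt ?G) (vars 0 ?k) ys1"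
    by (rule wt_vars[of _ "rev ys1 @ [\<sigma>]"] wt_vars[of _ "[]"]; simp)+
  have "wff ?G (plug ([Var ?k] @ happs [\<sigma>] xs1 (vars (?k + 1) ?m) [Var ?k] @ vars 0 ?k) (?k + 1 + ?m) \<phi>1)"
    by (rule wff_plug[OF w, where G="rev ys1 @ \<sigma> # rev ?X"])
      (intro list_all2_appendI v wt_happs, simp_all add: nth_append)
  then show ?case using AllSt.prems d by (auto simp: Let_def rev_map)
next
  case (ExSt \<sigma> \<Phi>)
  obtain xs1 ys1 \<phi>1 where d: "dst \<Phi> = (xs1, ys1, \<phi>1)"
    by (metis prod_cases3)
  let ?X = "map Seq xs1" and ?Y = "map Seq ys1"
  let ?G = "\<sigma> # rev ?Y @ Seq \<sigma> # rev ?X @ \<Gamma>"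
  let ?m = "length xs1" and ?k = "length ys1"
  have w: "wff (rev ([\<sigma>] @ ?X @ ys1) @ \<Gamma>) \<phi>1"
    using ExSt.IH[OF _ d] ExSt.prems by auto
  have v: "list_all2 (wt (rev ys1 @ ?G)) (vars (?k + 1 + ?k + 1) ?m) ?X"
    "list_all2 (wt (rev ys1 @ ?G)) (vars 0 ?k) ys1"
    "list_all2 (wt ?G) (vars 1 ?k) ?Y"
    by (rule wt_vars[of _ "rev ys1 @ \<sigma> # rev ?Y @ [Seq \<sigma>]"] wt_vars[of _ "[]"] wt_vars[of _ "[\<sigma>]"]; simp)+
  have "wff (rev ys1 @ ?G)
      (plug ([Var ?k] @ vars (?k + 1 + ?k + 1) ?m @ vars 0 ?k) (?k + 1 + ?k + 1 + ?m) \<phi>1)"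
    by (rule wff_plug[OF w, where G="rev ys1 @ \<sigma> # rev ?Y @ Seq \<sigma> # rev ?X"])
      (intro list_all2_appendI v, simp_all add: nth_append)
  then have "wff ?G (balls ys1 (vars 1 ?k)
      (plug ([Var ?k] @ vars (?k + 1 + ?k + 1) ?m @ vars 0 ?k) (?k + 1 + ?k + 1 + ?m) \<phi>1))"
    by (rule wff_balls[OF v(3)])
  then show ?case using ExSt.prems d by (auto simp: Let_def rev_map nth_append intro!: wff_bex)
qed auto

section \<open>Derived rules of inference\<close>

lemma psub_simps [simp]:
  "psub [t] d 0 = t" "psub [t] d (Suc i) = Var (i + d)"
  "psub [s, t] d 0 = t" "psub [s, t] d (Suc 0) = s" "psub [s, t] d (Suc (Suc i)) = Var (i + d)"
  by (auto simp: psub_def)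

lemma nd_weaken: "nd Ax \<Gamma> \<Delta> \<Phi> \<Longrightarrow> set \<Delta> \<subseteq> set \<Delta>' \<Longrightarrow> nd Ax \<Gamma> \<Delta>' \<Phi>"
proof (induction arbitrary: \<Delta>' rule: nd.induct)
  case (Axm \<Gamma> \<Phi> \<Delta>)
  then show ?case by (simp add: nd.Axm)
next
  case (Asm \<Phi> \<Delta> \<Gamma>)
  then show ?case by (intro nd.Asm) auto
next
  case (OrE \<Gamma> \<Delta> \<Phi> \<Psi> \<chi>)
  show ?case by (rule nd.OrE[OF OrE.IH]) (use OrE.prems in auto)
next
  case (ImpI \<Gamma> \<Phi> \<Delta> \<Psi>)
  show ?case by (rule nd.ImpI[OF ImpI.hyps(1) ImpI.IH]) (use ImpI.prems in auto)
next
  case (AllI \<sigma> \<Gamma> \<Delta> \<Phi>)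
  show ?case by (rule nd.AllI[OF AllI.IH]) (use AllI.prems in auto)
next
  case (ExE \<Gamma> \<Delta> \<sigma> \<Phi> \<chi>)
  show ?case
    by (rule nd.ExE[OF ExE.IH(1) ExE.IH(2)]) (use ExE.prems ExE.hyps in auto)
next
  case (FlsE \<Gamma> \<Delta> \<Phi>)
  show ?case by (rule nd.FlsE[OF FlsE.IH]) (use FlsE in auto)
next
  case (AndE1 \<Gamma> \<Delta> \<Phi> \<Psi>)
  show ?case by (rule nd.AndE1[OF AndE1.IH]) (use AndE1 in auto)
next
  case (AndE2 \<Gamma> \<Delta> \<Phi> \<Psi>)
  show ?case by (rule nd.AndE2[OF AndE2.IH]) (use AndE2 in auto)
next
  case (ImpE \<Gamma> \<Delta> \<Phi> \<Psi>)
  show ?case by (rule nd.ImpE[OF ImpE.IH]) (use ImpE in auto)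
next
  case (AllE \<Gamma> \<Delta> \<sigma> \<Phi> t)
  show ?case by (rule nd.AllE[OF AllE.IH]) (use AllE in auto)
qed (simp_all add: nd.AndI nd.OrI1 nd.OrI2 nd.ExI)

abbreviation prv :: "ty list \<Rightarrow> fm list \<Rightarrow> fm \<Rightarrow> bool" where
  "prv \<equiv> nd HAx"

lemma prv_EHA: "EHA \<Gamma> \<Phi> \<Longrightarrow> prv \<Gamma> \<Delta> \<Phi>"
  and prv_EHAst: "EHAst \<Gamma> \<Phi> \<Longrightarrow> prv \<Gamma> \<Delta> \<Phi>"
  by (auto intro: nd.Axm HAx.EHAst EHAst.EHA)

lemma prv_cut: "prv \<Gamma> \<Delta> \<Phi> \<Longrightarrow> wff \<Gamma> \<Phi> \<Longrightarrow> prv \<Gamma> (\<Phi> # \<Delta>) \<Psi> \<Longrightarrow> prv \<Gamma> \<Delta> \<Psi>"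
  by (rule nd.ImpE[OF nd.ImpI])

lemma prv_mp: "prv \<Gamma> \<Delta> (Imp \<Phi> \<Psi>) \<Longrightarrow> prv \<Gamma> \<Delta> \<Phi> \<Longrightarrow> prv \<Gamma> \<Delta> \<Psi>"
  by (rule nd.ImpE)

lemma prv_AllE: "prv \<Gamma> \<Delta> (All \<sigma> \<Phi>) \<Longrightarrow> wt \<Gamma> t \<sigma> \<Longrightarrow> fsubst (psub [t] 0) \<Phi> = \<Psi> \<Longrightarrow> prv \<Gamma> \<Delta> \<Psi>"
  using nd.AllE[of HAx \<Gamma> \<Delta> \<sigma> \<Phi> t] by (simp add: plug_psub)

lemma prv_ExI: "prv \<Gamma> \<Delta> (fsubst (psub [t] 0) \<Phi>) \<Longrightarrow> wt \<Gamma> t \<sigma> \<Longrightarrow> wff (\<sigma> # \<Gamma>) \<Phi> \<Longrightarrow> prv \<Gamma> \<Delta> (Ex \<sigma> \<Phi>)"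
  using nd.ExI[of \<sigma> \<Gamma> \<Phi> t] by (simp add: plug_psub)

lemma inst_Var_lift: "(\<lambda>i. tsubst (psub [Var 0] 0) (up (\<lambda>i. Var (Suc i)) i)) = Var"
proof
  fix i show "tsubst (psub [Var 0] 0) (up (\<lambda>i. Var (Suc i)) i) = Var i"
    by (cases i) auto
qed

lemma wff_up_lift: "wff (\<sigma> # \<Gamma>) \<Phi> \<Longrightarrow> wff (\<sigma> # \<rho> # \<Gamma>) (fsubst (up (\<lambda>i. Var (Suc i))) \<Phi>)"
  using wff_flift[of \<Gamma> "All \<sigma> \<Phi>"] by simp

text \<open>
  Going under the binder of a quantified assumption is instantiation with the new variable after
  weakening; substituting the variable with index 0 undoes the shift (\<open>inst_Var_lift\<close>).
\<close>

lemma prv_All_lift: "All \<sigma> \<Phi> \<in> set \<Delta> \<Longrightarrow> wff (\<sigma> # \<Gamma>) \<Phi> \<Longrightarrow> prv (\<sigma> # \<Gamma>) (map flift \<Delta>) \<Phi>"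
  by (rule prv_AllE[OF nd.Asm, where t="Var 0"])
    (force simp: inst_Var_lift wff_up_lift)+

lemma prv_Ex_lift: "prv (\<sigma> # \<Gamma>) \<Delta> \<Phi> \<Longrightarrow> wff (\<sigma> # \<Gamma>) \<Phi> \<Longrightarrow> prv (\<sigma> # \<Gamma>) \<Delta> (flift (Ex \<sigma> \<Phi>))"
  by (simp, rule prv_ExI[where t="Var 0"])
    (force simp: inst_Var_lift wff_up_lift)+

section \<open>Extensional equality is a congruence\<close>

text \<open>
  Provable equality together with the typing of both sides, so that chains of equations do not
  accumulate side conditions.
\<close>

definition eqd :: "ty list \<Rightarrow> fm list \<Rightarrow> ty \<Rightarrow> tm \<Rightarrow> tm \<Rightarrow> bool" where
  "eqd \<Gamma> \<Delta> \<sigma> s t \<longleftrightarrow> wt \<Gamma> s \<sigma> \<and> wt \<Gamma> t \<sigma> \<and> prv \<Gamma> \<Delta> (eq \<sigma> s t)"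

lemma eqdI: "wt \<Gamma> s \<sigma> \<Longrightarrow> wt \<Gamma> t \<sigma> \<Longrightarrow> prv \<Gamma> \<Delta> (eq \<sigma> s t) \<Longrightarrow> eqd \<Gamma> \<Delta> \<sigma> s t"
  and eqd_wt1: "eqd \<Gamma> \<Delta> \<sigma> s t \<Longrightarrow> wt \<Gamma> s \<sigma>"
  and eqd_wt2: "eqd \<Gamma> \<Delta> \<sigma> s t \<Longrightarrow> wt \<Gamma> t \<sigma>"
  and eqd_prv: "eqd \<Gamma> \<Delta> \<sigma> s t \<Longrightarrow> prv \<Gamma> \<Delta> (eq \<sigma> s t)"
  by (auto simp: eqd_def)

lemma eqd_Nat: "eqd \<Gamma> \<Delta> Nat s t \<longleftrightarrow> wt \<Gamma> s Nat \<and> wt \<Gamma> t Nat \<and> prv \<Gamma> \<Delta> (Eq s t)"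
  by (simp add: eqd_def)

lemma eqd_Asm: "eq \<sigma> s t \<in> set \<Delta> \<Longrightarrow> wt \<Gamma> s \<sigma> \<Longrightarrow> wt \<Gamma> t \<sigma> \<Longrightarrow> eqd \<Gamma> \<Delta> \<sigma> s t"
  by (auto simp: eqd_def intro: nd.Asm)

lemma eqd_fun1: "eqd \<Gamma> \<Delta> (\<sigma> \<rightarrow> \<tau>) s t \<Longrightarrow> wt \<Gamma> u \<sigma> \<Longrightarrow> eqd \<Gamma> \<Delta> \<tau> (s \<cdot> u) (t \<cdot> u)"
  unfolding eqd_def by (auto intro: wt_AppI elim!: prv_AllE)

lemma eqd_arg: "wt \<Gamma> f (\<sigma> \<rightarrow> \<tau>) \<Longrightarrow> eqd \<Gamma> \<Delta> \<sigma> s t \<Longrightarrow> eqd \<Gamma> \<Delta> \<tau> (f \<cdot> s) (f \<cdot> t)"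
  unfolding eqd_def by (auto intro: wt_AppI prv_mp[OF prv_EHA[OF EHA.ext]])

lemma eqd_funI:
  assumes "wt \<Gamma> s (\<sigma> \<rightarrow> \<tau>)" "wt \<Gamma> t (\<sigma> \<rightarrow> \<tau>)"
    "eqd (\<sigma> # \<Gamma>) (map flift \<Delta>) \<tau> (tlift s \<cdot> Var 0) (tlift t \<cdot> Var 0)"
  shows "eqd \<Gamma> \<Delta> (\<sigma> \<rightarrow> \<tau>) s t"
  using assms unfolding eqd_def by (auto intro: nd.AllI)

lemma eqd_Nat_refl: "wt \<Gamma> s Nat \<Longrightarrow> eqd \<Gamma> \<Delta> Nat s s"
  by (simp add: eqd_Nat prv_EHA EHA.refl)

lemma eqd_Nat_sym: "eqd \<Gamma> \<Delta> Nat s t \<Longrightarrow> eqd \<Gamma> \<Delta> Nat t s"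
  unfolding eqd_Nat using prv_mp[OF prv_EHA[OF EHA.sym]] by simp

lemma eqd_Nat_trans: "eqd \<Gamma> \<Delta> Nat s t \<Longrightarrow> eqd \<Gamma> \<Delta> Nat t u \<Longrightarrow> eqd \<Gamma> \<Delta> Nat s u"
  unfolding eqd_Nat using prv_mp[OF prv_mp[OF prv_EHA[OF EHA.trans]]] by blast

text \<open>
  The one instance of replacing equals by equals that is needed before equality is known to be a
  congruence: the equality of sequences is bounded by a length.
\<close>

lemma prv_less_cong:
  assumes "eqd \<Gamma> \<Delta> Nat s t" "prv \<Gamma> \<Delta> (less i s)" "wt \<Gamma> i Nat"
  shows "prv \<Gamma> \<Delta> (less i t)"
proof -
  have w: "wt \<Gamma> s Nat" "wt \<Gamma> t Nat" using assms(1) by (auto dest: eqd_wt1 eqd_wt2)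
  let ?\<Delta> = "Eq s t # \<Delta>"
  let ?\<Delta>' = "Eq (add \<cdot> (Con Succ \<cdot> tlift i) \<cdot> Var 0) (tlift s) # map flift ?\<Delta>"
  have "eqd (Nat # \<Gamma>) ?\<Delta>' Nat (add \<cdot> (Con Succ \<cdot> tlift i) \<cdot> Var 0) (tlift s)"
    "eqd (Nat # \<Gamma>) ?\<Delta>' Nat (tlift s) (tlift t)"
    by (rule eqd_Asm; use w assms in simp)+
  then have "prv (Nat # \<Gamma>) ?\<Delta>' (Eq (add \<cdot> (Con Succ \<cdot> tlift i) \<cdot> Var 0) (tlift t))"
    using eqd_Nat eqd_Nat_trans by blast
  then have "prv (Nat # \<Gamma>) ?\<Delta>' (flift (less i t))"
    unfolding less_def using w assms(3) by (intro prv_Ex_lift) auto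
  moreover have "prv \<Gamma> ?\<Delta> (Ex Nat (Eq (add \<cdot> (Con Succ \<cdot> tlift i) \<cdot> Var 0) (tlift s)))"
    by (rule nd_weaken[OF assms(2)[unfolded less_def]]) auto
  ultimately have "prv \<Gamma> ?\<Delta> (less i t)"
    using nd.ExE[of HAx \<Gamma> ?\<Delta> Nat "Eq (add \<cdot> (Con Succ \<cdot> tlift i) \<cdot> Var 0) (tlift s)" "less i t"] w assms(3)
    by (simp del: fsubst_less)
  then show ?thesis
    by (rule prv_cut[rotated 2]) (use assms(1) w in \<open>auto simp: eqd_Nat\<close>)
qed

lemma eqd_SeqI:
  assumes "wt \<Gamma> s (Seq \<sigma>)" "wt \<Gamma> t (Seq \<sigma>)" "eqd \<Gamma> \<Delta> Nat (len \<sigma> \<cdot> s) (len \<sigma> \<cdot> t)"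
    "eqd (Nat # \<Gamma>) (less (Var 0) (len \<sigma> \<cdot> tlift s) # map flift \<Delta>) \<sigma>
       (proj \<sigma> \<cdot> tlift s \<cdot> Var 0) (proj \<sigma> \<cdot> tlift t \<cdot> Var 0)"
  shows "eqd \<Gamma> \<Delta> (Seq \<sigma>) s t"
  using assms unfolding eqd_def by (auto intro!: nd.AllI nd.AndI nd.ImpI)

lemma eqd_Seq_len: "eqd \<Gamma> \<Delta> (Seq \<sigma>) s t \<Longrightarrow> eqd \<Gamma> \<Delta> Nat (len \<sigma> \<cdot> s) (len \<sigma> \<cdot> t)"
  unfolding eqd_def by (auto dest: nd.AndE1)

lemma eqd_Seq_proj:
  assumes "eqd \<Gamma> \<Delta> (Seq \<sigma>) s t" "prv \<Gamma> \<Delta> (less i (len \<sigma> \<cdot> s))" "wt \<Gamma> i Nat"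
  shows "eqd \<Gamma> \<Delta> \<sigma> (proj \<sigma> \<cdot> s \<cdot> i) (proj \<sigma> \<cdot> t \<cdot> i)"
proof -
  have "prv \<Gamma> \<Delta> (Imp (less i (len \<sigma> \<cdot> s)) (eq \<sigma> (proj \<sigma> \<cdot> s \<cdot> i) (proj \<sigma> \<cdot> t \<cdot> i)))"
    by (rule prv_AllE[OF nd.AndE2[OF assms(1)[THEN eqd_prv, simplified eq.simps]] assms(3)]) simp
  with assms show ?thesis by (auto simp: eqd_def intro: prv_mp)
qed

text \<open>
  From here on equality at higher types is used only through its introduction and elimination rules.
\<close>

declare eq.simps(2,3) [simp del]

lemma eqd_refl: "wt \<Gamma> s \<sigma> \<Longrightarrow> eqd \<Gamma> \<Delta> \<sigma> s s"
proof (induction \<sigma> arbitrary: \<Gamma> \<Delta> s)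
  case Nat then show ?case by (rule eqd_Nat_refl)
next
  case (Fun \<sigma> \<tau>)
  have "wt (\<sigma> # \<Gamma>) (tlift s \<cdot> Var 0) \<tau>" using Fun.prems by (intro wt_AppI[OF wt_tlift]) auto
  with Fun show ?case by (intro eqd_funI) auto
next
  case (Seq \<sigma>)
  then show ?case by (intro eqd_SeqI eqd_Nat_refl Seq.IH) auto
qed

text \<open>
  The equation is first made an assumption. Assumptions can be moved below the quantifiers hidden in
  the equation at a higher type; no such lifting is available for derivations.
\<close>

lemma eqd_sym: "eqd \<Gamma> \<Delta> \<sigma> s t \<Longrightarrow> eqd \<Gamma> \<Delta> \<sigma> t s"
proof (induction \<sigma> arbitrary: \<Gamma> \<Delta> s t)
  case Nat then show ?case by (rule eqd_Nat_sym)
next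
  case (Fun \<sigma> \<tau>)
  have w: "wt \<Gamma> s (\<sigma> \<rightarrow> \<tau>)" "wt \<Gamma> t (\<sigma> \<rightarrow> \<tau>)" using Fun.prems by (auto simp: eqd_def)
  let ?\<Delta> = "eq (\<sigma> \<rightarrow> \<tau>) s t # \<Delta>"
  have "eqd (\<sigma> # \<Gamma>) (map flift ?\<Delta>) (\<sigma> \<rightarrow> \<tau>) (tlift s) (tlift t)"
    by (rule eqd_Asm) (use w in auto)
  then have "eqd (\<sigma> # \<Gamma>) (map flift ?\<Delta>) \<tau> (tlift s \<cdot> Var 0) (tlift t \<cdot> Var 0)"
    by (rule eqd_fun1) simp
  then have "eqd \<Gamma> ?\<Delta> (\<sigma> \<rightarrow> \<tau>) t s"
    using w Fun.IH(2) by (intro eqd_funI) auto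
  then show ?case
    using prv_cut[OF eqd_prv[OF Fun.prems]] w by (simp add: eqd_def)
next
  case (Seq \<sigma>)
  have w: "wt \<Gamma> s (Seq \<sigma>)" "wt \<Gamma> t (Seq \<sigma>)" using Seq.prems by (auto simp: eqd_def)
  let ?\<Delta> = "eq (Seq \<sigma>) s t # \<Delta>"
  let ?\<Delta>' = "less (Var 0) (len \<sigma> \<cdot> tlift t) # map flift ?\<Delta>"
  have e: "eqd (Nat # \<Gamma>) ?\<Delta>' (Seq \<sigma>) (tlift s) (tlift t)"
    by (rule eqd_Asm) (use w in auto)
  have "prv (Nat # \<Gamma>) ?\<Delta>' (less (Var 0) (len \<sigma> \<cdot> tlift s))"
    by (rule prv_less_cong[OF eqd_Nat_sym[OF eqd_Seq_len[OF e]]]) (auto intro!: nd.Asm simp: w)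
  then have "eqd (Nat # \<Gamma>) ?\<Delta>' \<sigma> (proj \<sigma> \<cdot> tlift s \<cdot> Var 0) (proj \<sigma> \<cdot> tlift t \<cdot> Var 0)"
    by (rule eqd_Seq_proj[OF e]) simp
  moreover have "eqd \<Gamma> ?\<Delta> Nat (len \<sigma> \<cdot> t) (len \<sigma> \<cdot> s)"
    by (rule eqd_Nat_sym[OF eqd_Seq_len[OF eqd_Asm]]) (auto simp: w)
  ultimately have "eqd \<Gamma> ?\<Delta> (Seq \<sigma>) t s"
    using w Seq.IH by (intro eqd_SeqI) auto
  then show ?case
    using prv_cut[OF eqd_prv[OF Seq.prems]] w by (simp add: eqd_def)
qed

lemma eqd_trans: "eqd \<Gamma> \<Delta> \<sigma> s t \<Longrightarrow> eqd \<Gamma> \<Delta> \<sigma> t u \<Longrightarrow> eqd \<Gamma> \<Delta> \<sigma> s u"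
proof (induction \<sigma> arbitrary: \<Gamma> \<Delta> s t u)
  case Nat then show ?case by (rule eqd_Nat_trans)
next
  case (Fun \<sigma> \<tau>)
  have w: "wt \<Gamma> s (\<sigma> \<rightarrow> \<tau>)" "wt \<Gamma> t (\<sigma> \<rightarrow> \<tau>)" "wt \<Gamma> u (\<sigma> \<rightarrow> \<tau>)" using Fun.prems by (auto simp: eqd_def)
  let ?\<Delta> = "eq (\<sigma> \<rightarrow> \<tau>) t u # eq (\<sigma> \<rightarrow> \<tau>) s t # \<Delta>"
  have "eqd (\<sigma> # \<Gamma>) (map flift ?\<Delta>) \<tau> (tlift s \<cdot> Var 0) (tlift t \<cdot> Var 0)"
    "eqd (\<sigma> # \<Gamma>) (map flift ?\<Delta>) \<tau> (tlift t \<cdot> Var 0) (tlift u \<cdot> Var 0)"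
    by (rule eqd_fun1[OF eqd_Asm]; use w in simp)+
  then have "eqd (\<sigma> # \<Gamma>) (map flift ?\<Delta>) \<tau> (tlift s \<cdot> Var 0) (tlift u \<cdot> Var 0)"
    by (rule Fun.IH(2))
  then have "eqd \<Gamma> ?\<Delta> (\<sigma> \<rightarrow> \<tau>) s u"
    using w by (intro eqd_funI) auto
  then have "prv \<Gamma> (eq (\<sigma> \<rightarrow> \<tau>) s t # \<Delta>) (eq (\<sigma> \<rightarrow> \<tau>) s u)"
    by (intro prv_cut[OF nd_weaken[OF eqd_prv[OF Fun.prems(2)]] _ eqd_prv]) (use w in auto)
  then have "prv \<Gamma> \<Delta> (eq (\<sigma> \<rightarrow> \<tau>) s u)"
    by (rule prv_cut[OF Fun.prems(1)[THEN eqd_prv], rotated]) (use w in auto)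
  then show ?case
    using w by (simp add: eqd_def)
next
  case (Seq \<sigma>)
  have w: "wt \<Gamma> s (Seq \<sigma>)" "wt \<Gamma> t (Seq \<sigma>)" "wt \<Gamma> u (Seq \<sigma>)" using Seq.prems by (auto simp: eqd_def)
  let ?\<Delta> = "eq (Seq \<sigma>) t u # eq (Seq \<sigma>) s t # \<Delta>"
  let ?\<Delta>' = "less (Var 0) (len \<sigma> \<cdot> tlift s) # map flift ?\<Delta>"
  have e: "eqd (Nat # \<Gamma>) ?\<Delta>' (Seq \<sigma>) (tlift s) (tlift t)" "eqd (Nat # \<Gamma>) ?\<Delta>' (Seq \<sigma>) (tlift t) (tlift u)"
    by (rule eqd_Asm; use w in simp)+
  have l: "prv (Nat # \<Gamma>) ?\<Delta>' (less (Var 0) (len \<sigma> \<cdot> tlift s))"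
    by (rule nd.Asm) (use w in auto)
  have "prv (Nat # \<Gamma>) ?\<Delta>' (less (Var 0) (len \<sigma> \<cdot> tlift t))"
    by (rule prv_less_cong[OF eqd_Seq_len[OF e(1)] l]) simp
  from Seq.IH[OF eqd_Seq_proj[OF e(1) l] eqd_Seq_proj[OF e(2) this]]
  have "eqd (Nat # \<Gamma>) ?\<Delta>' \<sigma> (proj \<sigma> \<cdot> tlift s \<cdot> Var 0) (proj \<sigma> \<cdot> tlift u \<cdot> Var 0)"
    by simp
  moreover have "eqd \<Gamma> ?\<Delta> Nat (len \<sigma> \<cdot> s) (len \<sigma> \<cdot> u)"
    by (rule eqd_Nat_trans[OF eqd_Seq_len[OF eqd_Asm[of _ _ t]] eqd_Seq_len[OF eqd_Asm]]) (auto simp: w)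
  ultimately have "eqd \<Gamma> ?\<Delta> (Seq \<sigma>) s u"
    using w by (intro eqd_SeqI) auto
  then have "prv \<Gamma> (eq (Seq \<sigma>) s t # \<Delta>) (eq (Seq \<sigma>) s u)"
    by (intro prv_cut[OF nd_weaken[OF eqd_prv[OF Seq.prems(2)]] _ eqd_prv]) (use w in auto)
  then have "prv \<Gamma> \<Delta> (eq (Seq \<sigma>) s u)"
    by (rule prv_cut[OF Seq.prems(1)[THEN eqd_prv], rotated]) (use w in auto)
  then show ?case
    using w by (simp add: eqd_def)
qed

lemma eqd_app: "eqd \<Gamma> \<Delta> (\<sigma> \<rightarrow> \<tau>) s s' \<Longrightarrow> eqd \<Gamma> \<Delta> \<sigma> t t' \<Longrightarrow> eqd \<Gamma> \<Delta> \<tau> (s \<cdot> t) (s' \<cdot> t')"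
  by (rule eqd_trans[OF eqd_arg[OF eqd_wt1] eqd_fun1]) (auto dest: eqd_wt2)

lemma eqd_tsubst:
  assumes "wt \<Gamma>' t \<tau>" "\<And>i. i < length \<Gamma>' \<Longrightarrow> eqd \<Gamma> \<Delta> (\<Gamma>' ! i) (\<theta> i) (\<theta>' i)"
  shows "eqd \<Gamma> \<Delta> \<tau> (tsubst \<theta> t) (tsubst \<theta>' t)"
  using assms(1)
proof (induction t arbitrary: \<tau>)
  case (Var i)
  then show ?case using assms(2) by auto
next
  case (Con c)
  then show ?case by (auto intro: eqd_refl)
next
  case (App s t)
  then obtain \<sigma> where "wt \<Gamma>' s (\<sigma> \<rightarrow> \<tau>)" "wt \<Gamma>' t \<sigma>" by (auto simp: wt.simps)
  then show ?case by (simp, intro eqd_app[OF App.IH])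
qed

text \<open>
  The hypothesis of the replacement theorem in a form that is stable under going below a quantifier: an
  equation that is an assumption stays one, in lifted form, and the new variable is equal to itself on
  the nose. It is symmetric because implication reverses the direction of replacement.
\<close>

definition linked :: "ty list \<Rightarrow> fm list \<Rightarrow> ty \<Rightarrow> tm \<Rightarrow> tm \<Rightarrow> bool" where
  "linked \<Gamma> \<Delta> \<sigma> s t \<longleftrightarrow>
     wt \<Gamma> s \<sigma> \<and> wt \<Gamma> t \<sigma> \<and> (s = t \<or> eq \<sigma> s t \<in> set \<Delta> \<or> eq \<sigma> t s \<in> set \<Delta>)"

lemma linked_sym: "linked \<Gamma> \<Delta> \<sigma> s t \<Longrightarrow> linked \<Gamma> \<Delta> \<sigma> t s"
  by (auto simp: linked_def)

lemma linked_weaken: "linked \<Gamma> \<Delta> \<sigma> s t \<Longrightarrow> set \<Delta> \<subseteq> set \<Delta>' \<Longrightarrow> linked \<Gamma> \<Delta>' \<sigma> s t"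
  by (auto simp: linked_def)

lemma linked_eqd: "linked \<Gamma> \<Delta> \<sigma> s t \<Longrightarrow> eqd \<Gamma> \<Delta> \<sigma> s t"
  unfolding linked_def using eqd_refl eqd_Asm eqd_sym[OF eqd_Asm] by blast

lemma linked_up:
  assumes "\<And>i. i < length \<Gamma>' \<Longrightarrow> linked \<Gamma> \<Delta> (\<Gamma>' ! i) (\<theta> i) (\<theta>' i)" "i < length (\<sigma> # \<Gamma>')"
  shows "linked (\<sigma> # \<Gamma>) (map flift \<Delta>) ((\<sigma> # \<Gamma>') ! i) (up \<theta> i) (up \<theta>' i)"
proof (cases i)
  case 0 then show ?thesis by (simp add: linked_def)
next
  case (Suc j)
  have "flift (eq \<rho> s t) \<in> set (map flift \<Delta>)" if "eq \<rho> s t \<in> set \<Delta>" for \<rho> s t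
    using that by (simp del: fsubst_eq)
  with Suc assms(1)[of j] assms(2) show ?thesis by (auto simp: linked_def)
qed

lemma prv_Leibniz_linked:
  assumes "internal \<phi>" "wff \<Gamma>' \<phi>"
    "\<And>i. i < length \<Gamma>' \<Longrightarrow> linked \<Gamma> \<Delta> (\<Gamma>' ! i) (\<theta> i) (\<theta>' i)"
    "fsubst \<theta> \<phi> \<in> set \<Delta>"
  shows "prv \<Gamma> \<Delta> (fsubst \<theta>' \<phi>)"
  using assms
proof (induction \<phi> arbitrary: \<Gamma> \<Gamma>' \<Delta> \<theta> \<theta>')
  case (Eq s t)
  have e: "eqd \<Gamma> \<Delta> Nat (tsubst \<theta> u) (tsubst \<theta>' u)" if "wt \<Gamma>' u Nat" for u
    using that Eq.prems(3) by (intro eqd_tsubst linked_eqd)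
  have "eqd \<Gamma> \<Delta> Nat (tsubst \<theta> s) (tsubst \<theta> t)"
    using Eq.prems e by (intro eqd_Asm) (auto dest: eqd_wt1)
  from eqd_trans[OF eqd_trans[OF eqd_sym[OF e] this] e] Eq.prems show ?case
    by (auto simp: eqd_def)
next
  case Fls then show ?case by (auto intro: nd.Asm)
next
  case (And \<phi> \<psi>)
  have w: "wff \<Gamma> (fsubst \<theta> \<phi>)" "wff \<Gamma> (fsubst \<theta> \<psi>)"
    using And.prems by (auto intro!: wff_fsubst simp: linked_def)
  have A: "prv \<Gamma> \<Delta> (And (fsubst \<theta> \<phi>) (fsubst \<theta> \<psi>))"
    using And.prems w by (intro nd.Asm) auto
  have "prv \<Gamma> (fsubst \<theta> \<phi> # \<Delta>) (fsubst \<theta>' \<phi>)"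
    using And.prems(1,2,4) by (intro And.IH(1)[of \<Gamma>' _ _ \<theta>] linked_weaken[OF And.prems(3)]) auto
  moreover have "prv \<Gamma> (fsubst \<theta> \<psi> # \<Delta>) (fsubst \<theta>' \<psi>)"
    using And.prems(1,2,4) by (intro And.IH(2)[of \<Gamma>' _ _ \<theta>] linked_weaken[OF And.prems(3)]) auto
  ultimately show ?case
    using prv_cut[OF nd.AndE1[OF A]] prv_cut[OF nd.AndE2[OF A]] w by (auto intro: nd.AndI)
next
  case (Or \<phi> \<psi>)
  have w: "wff \<Gamma> (fsubst \<theta> \<phi>)" "wff \<Gamma> (fsubst \<theta> \<psi>)" "wff \<Gamma> (fsubst \<theta>' \<phi>)" "wff \<Gamma> (fsubst \<theta>' \<psi>)"
    using Or.prems by (auto intro!: wff_fsubst simp: linked_def)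
  have A: "prv \<Gamma> \<Delta> (Or (fsubst \<theta> \<phi>) (fsubst \<theta> \<psi>))"
    using Or.prems w by (intro nd.Asm) auto
  have "prv \<Gamma> (fsubst \<theta> \<phi> # \<Delta>) (fsubst \<theta>' \<phi>)"
    using Or.prems(1,2,4) by (intro Or.IH(1)[of \<Gamma>' _ _ \<theta>] linked_weaken[OF Or.prems(3)]) auto
  moreover have "prv \<Gamma> (fsubst \<theta> \<psi> # \<Delta>) (fsubst \<theta>' \<psi>)"
    using Or.prems(1,2,4) by (intro Or.IH(2)[of \<Gamma>' _ _ \<theta>] linked_weaken[OF Or.prems(3)]) auto
  ultimately show ?case
    using w by (intro nd.OrE[OF A]) (auto intro: nd.OrI1 nd.OrI2)
next
  case (Imp \<phi> \<psi>)
  have w: "wff \<Gamma> (fsubst \<theta> \<phi>)" "wff \<Gamma> (fsubst \<theta> \<psi>)" "wff \<Gamma> (fsubst \<theta>' \<phi>)" "wff \<Gamma> (fsubst \<theta>' \<psi>)"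
    using Imp.prems by (auto intro!: wff_fsubst simp: linked_def)
  let ?\<Delta> = "fsubst \<theta>' \<phi> # \<Delta>"
  have A: "prv \<Gamma> ?\<Delta> (Imp (fsubst \<theta> \<phi>) (fsubst \<theta> \<psi>))"
    using Imp.prems w by (intro nd.Asm) auto
  have "prv \<Gamma> ?\<Delta> (fsubst \<theta> \<phi>)"
    using Imp.prems(1,2,4) by (intro Imp.IH(1)[of \<Gamma>' _ _ \<theta>'] linked_weaken[OF linked_sym[OF Imp.prems(3)]]) auto
  from prv_mp[OF A this] have B: "prv \<Gamma> ?\<Delta> (fsubst \<theta> \<psi>)" .
  have "prv \<Gamma> (fsubst \<theta> \<psi> # ?\<Delta>) (fsubst \<theta>' \<psi>)"
    using Imp.prems(1,2,4) by (intro Imp.IH(2)[of \<Gamma>' _ _ \<theta>] linked_weaken[OF Imp.prems(3)]) auto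
  from prv_cut[OF B w(2) this] w show ?case by (auto intro: nd.ImpI)
next
  case (All \<sigma> \<phi>)
  have w: "wff \<Gamma> (fsubst \<theta> (All \<sigma> \<phi>))"
    using All.prems by (intro wff_fsubst) (auto simp: linked_def)
  then have w: "wff (\<sigma> # \<Gamma>) (fsubst (up \<theta>) \<phi>)" by simp
  have A: "prv (\<sigma> # \<Gamma>) (map flift \<Delta>) (fsubst (up \<theta>) \<phi>)"
    by (rule prv_All_lift) (use All.prems w in auto)
  have "prv (\<sigma> # \<Gamma>) (fsubst (up \<theta>) \<phi> # map flift \<Delta>) (fsubst (up \<theta>') \<phi>)"
    using All.prems(1,2)
    by (intro All.IH[of "\<sigma> # \<Gamma>'" _ _ "up \<theta>"] linked_weaken[OF linked_up[OF All.prems(3)]]) auto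
  from prv_cut[OF A w this] show ?case by (auto intro: nd.AllI)
next
  case (Ex \<sigma> \<phi>)
  have w: "wff \<Gamma> (fsubst \<theta> (Ex \<sigma> \<phi>))" "wff \<Gamma> (fsubst \<theta>' (Ex \<sigma> \<phi>))"
    using Ex.prems by (auto intro!: wff_fsubst simp: linked_def simp del: fsubst.simps)
  have "prv (\<sigma> # \<Gamma>) (fsubst (up \<theta>) \<phi> # map flift \<Delta>) (fsubst (up \<theta>') \<phi>)"
    using Ex.prems(1,2)
    by (intro Ex.IH[of "\<sigma> # \<Gamma>'" _ _ "up \<theta>"] linked_weaken[OF linked_up[OF Ex.prems(3)]]) auto
  then have A: "prv (\<sigma> # \<Gamma>) (fsubst (up \<theta>) \<phi> # map flift \<Delta>) (flift (Ex \<sigma> (fsubst (up \<theta>') \<phi>)))"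
    by (rule prv_Ex_lift) (use w in simp)
  have "prv \<Gamma> \<Delta> (Ex \<sigma> (fsubst (up \<theta>) \<phi>))"
    using Ex.prems w by (intro nd.Asm) auto
  from nd.ExE[OF this A] w show ?case by simp
qed auto

declare eqd_trans [trans]

lemma prv_cuts:
  "(\<And>\<Phi>. \<Phi> \<in> set \<Theta> \<Longrightarrow> wff \<Gamma> \<Phi> \<and> prv \<Gamma> \<Delta> \<Phi>) \<Longrightarrow> prv \<Gamma> (\<Theta> @ \<Delta>) \<Psi> \<Longrightarrow> prv \<Gamma> \<Delta> \<Psi>"
proof (induction \<Theta>)
  case (Cons \<Phi> \<Theta>)
  have "prv \<Gamma> (\<Theta> @ \<Delta>) \<Phi>"
    by (rule nd_weaken[of _ _ \<Delta>]) (use Cons.prems in auto)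
  then have "prv \<Gamma> (\<Theta> @ \<Delta>) \<Psi>"
    by (rule prv_cut) (use Cons.prems in auto)
  with Cons show ?case by simp
qed simp

text \<open>
  Arbitrary provable equations are turned into assumptions by cuts.
\<close>

lemma prv_Leibniz:
  assumes "internal \<phi>" "wff \<Gamma>' \<phi>"
    and e: "\<And>i. i < length \<Gamma>' \<Longrightarrow> eqd \<Gamma> \<Delta> (\<Gamma>' ! i) (\<theta> i) (\<theta>' i)"
    and p: "prv \<Gamma> \<Delta> (fsubst \<theta> \<phi>)"
  shows "prv \<Gamma> \<Delta> (fsubst \<theta>' \<phi>)"
proof -
  let ?\<Theta> = "fsubst \<theta> \<phi> # map (\<lambda>i. eq (\<Gamma>' ! i) (\<theta> i) (\<theta>' i)) [0..<length \<Gamma>']"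
  have w: "wff \<Gamma> (fsubst \<theta> \<phi>)"
    by (rule wff_fsubst[OF assms(2)]) (use e in \<open>auto simp: eqd_def\<close>)
  have "prv \<Gamma> (?\<Theta> @ \<Delta>) (fsubst \<theta>' \<phi>)"
    by (rule prv_Leibniz_linked[OF assms(1,2)]) (use e in \<open>auto simp: eqd_def linked_def\<close>)
  then show ?thesis
    by (rule prv_cuts[rotated]) (use e p w in \<open>auto simp: eqd_def\<close>)
qed

section \<open>Induction and case distinction on numbers\<close>

lemma prv_ExE:
  "prv \<Gamma> \<Delta> (Ex \<sigma> \<Phi>) \<Longrightarrow> wff \<Gamma> \<chi> \<Longrightarrow> prv (\<sigma> # \<Gamma>) (\<Phi> # map flift \<Delta>) (flift \<chi>) \<Longrightarrow> prv \<Gamma> \<Delta> \<chi>"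
  by (rule nd.ExE)

lemma prv_induct:
  assumes "wff (Nat # \<Gamma>) \<phi>" "internal \<phi>" "prv \<Gamma> \<Delta> (fsubst (psub [Con Zero] 0) \<phi>)"
    "prv (Nat # \<Gamma>) (\<phi> # map flift \<Delta>) (fsubst (psub [Con Succ \<cdot> Var 0] 1) \<phi>)"
  shows "prv \<Gamma> \<Delta> (All Nat \<phi>)"
  by (rule prv_mp[OF prv_EHA[OF EHA.induction[OF assms(1,2)]]])
    (intro nd.AndI nd.AllI nd.ImpI; use assms in \<open>simp add: plug_psub\<close>)

lemma prv_Nat_cases:
  assumes "wt \<Gamma> t Nat" "wff \<Gamma> \<chi>" "prv \<Gamma> (Eq t (Con Zero) # \<Delta>) \<chi>"
    "prv (Nat # \<Gamma>) (Eq (tlift t) (Con Succ \<cdot> Var 0) # map flift \<Delta>) (flift \<chi>)"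
  shows "prv \<Gamma> \<Delta> \<chi>"
proof -
  let ?\<phi> = "Or (Eq (Var 0) (Con Zero)) (Ex Nat (Eq (Var 1) (Con Succ \<cdot> Var 0)))"
  have "prv \<Gamma> \<Delta> (All Nat ?\<phi>)"
  proof (rule prv_induct)
    show "prv \<Gamma> \<Delta> (fsubst (psub [Con Zero] 0) ?\<phi>)"
      by (simp, intro nd.OrI1 prv_EHA EHA.refl) auto
    have "prv (Nat # \<Gamma>) (?\<phi> # map flift \<Delta>) (Ex Nat (Eq (Con Succ \<cdot> Var 1) (Con Succ \<cdot> Var 0)))"
      by (rule prv_ExI[where t="Var 0"]) (auto intro!: prv_EHA EHA.refl)
    then show "prv (Nat # \<Gamma>) (?\<phi> # map flift \<Delta>) (fsubst (psub [Con Succ \<cdot> Var 0] 1) ?\<phi>)"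
      by (simp, intro nd.OrI2) auto
  qed auto
  then have *: "prv \<Gamma> \<Delta> (Or (Eq t (Con Zero)) (Ex Nat (Eq (tlift t) (Con Succ \<cdot> Var 0))))"
    by (rule prv_AllE[OF _ assms(1)]) simp
  show ?thesis
  proof (rule nd.OrE[OF * assms(3)])
    show "prv \<Gamma> (Ex Nat (Eq (tlift t) (Con Succ \<cdot> Var 0)) # \<Delta>) \<chi>"
      by (rule prv_ExE[OF nd.Asm _ nd_weaken[OF assms(4)]]) (use assms(1,2) in auto)
  qed
qed

section \<open>Computing with closed terms\<close>

lemma eqd_K: "wt \<Gamma> s \<sigma> \<Longrightarrow> wt \<Gamma> t \<tau> \<Longrightarrow> eqd \<Gamma> \<Delta> \<sigma> (Con (Kc \<sigma> \<tau>) \<cdot> s \<cdot> t) s"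
  by (intro eqdI prv_EHA EHA.K) (auto intro!: wt_AppI)

lemma eqd_S: "wt \<Gamma> s (\<rho> \<rightarrow> \<sigma> \<rightarrow> \<tau>) \<Longrightarrow> wt \<Gamma> t (\<rho> \<rightarrow> \<sigma>) \<Longrightarrow> wt \<Gamma> u \<rho> \<Longrightarrow>
    eqd \<Gamma> \<Delta> \<tau> (Con (Sc \<rho> \<sigma> \<tau>) \<cdot> s \<cdot> t \<cdot> u) (s \<cdot> u \<cdot> (t \<cdot> u))"
  by (intro eqdI prv_EHA EHA.S) (auto intro: wt_AppI simp: wt.simps)

lemma eqd_R_Zero: "wt \<Gamma> s \<sigma> \<Longrightarrow> wt \<Gamma> t (\<sigma> \<rightarrow> Nat \<rightarrow> \<sigma>) \<Longrightarrow>
    eqd \<Gamma> \<Delta> \<sigma> (Con (Rc \<sigma>) \<cdot> s \<cdot> t \<cdot> Con Zero) s"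
  by (intro eqdI prv_EHA EHA.R_Zero) (auto simp: wt.simps)

lemma eqd_R_Succ: "wt \<Gamma> s \<sigma> \<Longrightarrow> wt \<Gamma> t (\<sigma> \<rightarrow> Nat \<rightarrow> \<sigma>) \<Longrightarrow> wt \<Gamma> u Nat \<Longrightarrow>
    eqd \<Gamma> \<Delta> \<sigma> (Con (Rc \<sigma>) \<cdot> s \<cdot> t \<cdot> (Con Succ \<cdot> u)) (t \<cdot> (Con (Rc \<sigma>) \<cdot> s \<cdot> t \<cdot> u) \<cdot> u)"
  by (intro eqdI prv_EHA EHA.R_Succ) (auto simp: wt.simps)

text \<open>
  Bracket abstraction is correct: the equations of \<open>S\<close> and \<open>K\<close> drive the argument to the leaves.
\<close>

lemma eqd_beta:
  "wt (\<sigma> # \<Gamma>) t \<tau> \<Longrightarrow> wt \<Gamma> s \<sigma> \<Longrightarrow> eqd \<Gamma> \<Delta> \<tau> (lam \<Gamma> \<sigma> t \<cdot> s) (tsubst (psub [s] 0) t)"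
proof (induction \<Gamma> \<sigma> t arbitrary: \<tau> rule: lam.induct)
  case (1 \<Gamma> \<sigma>)
  have "eqd \<Gamma> \<Delta> \<sigma> (Con (Sc \<sigma> (\<sigma> \<rightarrow> \<sigma>) \<sigma>) \<cdot> Con (Kc \<sigma> (\<sigma> \<rightarrow> \<sigma>)) \<cdot> Con (Kc \<sigma> \<sigma>) \<cdot> s)
      (Con (Kc \<sigma> (\<sigma> \<rightarrow> \<sigma>)) \<cdot> s \<cdot> (Con (Kc \<sigma> \<sigma>) \<cdot> s))"
    by (rule eqd_S) (use 1 in auto)
  also have "eqd \<Gamma> \<Delta> \<sigma> (Con (Kc \<sigma> (\<sigma> \<rightarrow> \<sigma>)) \<cdot> s \<cdot> (Con (Kc \<sigma> \<sigma>) \<cdot> s)) s"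
    by (rule eqd_K) (use 1 in \<open>auto intro: wt_AppI\<close>)
  finally show ?case using 1 by simp
next
  case (2 \<Gamma> \<sigma> i)
  then show ?case by (auto intro: eqd_K)
next
  case (3 \<Gamma> \<sigma> c)
  then show ?case by (auto intro: eqd_K)
next
  case (4 \<Gamma> \<sigma> u v)
  then obtain \<rho> where w: "wt (\<sigma> # \<Gamma>) u (\<rho> \<rightarrow> \<tau>)" "wt (\<sigma> # \<Gamma>) v \<rho>" by (auto simp: wt.simps)
  have ty: "tyof (\<sigma> # \<Gamma>) v = \<rho>" "tyof (\<sigma> # \<Gamma>) (u \<cdot> v) = \<tau>"
    using w by (auto dest!: wt_tyof)
  have "eqd \<Gamma> \<Delta> \<tau> (Con (Sc \<sigma> \<rho> \<tau>) \<cdot> lam \<Gamma> \<sigma> u \<cdot> lam \<Gamma> \<sigma> v \<cdot> s)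
      (lam \<Gamma> \<sigma> u \<cdot> s \<cdot> (lam \<Gamma> \<sigma> v \<cdot> s))"
    by (rule eqd_S) (use w 4 in \<open>auto intro: wt_lam\<close>)
  also have "eqd \<Gamma> \<Delta> \<tau> (lam \<Gamma> \<sigma> u \<cdot> s \<cdot> (lam \<Gamma> \<sigma> v \<cdot> s))
      (tsubst (psub [s] 0) u \<cdot> tsubst (psub [s] 0) v)"
    by (rule eqd_app[OF 4(1) 4(2)]) (use w 4 in auto)
  finally show ?case using ty by simp
qed

text \<open>
  The abstraction over the step function of the recursion contains no free variables, so it is a
  closed term that does not depend on the context in which it is formed.
\<close>

lemma eqd_add:
  assumes "wt \<Gamma> a Nat"
  shows "eqd \<Gamma> \<Delta> (Nat \<rightarrow> Nat) (add \<cdot> a)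
    (Con (Rc Nat) \<cdot> a \<cdot> lam [Nat] Nat (lam [Nat, Nat] Nat (Con Succ \<cdot> Var 1)))"
proof -
  let ?T = "lam [Nat] Nat (lam [Nat, Nat] Nat (Con Succ \<cdot> Var 1))"
  let ?t = "Con (Rc Nat) \<cdot> Var 0 \<cdot> ?T"
  have T: "wt \<Gamma>' ?T (Nat \<rightarrow> Nat \<rightarrow> Nat)" for \<Gamma>'
    by (simp add: wt_App_tyof eval_nat_numeral)
  then have w: "wt (Nat # \<Gamma>') ?t (Nat \<rightarrow> Nat)" for \<Gamma>'
    by (intro wt_AppI) auto
  have "lam [] Nat ?t = lam \<Gamma> Nat ?t"
    by simp
  then have "add = lam \<Gamma> Nat ?t"
    by (simp add: add_def)
  moreover have "tsubst (psub [a] 0) ?t = Con (Rc Nat) \<cdot> a \<cdot> ?T"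
    by simp
  ultimately show ?thesis
    using eqd_beta[OF w assms, of \<Delta>] by simp
qed

lemma eqd_add_Zero: "wt \<Gamma> a Nat \<Longrightarrow> eqd \<Gamma> \<Delta> Nat (add \<cdot> a \<cdot> Con Zero) a"
  by (rule eqd_trans[OF eqd_fun1[OF eqd_add] eqd_R_Zero]) (simp_all add: wt_App_tyof eval_nat_numeral)

lemma eqd_add_Succ:
  assumes "wt \<Gamma> a Nat" "wt \<Gamma> b Nat"
  shows "eqd \<Gamma> \<Delta> Nat (add \<cdot> a \<cdot> (Con Succ \<cdot> b)) (Con Succ \<cdot> (add \<cdot> a \<cdot> b))"
proof -
  let ?T = "lam [Nat] Nat (lam [Nat, Nat] Nat (Con Succ \<cdot> Var 1))"
  let ?R = "Con (Rc Nat) \<cdot> a \<cdot> ?T"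
  have T: "wt \<Gamma> ?T (Nat \<rightarrow> Nat \<rightarrow> Nat)"
    by (simp add: wt_App_tyof eval_nat_numeral)
  then have R: "wt \<Gamma> (?R \<cdot> b) Nat"
    using assms by (auto simp: wt.simps simp del: lam.simps)
  have "eqd \<Gamma> \<Delta> Nat (add \<cdot> a \<cdot> (Con Succ \<cdot> b)) (?R \<cdot> (Con Succ \<cdot> b))"
    by (rule eqd_fun1[OF eqd_add]) (use assms in auto)
  also have "eqd \<Gamma> \<Delta> Nat (?R \<cdot> (Con Succ \<cdot> b)) (?T \<cdot> (?R \<cdot> b) \<cdot> b)"
    by (rule eqd_R_Succ[OF assms(1) T assms(2)])
  also have "eqd \<Gamma> \<Delta> Nat (?T \<cdot> (?R \<cdot> b) \<cdot> b) (Con Succ \<cdot> (?R \<cdot> b))"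
  proof -
    let ?u = "lam (Nat # \<Gamma>) Nat (Con Succ \<cdot> Var 1)"
    let ?r = "?R \<cdot> b"
    have u: "lam [Nat] Nat (lam [Nat, Nat] Nat (Con Succ \<cdot> Var 1)) = lam \<Gamma> Nat ?u"
      by simp
    have "eqd \<Gamma> \<Delta> (Nat \<rightarrow> Nat) (?T \<cdot> ?r) (tsubst (psub [?r] 0) ?u)"
      unfolding u by (rule eqd_beta[OF wt_lam R[unfolded u]]) simp
    then have "eqd \<Gamma> \<Delta> Nat (?T \<cdot> ?r \<cdot> b) (tsubst (psub [?r] 0) ?u \<cdot> b)"
      by (rule eqd_fun1[OF _ assms(2)])
    also have "tsubst (psub [?r] 0) ?u =
        Con (Sc Nat Nat Nat) \<cdot> (Con (Kc (Nat \<rightarrow> Nat) Nat) \<cdot> Con Succ) \<cdot> (Con (Kc Nat Nat) \<cdot> ?r)"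
      by simp
    also have "eqd \<Gamma> \<Delta> Nat (\<dots> \<cdot> b) (Con (Kc (Nat \<rightarrow> Nat) Nat) \<cdot> Con Succ \<cdot> b \<cdot> (Con (Kc Nat Nat) \<cdot> ?r \<cdot> b))"
      by (rule eqd_S[OF _ wt_AppI[OF _ R] assms(2)]) (auto simp: wt.simps)
    also have "eqd \<Gamma> \<Delta> Nat \<dots> (Con Succ \<cdot> ?r)"
      by (rule eqd_app[OF eqd_K eqd_K[OF R assms(2)]]) (use assms in auto)
    finally show ?thesis .
  qed
  also have "eqd \<Gamma> \<Delta> Nat (Con Succ \<cdot> (?R \<cdot> b)) (Con Succ \<cdot> (add \<cdot> a \<cdot> b))"
    by (rule eqd_arg[OF _ eqd_sym[OF eqd_fun1[OF eqd_add]]]) (use assms in auto)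
  finally show ?thesis .
qed

section \<open>The order of the natural numbers\<close>

lemma eqd_Succ_inj:
  assumes "eqd \<Gamma> \<Delta> Nat (Con Succ \<cdot> s) (Con Succ \<cdot> t)" shows "eqd \<Gamma> \<Delta> Nat s t"
  using assms prv_mp[OF prv_EHA[OF EHA.Succ_inj]] unfolding eqd_Nat by simp

text \<open>
  Split the witness \<open>j\<close> of \<open>S i + j = 0\<close> into zero and successor; both make a successor equal to 0.
\<close>

lemma prv_less_Zero:
  assumes "prv \<Gamma> \<Delta> (less i (Con Zero))" "wt \<Gamma> i Nat" "wff \<Gamma> \<chi>"
  shows "prv \<Gamma> \<Delta> \<chi>"
proof -
  have no: "prv \<Gamma>' \<Delta>' Fls" if "eqd \<Gamma>' \<Delta>' Nat (Con Succ \<cdot> t) (Con Zero)" for \<Gamma>' \<Delta>' t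
    using that by (auto simp: eqd_Nat intro: prv_mp[OF prv_EHA[OF EHA.Succ_Zero]])
  have A: "prv \<Gamma>' \<Delta>' Fls" if e: "Eq (add \<cdot> (Con Succ \<cdot> i) \<cdot> j) (Con Zero) \<in> set \<Delta>'"
    and w: "wt \<Gamma>' i Nat" "wt \<Gamma>' j Nat" for \<Gamma>' \<Delta>' i j
  proof (rule prv_Nat_cases[OF w(2)])
    let ?\<Delta> = "Eq j (Con Zero) # \<Delta>'"
    have "eqd \<Gamma>' ?\<Delta> Nat (Con Succ \<cdot> i) (add \<cdot> (Con Succ \<cdot> i) \<cdot> Con Zero)"
      by (rule eqd_sym[OF eqd_add_Zero]) (use w in simp)
    also have "eqd \<Gamma>' ?\<Delta> Nat \<dots> (add \<cdot> (Con Succ \<cdot> i) \<cdot> j)"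
      by (rule eqd_arg[OF _ eqd_sym[OF eqd_Asm]]) (use w in \<open>auto intro!: wt_AppI[of _ _ Nat]\<close>)
    also have "eqd \<Gamma>' ?\<Delta> Nat \<dots> (Con Zero)"
      by (rule eqd_Asm) (use w e in auto)
    finally show "prv \<Gamma>' ?\<Delta> Fls" by (rule no)
  next
    let ?\<Delta> = "Eq (tlift j) (Con Succ \<cdot> Var 0) # map flift \<Delta>'"
    let ?i = "tlift i"
    have "flift (Eq (add \<cdot> (Con Succ \<cdot> i) \<cdot> j) (Con Zero)) \<in> set (map flift \<Delta>')"
      using e unfolding set_map by (rule imageI)
    then have e': "Eq (add \<cdot> (Con Succ \<cdot> ?i) \<cdot> tlift j) (Con Zero) \<in> set ?\<Delta>"
      by simp
    have "eqd (Nat # \<Gamma>') ?\<Delta> Nat (Con Succ \<cdot> (add \<cdot> (Con Succ \<cdot> ?i) \<cdot> Var 0)) (add \<cdot> (Con Succ \<cdot> ?i) \<cdot> (Con Succ \<cdot> Var 0))"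
      by (rule eqd_sym[OF eqd_add_Succ]) (use w in auto)
    also have "eqd (Nat # \<Gamma>') ?\<Delta> Nat \<dots> (add \<cdot> (Con Succ \<cdot> ?i) \<cdot> tlift j)"
      by (rule eqd_arg[OF _ eqd_sym[OF eqd_Asm]]) (use w in \<open>auto intro!: wt_AppI[of _ _ Nat]\<close>)
    also have "eqd (Nat # \<Gamma>') ?\<Delta> Nat \<dots> (Con Zero)"
      by (rule eqd_Asm) (use w e' in auto)
    finally have "prv (Nat # \<Gamma>') ?\<Delta> Fls" by (rule no)
    then show "prv (Nat # \<Gamma>') ?\<Delta> (flift Fls)" by simp
  qed simp
  have "prv \<Gamma> \<Delta> Fls"
    by (rule prv_ExE[OF assms(1)[unfolded less_def]]) (use assms(2) in \<open>auto intro!: A[of "tlift i" "Var 0"]\<close>)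
  then show ?thesis by (rule nd.FlsE) (rule assms(3))
qed

text \<open>
  Split the witness \<open>j\<close> of \<open>S i + j = S k\<close>: for \<open>j = 0\<close> the numbers \<open>i\<close> and \<open>k\<close> are equal, otherwise its
  predecessor witnesses \<open>i < k\<close>.
\<close>

lemma prv_less_SuccE:
  assumes l: "prv \<Gamma> \<Delta> (less i (Con Succ \<cdot> k))" and w: "wt \<Gamma> i Nat" "wt \<Gamma> k Nat"
  shows "prv \<Gamma> \<Delta> (Or (less i k) (Eq i k))"
proof -
  have A: "prv \<Gamma>' \<Delta>' (Or (less i k) (Eq i k))"
    if e: "Eq (add \<cdot> (Con Succ \<cdot> i) \<cdot> j) (Con Succ \<cdot> k) \<in> set \<Delta>'"
    and w: "wt \<Gamma>' i Nat" "wt \<Gamma>' j Nat" "wt \<Gamma>' k Nat" for \<Gamma>' \<Delta>' i j k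
  proof (rule prv_Nat_cases[OF w(2)])
    let ?\<Delta> = "Eq j (Con Zero) # \<Delta>'"
    have "eqd \<Gamma>' ?\<Delta> Nat (Con Succ \<cdot> i) (add \<cdot> (Con Succ \<cdot> i) \<cdot> Con Zero)"
      by (rule eqd_sym[OF eqd_add_Zero]) (use w in simp)
    also have "eqd \<Gamma>' ?\<Delta> Nat \<dots> (add \<cdot> (Con Succ \<cdot> i) \<cdot> j)"
      by (rule eqd_arg[OF _ eqd_sym[OF eqd_Asm]]) (use w in \<open>auto intro!: wt_AppI[of _ _ Nat]\<close>)
    also have "eqd \<Gamma>' ?\<Delta> Nat \<dots> (Con Succ \<cdot> k)"
      by (rule eqd_Asm) (use w e in auto)
    finally have "eqd \<Gamma>' ?\<Delta> Nat i k" by (rule eqd_Succ_inj)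
    then show "prv \<Gamma>' ?\<Delta> (Or (less i k) (Eq i k))"
      using w by (intro nd.OrI2) (auto simp: eqd_Nat)
  next
    let ?\<Delta> = "Eq (tlift j) (Con Succ \<cdot> Var 0) # map flift \<Delta>'"
    let ?i = "tlift i" and ?k = "tlift k"
    have "flift (Eq (add \<cdot> (Con Succ \<cdot> i) \<cdot> j) (Con Succ \<cdot> k)) \<in> set (map flift \<Delta>')"
      using e unfolding set_map by (rule imageI)
    then have e': "Eq (add \<cdot> (Con Succ \<cdot> ?i) \<cdot> tlift j) (Con Succ \<cdot> ?k) \<in> set ?\<Delta>"
      by simp
    have "eqd (Nat # \<Gamma>') ?\<Delta> Nat (Con Succ \<cdot> (add \<cdot> (Con Succ \<cdot> ?i) \<cdot> Var 0)) (add \<cdot> (Con Succ \<cdot> ?i) \<cdot> (Con Succ \<cdot> Var 0))"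
      by (rule eqd_sym[OF eqd_add_Succ]) (use w in auto)
    also have "eqd (Nat # \<Gamma>') ?\<Delta> Nat \<dots> (add \<cdot> (Con Succ \<cdot> ?i) \<cdot> tlift j)"
      by (rule eqd_arg[OF _ eqd_sym[OF eqd_Asm]]) (use w in \<open>auto intro!: wt_AppI[of _ _ Nat]\<close>)
    also have "eqd (Nat # \<Gamma>') ?\<Delta> Nat \<dots> (Con Succ \<cdot> ?k)"
      by (rule eqd_Asm) (use w e' in auto)
    finally have "eqd (Nat # \<Gamma>') ?\<Delta> Nat (add \<cdot> (Con Succ \<cdot> ?i) \<cdot> Var 0) ?k" by (rule eqd_Succ_inj)
    then have "prv (Nat # \<Gamma>') ?\<Delta> (less ?i ?k)"
      unfolding less_def using w by (intro prv_ExI[where t="Var 0"]) (auto simp: eqd_Nat)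
    then show "prv (Nat # \<Gamma>') ?\<Delta> (flift (Or (less i k) (Eq i k)))"
      using w by (simp, intro nd.OrI1) auto
  qed (use w in auto)
  have "prv (Nat # \<Gamma>) (Eq (add \<cdot> (Con Succ \<cdot> tlift i) \<cdot> Var 0) (tlift (Con Succ \<cdot> k)) # map flift \<Delta>)
      (flift (Or (less i k) (Eq i k)))"
    using w by (simp, intro A[of "tlift i" "Var 0" "tlift k"]) auto
  then show ?thesis
    by (rule prv_ExE[OF l[unfolded less_def], rotated]) (use w in auto)
qed

section \<open>Changing one value of a function\<close>

text \<open>
  The composition of \<open>f\<close> with the successor, \<open>\<lambda>j. f (S j)\<close>, as the combinator term \<open>S (K f) S\<close>.
\<close>

definition compSucc :: "ty \<Rightarrow> tm \<Rightarrow> tm" where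
  "compSucc \<sigma> f = Con (Sc Nat Nat \<sigma>) \<cdot> (Con (Kc (Nat \<rightarrow> \<sigma>) Nat) \<cdot> f) \<cdot> Con Succ"

text \<open>
  The function with value \<open>a\<close> at 0 and \<open>g j\<close> at \<open>S j\<close>, by a recursion whose step ignores the value at \<open>j\<close>.
\<close>

definition natcase :: "ty \<Rightarrow> tm \<Rightarrow> tm \<Rightarrow> tm" where
  "natcase \<sigma> a g = Con (Rc \<sigma>) \<cdot> a \<cdot> (Con (Kc (Nat \<rightarrow> \<sigma>) \<sigma>) \<cdot> g)"

lemma wt_compSucc [simp]: "wt \<Gamma> (compSucc \<sigma> f) \<tau> \<longleftrightarrow> wt \<Gamma> f (Nat \<rightarrow> \<sigma>) \<and> \<tau> = Nat \<rightarrow> \<sigma>"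
  by (auto simp: compSucc_def wt.simps)

lemma wt_natcase [simp]: "wt \<Gamma> (natcase \<sigma> a g) \<tau> \<longleftrightarrow> wt \<Gamma> a \<sigma> \<and> wt \<Gamma> g (Nat \<rightarrow> \<sigma>) \<and> \<tau> = Nat \<rightarrow> \<sigma>"
  by (auto simp: natcase_def wt.simps)

lemma tsubst_compSucc [simp]: "tsubst \<theta> (compSucc \<sigma> f) = compSucc \<sigma> (tsubst \<theta> f)"
  by (simp add: compSucc_def)

lemma tsubst_natcase [simp]: "tsubst \<theta> (natcase \<sigma> a g) = natcase \<sigma> (tsubst \<theta> a) (tsubst \<theta> g)"
  by (simp add: natcase_def)

lemma eqd_compSucc:
  assumes "wt \<Gamma> f (Nat \<rightarrow> \<sigma>)" "wt \<Gamma> j Nat"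
  shows "eqd \<Gamma> \<Delta> \<sigma> (compSucc \<sigma> f \<cdot> j) (f \<cdot> (Con Succ \<cdot> j))"
proof -
  have "eqd \<Gamma> \<Delta> \<sigma> (compSucc \<sigma> f \<cdot> j) (Con (Kc (Nat \<rightarrow> \<sigma>) Nat) \<cdot> f \<cdot> j \<cdot> (Con Succ \<cdot> j))"
    unfolding compSucc_def by (rule eqd_S) (use assms in \<open>auto simp: wt.simps\<close>)
  also have "eqd \<Gamma> \<Delta> \<sigma> \<dots> (f \<cdot> (Con Succ \<cdot> j))"
    by (rule eqd_fun1[OF eqd_K]) (use assms in auto)
  finally show ?thesis .
qed

lemma eqd_natcase_Zero:
  "wt \<Gamma> a \<sigma> \<Longrightarrow> wt \<Gamma> g (Nat \<rightarrow> \<sigma>) \<Longrightarrow> eqd \<Gamma> \<Delta> \<sigma> (natcase \<sigma> a g \<cdot> Con Zero) a"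
  unfolding natcase_def by (rule eqd_R_Zero) (auto simp: wt.simps)

lemma eqd_natcase_Succ:
  assumes "wt \<Gamma> a \<sigma>" "wt \<Gamma> g (Nat \<rightarrow> \<sigma>)" "wt \<Gamma> j Nat"
  shows "eqd \<Gamma> \<Delta> \<sigma> (natcase \<sigma> a g \<cdot> (Con Succ \<cdot> j)) (g \<cdot> j)"
proof -
  let ?K = "Con (Kc (Nat \<rightarrow> \<sigma>) \<sigma>)"
  have "eqd \<Gamma> \<Delta> \<sigma> (natcase \<sigma> a g \<cdot> (Con Succ \<cdot> j)) (?K \<cdot> g \<cdot> (natcase \<sigma> a g \<cdot> j) \<cdot> j)"
    unfolding natcase_def by (rule eqd_R_Succ) (use assms in \<open>auto simp: wt.simps\<close>)
  also have "eqd \<Gamma> \<Delta> \<sigma> \<dots> (g \<cdot> j)"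
    by (rule eqd_fun1[OF eqd_K]) (use assms in \<open>auto intro!: wt_AppI[of _ _ Nat]\<close>)
  finally show ?thesis .
qed

text \<open>
  \<open>g\<close> is \<open>f\<close> with the value at \<open>m\<close> changed to \<open>x\<close>. The disjunction is stronger than the implication
  from \<open>n \<noteq> m\<close>: it decides at each \<open>n\<close> which of the two cases holds.
\<close>

definition updated :: "ty \<Rightarrow> tm \<Rightarrow> tm \<Rightarrow> tm \<Rightarrow> tm \<Rightarrow> fm" where
  "updated \<sigma> f m x g = And (eq \<sigma> (g \<cdot> m) x)
     (All Nat (Or (Eq (Var 0) (tlift m)) (eq \<sigma> (tlift g \<cdot> Var 0) (tlift f \<cdot> Var 0))))"

lemma fsubst_updated [simp]:
  "fsubst \<theta> (updated \<sigma> f m x g) = updated \<sigma> (tsubst \<theta> f) (tsubst \<theta> m) (tsubst \<theta> x) (tsubst \<theta> g)"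
  by (simp add: updated_def)

lemma internal_updated [simp]: "internal (updated \<sigma> f m x g)"
  by (simp add: updated_def)

lemma wt_lift_App_Var [simp]: "wt \<Gamma> f (\<sigma> \<rightarrow> \<tau>) \<Longrightarrow> wt (\<sigma> # \<Gamma>) (tlift f \<cdot> Var 0) \<tau>"
  by (rule wt_AppI[OF wt_tlift]) auto

lemma wff_updated [simp]:
  "wt \<Gamma> f (Nat \<rightarrow> \<sigma>) \<Longrightarrow> wt \<Gamma> m Nat \<Longrightarrow> wt \<Gamma> x \<sigma> \<Longrightarrow> wt \<Gamma> g (Nat \<rightarrow> \<sigma>) \<Longrightarrow> wff \<Gamma> (updated \<sigma> f m x g)"
  by (auto simp: updated_def intro: wff_eq wt_AppI)

text \<open>
  The second conjunct needs only a distinction between zero and successors, whence the trivial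
  induction.
\<close>

lemma updatedI:
  assumes w: "wt \<Gamma> f (Nat \<rightarrow> \<sigma>)" "wt \<Gamma> m Nat" "wt \<Gamma> x \<sigma>" "wt \<Gamma> g (Nat \<rightarrow> \<sigma>)"
    and "eqd \<Gamma> \<Delta> \<sigma> (g \<cdot> m) x"
    and Zero: "prv \<Gamma> \<Delta> (Or (Eq (Con Zero) m) (eq \<sigma> (g \<cdot> Con Zero) (f \<cdot> Con Zero)))"
    and Suc: "prv (Nat # \<Gamma>) (map flift \<Delta>) (Or (Eq (Con Succ \<cdot> Var 0) (tlift m))
        (eq \<sigma> (tlift g \<cdot> (Con Succ \<cdot> Var 0)) (tlift f \<cdot> (Con Succ \<cdot> Var 0))))"
  shows "prv \<Gamma> \<Delta> (updated \<sigma> f m x g)"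
proof -
  let ?\<phi> = "Or (Eq (Var 0) (tlift m)) (eq \<sigma> (tlift g \<cdot> Var 0) (tlift f \<cdot> Var 0))"
  have "prv \<Gamma> \<Delta> (All Nat ?\<phi>)"
  proof (rule prv_induct)
    show "prv \<Gamma> \<Delta> (fsubst (psub [Con Zero] 0) ?\<phi>)"
      using Zero by simp
    show "prv (Nat # \<Gamma>) (?\<phi> # map flift \<Delta>) (fsubst (psub [Con Succ \<cdot> Var 0] 1) ?\<phi>)"
      using nd_weaken[OF Suc, of "?\<phi> # map flift \<Delta>"] by (simp add: subset_insertI)
  qed (use w in auto)
  then show ?thesis
    unfolding updated_def using assms(5) by (intro nd.AndI) (auto simp: eqd_def)
qed

lemma updated_Zero:
  assumes w: "wt \<Gamma> f (Nat \<rightarrow> \<sigma>)" "wt \<Gamma> x \<sigma>"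
  shows "prv \<Gamma> \<Delta> (updated \<sigma> f (Con Zero) x (natcase \<sigma> x (compSucc \<sigma> f)))"
proof (rule updatedI)
  let ?g = "natcase \<sigma> x (compSucc \<sigma> f)"
  show "eqd \<Gamma> \<Delta> \<sigma> (?g \<cdot> Con Zero) x"
    by (rule eqd_natcase_Zero) (use w in auto)
  show "prv \<Gamma> \<Delta> (Or (Eq (Con Zero) (Con Zero)) (eq \<sigma> (?g \<cdot> Con Zero) (f \<cdot> Con Zero)))"
    by (intro nd.OrI1 prv_EHA EHA.refl wff_eq wt_AppI[of _ _ Nat]) (use w in auto)
  have "eqd (Nat # \<Gamma>) (map flift \<Delta>) \<sigma> (tlift ?g \<cdot> (Con Succ \<cdot> Var 0)) (compSucc \<sigma> (tlift f) \<cdot> Var 0)"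
    by (simp, rule eqd_natcase_Succ) (use w in auto)
  also have "eqd (Nat # \<Gamma>) (map flift \<Delta>) \<sigma> \<dots> (tlift f \<cdot> (Con Succ \<cdot> Var 0))"
    by (rule eqd_compSucc) (use w in auto)
  finally show "prv (Nat # \<Gamma>) (map flift \<Delta>) (Or (Eq (Con Succ \<cdot> Var 0) (tlift (Con Zero)))
        (eq \<sigma> (tlift ?g \<cdot> (Con Succ \<cdot> Var 0)) (tlift f \<cdot> (Con Succ \<cdot> Var 0))))"
    by (intro nd.OrI2) (auto simp: eqd_def)
qed (use w in auto)

text \<open>
  To change \<open>f\<close> at \<open>S m\<close>, change \<open>\<lambda>j. f (S j)\<close> at \<open>m\<close> and put back the old value at 0.
\<close>

lemma updated_Succ:
  assumes w: "wt \<Gamma> f (Nat \<rightarrow> \<sigma>)" "wt \<Gamma> m Nat" "wt \<Gamma> x \<sigma>" "wt \<Gamma> g (Nat \<rightarrow> \<sigma>)"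
    and u: "updated \<sigma> (compSucc \<sigma> f) m x g \<in> set \<Delta>"
  shows "prv \<Gamma> \<Delta> (updated \<sigma> f (Con Succ \<cdot> m) x (natcase \<sigma> (f \<cdot> Con Zero) g))"
proof -
  let ?g = "natcase \<sigma> (f \<cdot> Con Zero) g"
  have f0: "wt \<Gamma> (f \<cdot> Con Zero) \<sigma>" by (rule wt_AppI[OF w(1)]) simp
  have f0': "wt (Nat # \<Gamma>) (tlift f \<cdot> Con Zero) \<sigma>" using wt_tlift[OF f0] by simp
  show ?thesis
  proof (rule updatedI)
  have U: "prv \<Gamma> \<Delta> (updated \<sigma> (compSucc \<sigma> f) m x g)"
    by (rule nd.Asm[OF u]) (use w in auto)
  have "eqd \<Gamma> \<Delta> \<sigma> (?g \<cdot> (Con Succ \<cdot> m)) (g \<cdot> m)"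
    by (rule eqd_natcase_Succ) (use w f0 in auto)
  also have "eqd \<Gamma> \<Delta> \<sigma> \<dots> x"
    by (rule eqdI[OF _ _ nd.AndE1[OF U[unfolded updated_def]]]) (use w in \<open>auto intro: wt_AppI[of _ _ Nat]\<close>)
  finally show "eqd \<Gamma> \<Delta> \<sigma> (?g \<cdot> (Con Succ \<cdot> m)) x" .
  show "prv \<Gamma> \<Delta> (Or (Eq (Con Zero) (Con Succ \<cdot> m)) (eq \<sigma> (?g \<cdot> Con Zero) (f \<cdot> Con Zero)))"
    by (intro nd.OrI2 eqd_prv[OF eqd_natcase_Zero]) (use w f0 in auto)
  let ?\<Delta> = "map flift \<Delta>" and ?j = "Var 0" and ?\<Gamma> = "Nat # \<Gamma>" and ?m = "tlift m"
  let ?D = "Or (Eq (Con Succ \<cdot> ?j) (tlift (Con Succ \<cdot> m)))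
        (eq \<sigma> (tlift ?g \<cdot> (Con Succ \<cdot> ?j)) (tlift f \<cdot> (Con Succ \<cdot> ?j)))"
  have "flift (updated \<sigma> (compSucc \<sigma> f) m x g) \<in> set ?\<Delta>"
    using u unfolding set_map by (rule imageI)
  then have "updated \<sigma> (compSucc \<sigma> (tlift f)) ?m (tlift x) (tlift g) \<in> set ?\<Delta>" by simp
  then have "prv ?\<Gamma> ?\<Delta> (updated \<sigma> (compSucc \<sigma> (tlift f)) ?m (tlift x) (tlift g))"
    by (rule nd.Asm) (use w in auto)
  then have O: "prv ?\<Gamma> ?\<Delta> (Or (Eq ?j ?m) (eq \<sigma> (tlift g \<cdot> ?j) (compSucc \<sigma> (tlift f) \<cdot> ?j)))"
    unfolding updated_def by (rule prv_AllE[OF nd.AndE2, where t="?j"]) auto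
  show "prv ?\<Gamma> ?\<Delta> ?D"
  proof (rule nd.OrE[OF O])
    have w': "wt ?\<Gamma> (tlift ?g \<cdot> (Con Succ \<cdot> ?j)) \<sigma>" "wt ?\<Gamma> (tlift f \<cdot> (Con Succ \<cdot> ?j)) \<sigma>"
      using w f0' by (auto intro!: wt_AppI[of _ _ Nat])
    have "eqd ?\<Gamma> (Eq ?j ?m # ?\<Delta>) Nat (Con Succ \<cdot> ?j) (Con Succ \<cdot> ?m)"
      by (rule eqd_arg[OF _ eqd_Asm]) (use w in auto)
    then show "prv ?\<Gamma> (Eq ?j ?m # ?\<Delta>) ?D"
      using w' by (intro nd.OrI1 wff_eq) (auto simp: eqd_Nat)
    let ?\<Delta>2 = "eq \<sigma> (tlift g \<cdot> ?j) (compSucc \<sigma> (tlift f) \<cdot> ?j) # ?\<Delta>"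
    have "eqd ?\<Gamma> ?\<Delta>2 \<sigma> (tlift ?g \<cdot> (Con Succ \<cdot> ?j)) (tlift g \<cdot> ?j)"
      by (simp, rule eqd_natcase_Succ) (use w f0' in auto)
    also have "eqd ?\<Gamma> ?\<Delta>2 \<sigma> \<dots> (compSucc \<sigma> (tlift f) \<cdot> ?j)"
      by (rule eqd_Asm) (use w in \<open>auto intro!: wt_AppI[of _ _ Nat]\<close>)
    also have "eqd ?\<Gamma> ?\<Delta>2 \<sigma> \<dots> (tlift f \<cdot> (Con Succ \<cdot> ?j))"
      by (rule eqd_compSucc) (use w in auto)
    finally show "prv ?\<Gamma> ?\<Delta>2 ?D"
      using w by (intro nd.OrI2) (auto simp: eqd_def)
  qed
qed (use w f0 in auto)
qed

text \<open>
  Internal induction on \<open>m\<close>, for all \<open>f\<close> and \<open>x\<close> at once because the step changes \<open>f\<close>.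
\<close>

lemma prv_updated:
  assumes w: "wt \<Gamma> f (Nat \<rightarrow> \<sigma>)" "wt \<Gamma> m Nat" "wt \<Gamma> x \<sigma>"
  shows "prv \<Gamma> \<Delta> (Ex (Nat \<rightarrow> \<sigma>) (updated \<sigma> (tlift f) (tlift m) (tlift x) (Var 0)))"
proof -
  let ?V = "\<lambda>n. (Var n :: tm)"
  let ?\<psi> = "\<lambda>f m x. Ex (Nat \<rightarrow> \<sigma>) (updated \<sigma> (tlift f) (tlift m) (tlift x) (Var 0))"
  let ?\<phi> = "All (Nat \<rightarrow> \<sigma>) (All \<sigma> (?\<psi> (Var 1) (Var 2) (Var 0)))"
  have inst: "prv \<Gamma>' \<Delta>' (?\<psi> f m x)"
    if "prv \<Gamma>' \<Delta>' (All (Nat \<rightarrow> \<sigma>) (All \<sigma> (?\<psi> (Var 1) (tlift (tlift m)) (Var 0))))"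
      "wt \<Gamma>' f (Nat \<rightarrow> \<sigma>)" "wt \<Gamma>' x \<sigma>" for \<Gamma>' \<Delta>' f x m
    by (rule prv_AllE[OF prv_AllE[OF that(1,2) HOL.refl, simplified] that(3)]) (simp add: eval_nat_numeral)
  have "prv \<Gamma> \<Delta> (All Nat ?\<phi>)"
  proof (rule prv_induct)
    have "prv (\<sigma> # (Nat \<rightarrow> \<sigma>) # \<Gamma>) (map flift (map flift \<Delta>)) (?\<psi> (Var 1) (Con Zero) (Var 0))"
      by (rule prv_ExI[where t="natcase \<sigma> (Var 0) (compSucc \<sigma> (Var 1))"])
        (use updated_Zero[of "\<sigma> # (Nat \<rightarrow> \<sigma>) # \<Gamma>" "Var 1" \<sigma> "Var 0"] in \<open>auto simp: eval_nat_numeral\<close>)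
    then show "prv \<Gamma> \<Delta> (fsubst (psub [Con Zero] 0) ?\<phi>)"
      by (auto simp: eval_nat_numeral intro!: nd.AllI)
    let ?\<Gamma> = "\<sigma> # (Nat \<rightarrow> \<sigma>) # Nat # \<Gamma>" and ?\<Delta> = "map flift (map flift (?\<phi> # map flift \<Delta>))"
    have "prv ?\<Gamma> ?\<Delta> (flift (flift ?\<phi>))"
      by (rule nd.Asm) (auto simp: eval_nat_numeral)
    then have "prv ?\<Gamma> ?\<Delta> (All (Nat \<rightarrow> \<sigma>) (All \<sigma> (?\<psi> (Var 1) (tlift (tlift (Var 2))) (Var 0))))"
      by (simp add: eval_nat_numeral)
    then have A: "prv ?\<Gamma> ?\<Delta> (?\<psi> (compSucc \<sigma> (Var 1)) (Var 2) (Var 0))"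
      by (rule inst) auto
    have B: "prv ((Nat \<rightarrow> \<sigma>) # ?\<Gamma>) (updated \<sigma> (compSucc \<sigma> (Var 2)) (Var 3) (Var 1) (Var 0) # map flift ?\<Delta>)
        (flift (?\<psi> (Var 1) (Con Succ \<cdot> Var 2) (Var 0)))"
      by (simp, rule prv_ExI[where t="natcase \<sigma> (Var 2 \<cdot> Con Zero) (Var 0)"])
        (use updated_Succ[of "(Nat \<rightarrow> \<sigma>) # ?\<Gamma>" "Var 2" \<sigma> "Var 3" "Var 1" "Var 0"] in
          \<open>auto simp: eval_nat_numeral intro: wt_AppI\<close>)
    have "prv ?\<Gamma> ?\<Delta> (?\<psi> (Var 1) (Con Succ \<cdot> Var 2) (Var 0))"
      by (rule prv_ExE[OF A _ nd_weaken[OF B]]) (auto simp: eval_nat_numeral)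
    then show "prv (Nat # \<Gamma>) (?\<phi> # map flift \<Delta>) (fsubst (psub [Con Succ \<cdot> Var 0] 1) ?\<phi>)"
      by (auto simp: eval_nat_numeral intro!: nd.AllI)
  qed (auto simp: eval_nat_numeral)
  then have "prv \<Gamma> \<Delta> (All (Nat \<rightarrow> \<sigma>) (All \<sigma> (?\<psi> (Var 1) (tlift (tlift m)) (Var 0))))"
    by (rule prv_AllE[OF _ w(2)]) (simp add: eval_nat_numeral)
  then show ?thesis
    by (rule inst[OF _ w(1,3)])
qed

section \<open>Instances of a formula in two variables\<close>

text \<open>
  The hypothesis says that \<open>\<theta>\<close> merely renumbers the variables beyond the first \<open>d\<close> ones, so that
  composition with \<open>\<theta>\<close> keeps the shape of a \<open>psub\<close>.
\<close>

lemma psub_comp: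
  assumes "\<And>j. \<theta> (j + d) = Var (j + d')"
  shows "(\<lambda>i. tsubst \<theta> (psub ts d i)) = psub (map (tsubst \<theta>) ts) d'"
proof
  fix i show "tsubst \<theta> (psub ts d i) = psub (map (tsubst \<theta>) ts) d' i"
  proof (cases "i < length ts")
    case False
    then show ?thesis using assms[of "i - length ts"] by (simp add: psub_def)
  qed (simp add: psub_def rev_nth)
qed

lemma fsubst_plug:
  "(\<And>j. \<theta> (j + d) = Var (j + d')) \<Longrightarrow> fsubst \<theta> (plug ts d \<phi>) = plug (map (tsubst \<theta>) ts) d' \<phi>"
  by (simp add: plug_psub psub_comp)

lemma flift_plug [simp]: "flift (plug ts d \<phi>) = plug (map tlift ts) (Suc d) \<phi>"
  by (rule fsubst_plug) simp

lemma inst_plug [simp]: "fsubst (psub [t] 0) (plug ts (Suc d) \<phi>) = plug (map (tsubst (psub [t] 0)) ts) d \<phi>"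
  by (rule fsubst_plug) simp

lemma wff_plug2:
  assumes "wff (\<sigma> # Nat # \<Gamma>) \<chi>" "wt \<Gamma>' n Nat" "wt \<Gamma>' x \<sigma>" "\<Gamma>' = G @ \<Gamma>" "d = length G"
  shows "wff \<Gamma>' (plug [n, x] d \<chi>)"
  by (rule wff_plug[where \<tau>s="[Nat, \<sigma>]" and G=G and \<Gamma>=\<Gamma>]) (use assms in auto)

lemma prv_Leibniz2:
  assumes "wff (\<sigma> # Nat # \<Gamma>) \<chi>" "internal \<chi>" "\<Gamma>' = G @ \<Gamma>" "d = length G"
    and "eqd \<Gamma>' \<Delta> Nat n n'" "eqd \<Gamma>' \<Delta> \<sigma> x x'" "prv \<Gamma>' \<Delta> (plug [n, x] d \<chi>)"
  shows "prv \<Gamma>' \<Delta> (plug [n', x'] d \<chi>)"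
  unfolding plug_psub
proof (rule prv_Leibniz[OF assms(2,1)])
  fix i assume i: "i < length (\<sigma> # Nat # \<Gamma>)"
  consider "i = 0" | "i = 1" | j where "i = Suc (Suc j)"
    by (cases i rule: nat.exhaust) (auto simp: less_Suc_eq_0_disj, metis One_nat_def not0_implies_Suc)
  then show "eqd \<Gamma>' \<Delta> ((\<sigma> # Nat # \<Gamma>) ! i) (psub [n, x] d i) (psub [n', x'] d i)"
    by cases (use assms i in \<open>auto intro!: eqd_refl simp: nth_append\<close>)
qed (use assms(7) in \<open>simp add: plug_psub\<close>)

section \<open>Standard objects\<close>

lemma prv_AllStI:
  assumes "wff (\<sigma> # \<Gamma>) \<Phi>" "prv (\<sigma> # \<Gamma>) (St \<sigma> (Var 0) # map flift \<Delta>) \<Phi>"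
  shows "prv \<Gamma> \<Delta> (AllSt \<sigma> \<Phi>)"
  by (rule prv_mp[OF nd.AndE2[OF prv_EHAst[OF EHAst.AllSt[OF assms(1)]]]])
    (intro nd.AllI nd.ImpI assms; simp)

lemma prv_AllStE:
  assumes "prv \<Gamma> \<Delta> (AllSt \<sigma> \<Phi>)" "wff (\<sigma> # \<Gamma>) \<Phi>" "wt \<Gamma> t \<sigma>" "prv \<Gamma> \<Delta> (St \<sigma> t)"
    "fsubst (psub [t] 0) \<Phi> = \<Psi>"
  shows "prv \<Gamma> \<Delta> \<Psi>"
proof -
  have "prv \<Gamma> \<Delta> (All \<sigma> (Imp (St \<sigma> (Var 0)) \<Phi>))"
    by (rule prv_mp[OF nd.AndE1[OF prv_EHAst[OF EHAst.AllSt[OF assms(2)]]] assms(1)])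
  then have "prv \<Gamma> \<Delta> (Imp (St \<sigma> t) \<Psi>)"
    by (rule prv_AllE[OF _ assms(3)]) (simp add: assms(5))
  then show ?thesis by (rule prv_mp[OF _ assms(4)])
qed

lemma prv_St_proj:
  assumes "prv \<Gamma> \<Delta> (St (Seq \<sigma>) s)" "prv \<Gamma> \<Delta> (St Nat k)" "wt \<Gamma> s (Seq \<sigma>)" "wt \<Gamma> k Nat"
  shows "prv \<Gamma> \<Delta> (St \<sigma> (proj \<sigma> \<cdot> s \<cdot> k))"
proof -
  have ap: "prv \<Gamma> \<Delta> (St \<tau> (f \<cdot> t))" if "prv \<Gamma> \<Delta> (St (\<rho> \<rightarrow> \<tau>) f)" "prv \<Gamma> \<Delta> (St \<rho> t)"
    "wt \<Gamma> f (\<rho> \<rightarrow> \<tau>)" "wt \<Gamma> t \<rho>" for f t \<rho> \<tau>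
    by (rule prv_mp[OF prv_EHAst[OF EHAst.St_App[OF that(3,4)]] nd.AndI[OF that(1,2)]])
  show ?thesis
    by (rule ap[OF ap[OF prv_EHAst[OF EHAst.St_closed[OF wt_proj]] assms(1)] assms(2)])
      (use assms in \<open>auto intro: wt_AppI[of _ _ "Seq \<sigma>"]\<close>)
qed

lemma prv_St_len:
  assumes "prv \<Gamma> \<Delta> (St (Seq \<sigma>) s)" "wt \<Gamma> s (Seq \<sigma>)"
  shows "prv \<Gamma> \<Delta> (St Nat (len \<sigma> \<cdot> s))"
  by (rule prv_mp[OF prv_EHAst[OF EHAst.St_App] nd.AndI[OF prv_EHAst[OF EHAst.St_closed[OF wt_len]] assms(1)]])
    (use assms in auto)

section \<open>Choosing finitely many values\<close>

text \<open>
  The function \<open>f\<close> is a correct choice at those components of \<open>s\<close> whose number is below \<open>k\<close>. The terms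
  live below \<open>d\<close> variables of the context of \<open>\<chi>\<close>. For numbers beyond the length of \<open>s\<close> this speaks of
  the default value of \<open>proj\<close>, which is standard as well; so \<open>k\<close> need not be bounded by the length.
\<close>

definition chosen :: "fm \<Rightarrow> tm \<Rightarrow> tm \<Rightarrow> tm \<Rightarrow> nat \<Rightarrow> fm" where
  "chosen \<chi> s f k d = All Nat (Imp (less (Var 0) (tlift k))
     (plug [proj Nat \<cdot> tlift s \<cdot> Var 0, tlift f \<cdot> (proj Nat \<cdot> tlift s \<cdot> Var 0)] (Suc d) \<chi>))"

lemma fsubst_chosen:
  assumes "\<And>j. \<theta> (j + d) = Var (j + d')"
  shows "fsubst \<theta> (chosen \<chi> s f k d) = chosen \<chi> (tsubst \<theta> s) (tsubst \<theta> f) (tsubst \<theta> k) d'"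
  using assms by (simp add: chosen_def fsubst_plug[where d' = "Suc d'"])

lemma flift_chosen [simp]:
  "flift (chosen \<chi> s f k d) = chosen \<chi> (tlift s) (tlift f) (tlift k) (Suc d)"
  by (rule fsubst_chosen) simp

lemma wff_chosen:
  assumes "wff (\<sigma> # Nat # \<Gamma>) \<chi>" "\<Gamma>' = G @ \<Gamma>" "d = length G"
    "wt \<Gamma>' s (Seq Nat)" "wt \<Gamma>' f (Nat \<rightarrow> \<sigma>)" "wt \<Gamma>' k Nat"
  shows "wff \<Gamma>' (chosen \<chi> s f k d)"
  unfolding chosen_def
  using assms by (auto intro!: wff_plug2[where G="Nat # G" and \<Gamma>=\<Gamma> and \<sigma>=\<sigma>] intro: wt_AppI[OF wt_tlift])

lemma chosenD:
  assumes "prv \<Gamma>' \<Delta> (chosen \<chi> s f k d)" "prv \<Gamma>' \<Delta> (less i k)" "wt \<Gamma>' i Nat"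
  shows "prv \<Gamma>' \<Delta> (plug [proj Nat \<cdot> s \<cdot> i, f \<cdot> (proj Nat \<cdot> s \<cdot> i)] d \<chi>)"
  by (rule prv_mp[OF prv_AllE[OF assms(1)[unfolded chosen_def] assms(3) HOL.refl, simplified] assms(2)])

lemma flift_in: "\<phi> \<in> set \<Delta> \<Longrightarrow> flift \<phi> \<in> set (map flift \<Delta>)"
  by simp

text \<open>
  There are three cases for the component \<open>p\<close> with number \<open>i\<close>. If \<open>i = k\<close>, it is the argument at which
  the value was changed to the correct \<open>x\<close>. If \<open>i < k\<close>, it may still be equal to that argument, and is
  then treated in the same way; otherwise \<open>g\<close> agrees with \<open>f\<close> at it.
\<close>

lemma chosen_Succ_instance:
  assumes \<chi>: "wff (\<sigma> # Nat # \<Gamma>) \<chi>" "internal \<chi>" "\<Gamma>' = G @ \<Gamma>" "d = length G"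
    and w: "wt \<Gamma>' s (Seq Nat)" "wt \<Gamma>' f (Nat \<rightarrow> \<sigma>)" "wt \<Gamma>' g (Nat \<rightarrow> \<sigma>)" "wt \<Gamma>' k Nat" "wt \<Gamma>' x \<sigma>" "wt \<Gamma>' i Nat"
    and c: "chosen \<chi> s f k d \<in> set \<Delta>"
    and x: "plug [proj Nat \<cdot> s \<cdot> k, x] d \<chi> \<in> set \<Delta>"
    and u: "updated \<sigma> f (proj Nat \<cdot> s \<cdot> k) x g \<in> set \<Delta>"
    and l: "less i (Con Succ \<cdot> k) \<in> set \<Delta>"
  shows "prv \<Gamma>' \<Delta> (plug [proj Nat \<cdot> s \<cdot> i, g \<cdot> (proj Nat \<cdot> s \<cdot> i)] d \<chi>)"
proof -
  let ?p = "proj Nat \<cdot> s \<cdot> i" and ?m = "proj Nat \<cdot> s \<cdot> k"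
  let ?C = "plug [?p, g \<cdot> ?p] d \<chi>"
  have wp: "wt \<Gamma>' ?p Nat" "wt \<Gamma>' ?m Nat" using w by auto
  have wg: "wt \<Gamma>' (g \<cdot> ?p) \<sigma>" "wt \<Gamma>' (f \<cdot> ?p) \<sigma>" "wt \<Gamma>' (g \<cdot> ?m) \<sigma>"
    using w wp by (auto intro: wt_AppI)
  have U: "prv \<Gamma>' \<Delta>' (updated \<sigma> f ?m x g)" if "set \<Delta> \<subseteq> set \<Delta>'" for \<Delta>'
    by (rule nd.Asm) (use u w that in auto)
  have new: "prv \<Gamma>' \<Delta>' ?C" if \<Delta>': "set \<Delta> \<subseteq> set \<Delta>'" and e: "eqd \<Gamma>' \<Delta>' Nat ?p ?m" for \<Delta>'
  proof (rule prv_Leibniz2[OF \<chi> eqd_sym[OF e]])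
    have "eqd \<Gamma>' \<Delta>' \<sigma> (g \<cdot> ?m) x"
      by (rule eqdI[OF wg(3) w(5) nd.AndE1[OF U[OF \<Delta>', unfolded updated_def]]])
    with eqd_arg[OF w(3) e] show "eqd \<Gamma>' \<Delta>' \<sigma> x (g \<cdot> ?p)"
      by (rule eqd_sym[OF eqd_trans])
    show "prv \<Gamma>' \<Delta>' (plug [?m, x] d \<chi>)"
      by (rule nd.Asm) (use x \<Delta>' wff_plug2[OF \<chi>(1) _ _ \<chi>(3,4)] wp w in auto)
  qed
  have L: "prv \<Gamma>' \<Delta> (Or (less i k) (Eq i k))"
    by (rule prv_less_SuccE[OF nd.Asm]) (use l w in auto)
  show ?thesis
  proof (rule nd.OrE[OF L])
    let ?\<Delta> = "less i k # \<Delta>"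
    have O: "prv \<Gamma>' ?\<Delta> (Or (Eq ?p ?m) (eq \<sigma> (g \<cdot> ?p) (f \<cdot> ?p)))"
      by (rule prv_AllE[OF nd.AndE2[OF U[unfolded updated_def]] wp(1)]) auto
    show "prv \<Gamma>' ?\<Delta> ?C"
    proof (rule nd.OrE[OF O])
      show "prv \<Gamma>' (Eq ?p ?m # ?\<Delta>) ?C"
        by (rule new[OF _ eqd_Asm]) (use wp in auto)
      let ?\<Delta>2 = "eq \<sigma> (g \<cdot> ?p) (f \<cdot> ?p) # ?\<Delta>"
      have F: "prv \<Gamma>' ?\<Delta>2 (plug [?p, f \<cdot> ?p] d \<chi>)"
        by (rule chosenD[OF nd.Asm nd.Asm w(6)]) (use c w wff_chosen[OF \<chi>(1,3,4)] in auto)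
      show "prv \<Gamma>' ?\<Delta>2 ?C"
        by (rule prv_Leibniz2[OF \<chi> eqd_refl[OF wp(1)] eqd_sym[OF eqd_Asm] F]) (use wg in auto)
    qed
  next
    have "eqd \<Gamma>' (Eq i k # \<Delta>) Nat ?p ?m"
      by (rule eqd_arg[OF _ eqd_Asm]) (use w in \<open>auto intro!: wt_AppI[of _ _ "Seq Nat"]\<close>)
    then show "prv \<Gamma>' (Eq i k # \<Delta>) ?C"
      by (rule new[rotated]) auto
  qed
qed

lemma chosen_Succ:
  assumes \<chi>: "wff (\<sigma> # Nat # \<Gamma>) \<chi>" "internal \<chi>" "\<Gamma>' = G @ \<Gamma>" "d = length G"
    and w: "wt \<Gamma>' s (Seq Nat)" "wt \<Gamma>' f (Nat \<rightarrow> \<sigma>)" "wt \<Gamma>' g (Nat \<rightarrow> \<sigma>)" "wt \<Gamma>' k Nat" "wt \<Gamma>' x \<sigma>"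
    and c: "chosen \<chi> s f k d \<in> set \<Delta>"
    and x: "plug [proj Nat \<cdot> s \<cdot> k, x] d \<chi> \<in> set \<Delta>"
    and u: "updated \<sigma> f (proj Nat \<cdot> s \<cdot> k) x g \<in> set \<Delta>"
  shows "prv \<Gamma>' \<Delta> (chosen \<chi> s g (Con Succ \<cdot> k) d)"
proof -
  let ?\<Delta> = "less (Var 0) (tlift (Con Succ \<cdot> k)) # map flift \<Delta>"
  have "prv (Nat # \<Gamma>') ?\<Delta> (plug [proj Nat \<cdot> tlift s \<cdot> Var 0, tlift g \<cdot> (proj Nat \<cdot> tlift s \<cdot> Var 0)] (Suc d) \<chi>)"
  proof (rule chosen_Succ_instance[OF \<chi>(1,2)])
    show "Nat # \<Gamma>' = (Nat # G) @ \<Gamma>" "Suc d = length (Nat # G)" using \<chi>(3,4) by auto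
    show "chosen \<chi> (tlift s) (tlift f) (tlift k) (Suc d) \<in> set ?\<Delta>"
      using flift_in[OF c] by simp
    show "plug [proj Nat \<cdot> tlift s \<cdot> tlift k, tlift x] (Suc d) \<chi> \<in> set ?\<Delta>"
      using flift_in[OF x] by simp
    show "updated \<sigma> (tlift f) (proj Nat \<cdot> tlift s \<cdot> tlift k) (tlift x) (tlift g) \<in> set ?\<Delta>"
      using flift_in[OF u] by simp
  qed (use w in auto)
  then show ?thesis
    unfolding chosen_def using w by (intro nd.AllI nd.ImpI) auto
qed

lemma prv_chosen_step:
  assumes \<chi>: "wff (\<sigma> # Nat # \<Gamma>) \<chi>" "internal \<chi>" "\<Gamma>' = G @ \<Gamma>" "d = length G"
    and w: "wt \<Gamma>' s (Seq Nat)" "wt \<Gamma>' f (Nat \<rightarrow> \<sigma>)" "wt \<Gamma>' k Nat" "wt \<Gamma>' x \<sigma>"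
    and c: "chosen \<chi> s f k d \<in> set \<Delta>"
    and x: "plug [proj Nat \<cdot> s \<cdot> k, x] d \<chi> \<in> set \<Delta>"
  shows "prv \<Gamma>' \<Delta> (Ex (Nat \<rightarrow> \<sigma>) (chosen \<chi> (tlift s) (Var 0) (Con Succ \<cdot> tlift k) (Suc d)))"
proof (rule prv_ExE[OF prv_updated[OF w(2) _ w(4)]])
  let ?\<Gamma> = "(Nat \<rightarrow> \<sigma>) # \<Gamma>'"
  let ?\<Delta> = "updated \<sigma> (tlift f) (tlift (proj Nat \<cdot> s \<cdot> k)) (tlift x) (Var 0) # map flift \<Delta>"
  have W: "wff ?\<Gamma> (chosen \<chi> (tlift s) (Var 0) (Con Succ \<cdot> tlift k) (Suc d))"
    by (rule wff_chosen[OF \<chi>(1), where G="(Nat \<rightarrow> \<sigma>) # G"]) (use w \<chi> in auto)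
  then show "wff \<Gamma>' (Ex (Nat \<rightarrow> \<sigma>) (chosen \<chi> (tlift s) (Var 0) (Con Succ \<cdot> tlift k) (Suc d)))"
    by simp
  have "prv ?\<Gamma> ?\<Delta> (chosen \<chi> (tlift s) (Var 0) (Con Succ \<cdot> tlift k) (Suc d))"
    by (rule chosen_Succ[OF \<chi>(1,2), where G="(Nat \<rightarrow> \<sigma>) # G" and f="tlift f" and x="tlift x"])
      (use w \<chi>(3,4) flift_in[OF c] flift_in[OF x] in auto)
  from prv_Ex_lift[OF this W]
  show "prv ?\<Gamma> ?\<Delta> (flift (Ex (Nat \<rightarrow> \<sigma>) (chosen \<chi> (tlift s) (Var 0) (Con Succ \<cdot> tlift k) (Suc d))))" .
qed (use w in auto)

text \<open>
  The component with standard number \<open>k\<close> of the standard sequence \<open>s\<close> is standard, so the hypothesis on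
  \<open>\<chi>\<close> provides a value for it.
\<close>

lemma prv_chosen_step_AllSt:
  assumes \<chi>: "wff (\<sigma> # Nat # \<Gamma>) \<chi>" "internal \<chi>" "\<Gamma>' = G @ \<Gamma>" "d = length G"
    and w: "wt \<Gamma>' s (Seq Nat)" "wt \<Gamma>' f (Nat \<rightarrow> \<sigma>)" "wt \<Gamma>' k Nat"
    and c: "chosen \<chi> s f k d \<in> set \<Delta>"
    and a: "AllSt Nat (Ex \<sigma> (plug [Var 1, Var 0] (Suc (Suc d)) \<chi>)) \<in> set \<Delta>"
    and st: "St (Seq Nat) s \<in> set \<Delta>" "St Nat k \<in> set \<Delta>"
  shows "prv \<Gamma>' \<Delta> (Ex (Nat \<rightarrow> \<sigma>) (chosen \<chi> (tlift s) (Var 0) (Con Succ \<cdot> tlift k) (Suc d)))"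
proof -
  let ?m = "proj Nat \<cdot> s \<cdot> k"
  let ?E = "Ex (Nat \<rightarrow> \<sigma>) (chosen \<chi> (tlift s) (Var 0) (Con Succ \<cdot> tlift k) (Suc d))"
  have W: "wff (Nat # \<Gamma>') (Ex \<sigma> (plug [Var 1, Var 0] (Suc (Suc d)) \<chi>))"
    by (simp, rule wff_plug2[OF \<chi>(1), where G="\<sigma> # Nat # G"]) (use \<chi> in auto)
  have "prv \<Gamma>' \<Delta> (Ex \<sigma> (plug [tlift ?m, Var 0] (Suc d) \<chi>))"
  proof (rule prv_AllStE[OF nd.Asm[OF a] W])
    show "prv \<Gamma>' \<Delta> (St Nat ?m)"
      by (rule prv_St_proj[OF nd.Asm nd.Asm]) (use st w in auto)
    show "fsubst (psub [?m] 0) (Ex \<sigma> (plug [Var 1, Var 0] (Suc (Suc d)) \<chi>)) = Ex \<sigma> (plug [tlift ?m, Var 0] (Suc d) \<chi>)"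
      by (simp add: fsubst_plug[where d'="Suc d"])
  qed (use w W in auto)
  then show ?thesis
  proof (rule prv_ExE)
    show "wff \<Gamma>' ?E"
      by (simp, rule wff_chosen[OF \<chi>(1), where G="(Nat \<rightarrow> \<sigma>) # G"]) (use w \<chi> in auto)
    have "prv (\<sigma> # \<Gamma>') (plug [tlift ?m, Var 0] (Suc d) \<chi> # map flift \<Delta>)
       (Ex (Nat \<rightarrow> \<sigma>) (chosen \<chi> (tlift (tlift s)) (Var 0) (Con Succ \<cdot> tlift (tlift k)) (Suc (Suc d))))"
      by (rule prv_chosen_step[OF \<chi>(1,2), where G="\<sigma> # G" and f="tlift f" and x="Var 0"])
        (use w \<chi>(3,4) flift_in[OF c] in auto)
    then show "prv (\<sigma> # \<Gamma>') (plug [tlift ?m, Var 0] (Suc d) \<chi> # map flift \<Delta>) (flift ?E)"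
      by (simp add: fsubst_chosen[where d'="Suc (Suc d)"])
  qed
qed

text \<open>
  External induction, since the step relies on the standardness of the induction variable.
\<close>

lemma prv_chosen_all:
  assumes \<chi>: "wff (\<sigma> # Nat # \<Gamma>) \<chi>" "internal \<chi>"
    and w: "wt \<Gamma> s (Seq Nat)"
    and a: "AllSt Nat (Ex \<sigma> \<chi>) \<in> set \<Delta>" and st: "St (Seq Nat) s \<in> set \<Delta>"
  shows "prv \<Gamma> \<Delta> (AllSt Nat (Ex (Nat \<rightarrow> \<sigma>) (chosen \<chi> (tlift (tlift s)) (Var 0) (Var 1) 2)))"
proof -
  let ?s2 = "tlift (tlift s)" and ?s3 = "tlift (tlift (tlift s))"
  let ?E = "Ex (Nat \<rightarrow> \<sigma>) (chosen \<chi> ?s2 (Var 0) (Var 1) 2)"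
  let ?E' = "Ex (Nat \<rightarrow> \<sigma>) (chosen \<chi> ?s2 (Var 0) (Con Succ \<cdot> Var 1) 2)"
  have \<chi>': "plug [Var 1, Var 0] (Suc (Suc 0)) \<chi> = \<chi>"
  proof -
    have "psub [Var 1, Var 0] (Suc (Suc 0)) = Var"
    proof
      fix i show "psub [Var 1, Var 0] (Suc (Suc 0)) i = Var i"
        by (cases i; cases "i - 1") (auto simp: psub_def)
    qed
    then show ?thesis by (simp add: plug_psub)
  qed
  have WC: "wff ((Nat \<rightarrow> \<sigma>) # Nat # \<Gamma>) (chosen \<chi> ?s2 (Var 0) k 2)" if "wt ((Nat \<rightarrow> \<sigma>) # Nat # \<Gamma>) k Nat" for k
    by (rule wff_chosen[OF \<chi>(1), where G="[Nat \<rightarrow> \<sigma>, Nat]"]) (use w that in auto)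
  then have W: "wff (Nat # \<Gamma>) ?E" "wff (Nat # \<Gamma>) ?E'" by auto
  have E0: "plug [Con Zero] 0 ?E = Ex (Nat \<rightarrow> \<sigma>) (chosen \<chi> (tlift s) (Var 0) (Con Zero) 1)"
    by (simp add: plug_psub fsubst_chosen[where d'=1])
  have E1: "plug [Con Succ \<cdot> Var 0] 1 ?E = ?E'"
    by (simp add: plug_psub fsubst_chosen[where d'=2])
  have "prv \<Gamma> \<Delta> (plug [Con Zero] 0 ?E)"
    unfolding E0
  proof (rule prv_ExI[where t="zero (Nat \<rightarrow> \<sigma>)"])
    have "prv \<Gamma> \<Delta> (chosen \<chi> s (zero (Nat \<rightarrow> \<sigma>)) (Con Zero) 0)"
      unfolding chosen_def
      by (intro nd.AllI nd.ImpI prv_less_Zero[OF nd.Asm[of "less (Var 0) (Con Zero)"]])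
        (use w in \<open>auto intro!: wff_plug2[OF \<chi>(1), where G="[Nat]"] wt_AppI[OF closed_wt_weak(5)[of _ "Nat \<rightarrow> \<sigma>"]] simp del: zero.simps\<close>)
    then show "prv \<Gamma> \<Delta> (fsubst (psub [zero (Nat \<rightarrow> \<sigma>)] 0) (chosen \<chi> (tlift s) (Var 0) (Con Zero) 1))"
      by (simp add: fsubst_chosen[where d'=0])
    show "wff ((Nat \<rightarrow> \<sigma>) # \<Gamma>) (chosen \<chi> (tlift s) (Var 0) (Con Zero) 1)"
      by (rule wff_chosen[OF \<chi>(1), where G="[Nat \<rightarrow> \<sigma>]"]) (use w in auto)
  qed (rule closed_wt_weak)
  moreover have "prv \<Gamma> \<Delta> (AllSt Nat (Imp ?E (plug [Con Succ \<cdot> Var 0] 1 ?E)))"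
    unfolding E1
  proof (intro prv_AllStI nd.ImpI W)
    let ?\<Delta> = "?E # St Nat (Var 0) # map flift \<Delta>"
    show "prv (Nat # \<Gamma>) ?\<Delta> ?E'"
    proof (rule prv_ExE[OF nd.Asm])
      let ?\<Gamma> = "(Nat \<rightarrow> \<sigma>) # Nat # \<Gamma>" and ?\<Delta>' = "chosen \<chi> ?s2 (Var 0) (Var 1) 2 # map flift ?\<Delta>"
      have "prv ?\<Gamma> ?\<Delta>' (Ex (Nat \<rightarrow> \<sigma>) (chosen \<chi> (tlift ?s2) (Var 0) (Con Succ \<cdot> tlift (Var 1)) (Suc 2)))"
      proof (rule prv_chosen_step_AllSt[OF \<chi>, where G="[Nat \<rightarrow> \<sigma>, Nat]" and f="Var 0" and d=2])
        have "AllSt Nat (Ex \<sigma> (plug [Var 1, Var 0] (Suc (Suc 2)) \<chi>)) =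
            flift (flift (AllSt Nat (Ex \<sigma> (plug [Var 1, Var 0] (Suc (Suc 0)) \<chi>))))"
          by (simp del: fsubst_fsubst add: fsubst_plug[where d'="Suc (Suc 1)"] fsubst_plug[where d'="Suc (Suc 2)"])
        also have "\<dots> \<in> set ?\<Delta>'"
          unfolding \<chi>' using flift_in[OF flift_in[OF a]] by simp
        finally show "AllSt Nat (Ex \<sigma> (plug [Var 1, Var 0] (Suc (Suc 2)) \<chi>)) \<in> set ?\<Delta>'" .
        show "St (Seq Nat) ?s2 \<in> set ?\<Delta>'"
          using flift_in[OF flift_in[OF st]] by simp
      qed (use w in auto)
      then show "prv ?\<Gamma> ?\<Delta>' (flift ?E')"
        by (simp add: fsubst_chosen[where d'=3])
    qed (use W in auto)
  qed (use W in simp)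
  ultimately show ?thesis
    by (intro prv_mp[OF prv_EHAst[OF EHAst.external_induction[OF W(1)]]] nd.AndI)
qed

text \<open>
  The finite choice principle that carries the theorem: take the length of \<open>s\<close>, which is standard, for
  the bound on the numbers. A member of \<open>s\<close> is only equal to a component of \<open>s\<close>, hence the final
  replacement of equals by equals.
\<close>

lemma prv_choice_on_seq:
  assumes \<chi>: "wff (\<sigma> # Nat # \<Gamma>) \<chi>" "internal \<chi>"
    and w: "wt \<Gamma> s (Seq Nat)"
    and a: "AllSt Nat (Ex \<sigma> \<chi>) \<in> set \<Delta>" and st: "St (Seq Nat) s \<in> set \<Delta>"
  shows "prv \<Gamma> \<Delta> (Ex (Nat \<rightarrow> \<sigma>) (ball Nat (tlift s) (plug [Var 0, Var 1 \<cdot> Var 0] 2 \<chi>)))"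
proof -
  let ?s = "tlift s" and ?\<Gamma> = "(Nat \<rightarrow> \<sigma>) # \<Gamma>"
  let ?B = "ball Nat ?s (plug [Var 0, Var 1 \<cdot> Var 0] 2 \<chi>)"
  have WB: "wff ?\<Gamma> ?B"
    by (intro wff_ball wff_plug2[OF \<chi>(1), where G="[Nat, Nat \<rightarrow> \<sigma>]"]) (use w in \<open>auto intro: wt_AppI[of _ _ Nat]\<close>)
  have WC: "wff ((Nat \<rightarrow> \<sigma>) # Nat # \<Gamma>) (chosen \<chi> (tlift ?s) (Var 0) (Var 1) 2)"
    by (rule wff_chosen[OF \<chi>(1), where G="[Nat \<rightarrow> \<sigma>, Nat]"]) (use w in auto)
  have "prv \<Gamma> \<Delta> (Ex (Nat \<rightarrow> \<sigma>) (chosen \<chi> ?s (Var 0) (len Nat \<cdot> ?s) 1))"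
    by (rule prv_AllStE[OF prv_chosen_all[OF assms] _ _ prv_St_len[OF nd.Asm[OF st]]])
      (use w WC in \<open>auto simp: fsubst_chosen[where d'=1]\<close>)
  then show ?thesis
  proof (rule prv_ExE)
    let ?C = "chosen \<chi> ?s (Var 0) (len Nat \<cdot> ?s) 1"
    let ?\<Gamma>1 = "Nat # ?\<Gamma>" and ?\<Gamma>2 = "Nat # Nat # ?\<Gamma>"
    let ?\<Delta>1 = "mem Nat (Var 0) (tlift ?s) # map flift (?C # map flift \<Delta>)"
    let ?s2 = "tlift (tlift ?s)"
    let ?M = "And (less (Var 0) (len Nat \<cdot> ?s2)) (Eq (Var 1) (proj Nat \<cdot> ?s2 \<cdot> Var 0))"
    let ?\<Delta>2 = "?M # map flift ?\<Delta>1"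
    have "prv ?\<Gamma>1 ?\<Delta>1 (Ex Nat ?M)"
      by (rule nd.Asm) (use w in \<open>auto simp: mem_def\<close>)
    then have "prv ?\<Gamma>1 ?\<Delta>1 (plug [Var 0, Var 1 \<cdot> Var 0] 2 \<chi>)"
    proof (rule prv_ExE)
      let ?p = "proj Nat \<cdot> ?s2 \<cdot> Var 0"
      have M: "prv ?\<Gamma>2 ?\<Delta>2 ?M"
        by (rule nd.Asm) (use w in auto)
      have "prv ?\<Gamma>2 ?\<Delta>2 (chosen \<chi> ?s2 (Var 2) (len Nat \<cdot> ?s2) 3)"
        by (rule nd.Asm, simp add: eval_nat_numeral, rule wff_chosen[OF \<chi>(1), where G="[Nat, Nat, Nat \<rightarrow> \<sigma>]"])
          (use w in auto)
      from chosenD[OF this nd.AndE1[OF M]]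
      have F: "prv ?\<Gamma>2 ?\<Delta>2 (plug [?p, Var 2 \<cdot> ?p] 3 \<chi>)" by simp
      have e: "eqd ?\<Gamma>2 ?\<Delta>2 Nat ?p (Var 1)"
        using nd.AndE2[OF M] w by (intro eqd_sym[OF eqdI]) auto
      have e': "eqd ?\<Gamma>2 ?\<Delta>2 \<sigma> (Var 2 \<cdot> ?p) (Var 2 \<cdot> Var 1)"
        by (rule eqd_arg[OF _ e]) auto
      have "prv ?\<Gamma>2 ?\<Delta>2 (plug [Var 1, Var 2 \<cdot> Var 1] 3 \<chi>)"
        by (rule prv_Leibniz2[OF \<chi>, where G="[Nat, Nat, Nat \<rightarrow> \<sigma>]", OF _ _ e e' F]) auto
      then show "prv ?\<Gamma>2 ?\<Delta>2 (flift (plug [Var 0, Var 1 \<cdot> Var 0] 2 \<chi>))"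
        by (simp add: eval_nat_numeral)
    qed (use WB in \<open>simp add: ball_def\<close>)
    then have "prv ?\<Gamma> (?C # map flift \<Delta>) ?B"
      unfolding ball_def by (intro nd.AllI nd.ImpI) (use w in auto)
    from prv_Ex_lift[OF this WB]
    show "prv ?\<Gamma> (?C # map flift \<Delta>) (flift (Ex (Nat \<rightarrow> \<sigma>) ?B))" .
  qed (use WB in simp)
qed

section \<open>Tuples of standard quantifiers\<close>

lemma wff_foldr_AllSt [simp]: "wff \<Gamma> (foldr AllSt \<tau>s \<Phi>) \<longleftrightarrow> wff (rev \<tau>s @ \<Gamma>) \<Phi>"
  by (induction \<tau>s arbitrary: \<Gamma>) auto

lemma wff_foldr_ExSt [simp]: "wff \<Gamma> (foldr ExSt \<tau>s \<Phi>) \<longleftrightarrow> wff (rev \<tau>s @ \<Gamma>) \<Phi>"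
  by (induction \<tau>s arbitrary: \<Gamma>) auto

lemma prv_ExSt_mono:
  assumes w: "wff (\<sigma> # \<Gamma>) \<Phi>" "wff (\<sigma> # \<Gamma>) \<Psi>" and i: "prv (\<sigma> # \<Gamma>) [] (Imp \<Phi> \<Psi>)"
  shows "prv \<Gamma> [] (Imp (ExSt \<sigma> \<Phi>) (ExSt \<sigma> \<Psi>))"
proof (rule nd.ImpI)
  let ?\<Delta> = "[ExSt \<sigma> \<Phi>]"
  let ?\<Phi>' = "And (St \<sigma> (Var 0)) \<Phi>" and ?\<Psi>' = "And (St \<sigma> (Var 0)) \<Psi>"
  have "prv \<Gamma> ?\<Delta> (Ex \<sigma> ?\<Phi>')"
    by (rule prv_mp[OF nd.AndE1[OF prv_EHAst[OF EHAst.ExSt[OF w(1)]]] nd.Asm]) (use w in auto)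
  then have "prv \<Gamma> ?\<Delta> (Ex \<sigma> ?\<Psi>')"
  proof (rule prv_ExE)
    let ?\<Delta>' = "?\<Phi>' # map flift ?\<Delta>"
    have A: "prv (\<sigma> # \<Gamma>) ?\<Delta>' ?\<Phi>'"
      by (rule nd.Asm) (use w in auto)
    have "prv (\<sigma> # \<Gamma>) ?\<Delta>' \<Psi>"
      by (rule prv_mp[OF nd_weaken[OF i] nd.AndE2[OF A]]) simp
    then have "prv (\<sigma> # \<Gamma>) ?\<Delta>' ?\<Psi>'"
      by (rule nd.AndI[OF nd.AndE1[OF A]])
    then show "prv (\<sigma> # \<Gamma>) ?\<Delta>' (flift (Ex \<sigma> ?\<Psi>'))"
      by (rule prv_Ex_lift) (use w in auto)
  qed (use w in auto)
  then show "prv \<Gamma> ?\<Delta> (ExSt \<sigma> \<Psi>)"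
    by (rule prv_mp[OF nd.AndE2[OF prv_EHAst[OF EHAst.ExSt[OF w(2)]]]])
qed (use w in auto)

lemma prv_foldr_ExSt_mono:
  "wff (rev \<tau>s @ \<Gamma>) \<Phi> \<Longrightarrow> wff (rev \<tau>s @ \<Gamma>) \<Psi> \<Longrightarrow> prv (rev \<tau>s @ \<Gamma>) [] (Imp \<Phi> \<Psi>) \<Longrightarrow>
    prv \<Gamma> [] (Imp (foldr ExSt \<tau>s \<Phi>) (foldr ExSt \<tau>s \<Psi>))"
  by (induction \<tau>s arbitrary: \<Gamma>) (auto intro!: prv_ExSt_mono)

lemma vars_0_Suc: "vars 0 (Suc n) = Var n # vars 0 n"
  by (simp add: vars_def)

lemma prv_foldr_AllStI:
  assumes "wff (rev \<tau>s @ \<Gamma>) \<Phi>"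
    "prv (rev \<tau>s @ \<Gamma>) (map2 St \<tau>s (vars 0 (length \<tau>s)) @ map (fsubst (\<lambda>i. Var (i + length \<tau>s))) \<Delta>) \<Phi>"
  shows "prv \<Gamma> \<Delta> (foldr AllSt \<tau>s \<Phi>)"
  using assms
proof (induction \<tau>s arbitrary: \<Gamma> \<Delta>)
  case Nil
  then show ?case by simp
next
  case (Cons \<tau> \<tau>s)
  have "prv (\<tau> # \<Gamma>) (St \<tau> (Var 0) # map flift \<Delta>) (foldr AllSt \<tau>s \<Phi>)"
    by (rule Cons.IH) (use Cons.prems in \<open>auto simp: vars_0_Suc comp_def elim!: nd_weaken\<close>)
  then show ?case
    using Cons.prems(1) by (auto intro: prv_AllStI)
qed

text \<open>
  The formula is instantiated one quantifier at a time. The substitution \<open>\<theta>\<close> collects the terms used so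
  far, which is why the assumption is stated below an arbitrary substitution.
\<close>

lemma prv_foldr_AllStE:
  assumes "prv \<Gamma> \<Delta> (fsubst \<theta> (foldr AllSt \<tau>s \<Phi>))" "wff (rev \<tau>s @ \<Gamma>') \<Phi>"
    "\<And>i. i < length \<Gamma>' \<Longrightarrow> wt \<Gamma> (\<theta> i) (\<Gamma>' ! i)"
    "list_all2 (\<lambda>t \<tau>. wt \<Gamma> t \<tau> \<and> prv \<Gamma> \<Delta> (St \<tau> t)) ts \<tau>s"
  shows "prv \<Gamma> \<Delta> (fsubst (\<lambda>i. if i < length ts then rev ts ! i else \<theta> (i - length ts)) \<Phi>)"
  using assms
proof (induction \<tau>s arbitrary: \<theta> \<Gamma>' ts)
  case Nil
  then show ?case by simp
next
  case (Cons \<tau> \<tau>s)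
  from Cons.prems(4) obtain t us where ts: "ts = t # us" "wt \<Gamma> t \<tau>" "prv \<Gamma> \<Delta> (St \<tau> t)"
    "list_all2 (\<lambda>t \<tau>. wt \<Gamma> t \<tau> \<and> prv \<Gamma> \<Delta> (St \<tau> t)) us \<tau>s"
    by (auto simp: list_all2_Cons2)
  let ?\<theta> = "case_nat t \<theta>"
  have "wff (\<tau> # \<Gamma>) (fsubst (up \<theta>) (foldr AllSt \<tau>s \<Phi>))"
    by (rule wff_fsubst[of "\<tau> # \<Gamma>'"]) (use Cons.prems(2) wt_up[OF Cons.prems(3)] in auto)
  moreover have "(\<lambda>i. tsubst (psub [t] 0) (up \<theta> i)) = ?\<theta>"
    by (auto simp: fun_eq_iff split: nat.split)
  then have "fsubst (psub [t] 0) (fsubst (up \<theta>) (foldr AllSt \<tau>s \<Phi>)) = fsubst ?\<theta> (foldr AllSt \<tau>s \<Phi>)"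
    by simp
  ultimately have "prv \<Gamma> \<Delta> (fsubst ?\<theta> (foldr AllSt \<tau>s \<Phi>))"
    using Cons.prems(1) ts(2,3) prv_AllStE[of \<Gamma> \<Delta> \<tau> "fsubst (up \<theta>) (foldr AllSt \<tau>s \<Phi>)" t] by simp
  then have "prv \<Gamma> \<Delta> (fsubst (\<lambda>i. if i < length us then rev us ! i else ?\<theta> (i - length us)) \<Phi>)"
    by (rule Cons.IH[of _ "\<tau> # \<Gamma>'"])
      (use Cons.prems(2,3) ts in \<open>auto simp: nth_Cons split: nat.split\<close>)
  moreover have "(\<lambda>i. if i < length us then rev us ! i else ?\<theta> (i - length us)) =
      (\<lambda>i. if i < length ts then rev ts ! i else \<theta> (i - length ts))"
  proof
    fix i
    consider "i < length us" | "i = length us" | j where "i = Suc (length us + j)"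
      using less_imp_Suc_add linorder_neqE_nat by blast
    then show "(if i < length us then rev us ! i else ?\<theta> (i - length us)) =
        (if i < length ts then rev ts ! i else \<theta> (i - length ts))"
      by cases (auto simp: ts(1) nth_append Suc_diff_le)
  qed
  ultimately show ?case by simp
qed

section \<open>Countable saturation\<close>

lemma rev_vars: "rev (vars off n) = map Var [off..<off + n]"
  by (simp add: vars_def rev_map)

lemma map_vars: "(\<And>j. j < n \<Longrightarrow> \<theta> (off + j) = Var (off' + j)) \<Longrightarrow> map (tsubst \<theta>) (vars off n) = vars off' n"
proof (rule nth_equalityI)
  assume *: "\<And>j. j < n \<Longrightarrow> \<theta> (off + j) = Var (off' + j)"
  fix i assume "i < length (map (tsubst \<theta>) (vars off n))"
  then show "map (tsubst \<theta>) (vars off n) ! i = vars off' n ! i"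
    using *[of "n - Suc i"] by (simp add: vars_def rev_nth)
qed simp

text \<open>
  The variables bound in between extend the list by themselves; so the substitutions of the form \<open>psub\<close>
  are closed under going below binders.
\<close>

lemma upn_psub: "upn n (psub ts d) = psub (map (tsubst (\<lambda>i. Var (i + n))) ts @ vars 0 n) (d + n)"
  by (auto simp: upn_def psub_def fun_eq_iff nth_append rev_vars rev_nth)

text \<open>
  Reading off the slice of the list that a block of variables refers to.
\<close>

lemma map_psub_vars:
  assumes "length ts3 = off" "length ts2 = n"
  shows "map (tsubst (psub (ts1 @ ts2 @ ts3) d)) (vars off n) = ts2"
proof (rule nth_equalityI)
  fix i assume "i < length (map (tsubst (psub (ts1 @ ts2 @ ts3) d)) (vars off n))"
  then have i: "i < n" by simp
  then obtain j where j: "n = Suc (i + j)"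
    using less_imp_Suc_add by blast
  have "psub (ts1 @ ts2 @ ts3) d (off + (n - Suc i)) = ts2 ! i"
    using assms by (simp add: psub_def nth_append rev_nth j)
  moreover have "vars off n ! i = Var (off + (n - Suc i))"
    using i by (simp add: vars_def rev_nth)
  ultimately show "map (tsubst (psub (ts1 @ ts2 @ ts3) d)) (vars off n) ! i = ts2 ! i"
    using i by simp
qed (simp add: assms)

text \<open>
  As \<open>psub_comp\<close>, but \<open>\<theta>\<close> also replaces the first variable that \<open>psub ts d\<close> leaves alone. In this way a
  variable that is free in the inner formula, like \<open>n\<close> or \<open>f\<close>, becomes an entry of the list.
\<close>

lemma psub_comp_Cons:
  assumes "\<theta> d = t" "\<And>j. \<theta> (Suc (j + d)) = Var (j + d')"
  shows "(\<lambda>i. tsubst \<theta> (psub ts d i)) = psub (t # map (tsubst \<theta>) ts) d'"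
proof
  fix i
  consider "i < length ts" | "i = length ts" | j where "i = Suc (length ts + j)"
    using less_imp_Suc_add linorder_neqE_nat by blast
  then show "tsubst \<theta> (psub ts d i) = psub (t # map (tsubst \<theta>) ts) d' i"
  proof cases
    case (3 j)
    then show ?thesis using assms(2)[of j] by (simp add: psub_def)
  qed (simp_all add: psub_def nth_append rev_nth assms)
qed

text \<open>
  The internal formula \<open>\<chi>(n, z) = \<forall>y' \<in> y. \<phi>(X[n], y', n, z)\<close> in the scope \<open>X, s, y, n, z\<close>, which both
  interpretations have in common. The place of \<open>s\<close> in the scope is the one at which the interpretation of
  the conclusion binds it.
\<close>

definition kernel :: "ty list \<Rightarrow> ty list \<Rightarrow> fm \<Rightarrow> fm" where
  "kernel xs ys \<phi> =
    (let m = length xs; k = length ys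
     in balls ys (vars 2 k)
          (fsubst (psub ([Var (Suc k), Var k] @ happs [Nat] xs (vars (2 * k + 3) m) [Var (Suc k)] @ vars 0 k)
             (m + 2 * k + 3)) \<phi>))"

text \<open>
  In the interpretation of the premise the number \<open>n\<close> is bound outside of \<open>y\<close>. Renaming the variables,
  with \<open>n\<close> as the innermost one and \<open>s\<close> added, brings its matrix into the form \<open>\<exists>z \<chi>(n, z)\<close>.
\<close>

lemma Dst_AllSt_Ex_matrix:
  assumes "dst \<Phi> = (xs, ys, \<phi>)" and m: "m = length xs" and k: "k = length ys"
  obtains A where "dst (AllSt Nat (Ex \<sigma> \<Phi>)) = (map (htype [Nat]) xs, Nat # map Seq ys, A)"
    "plug ([Var 0] @ vars 1 k) (k + 2) A = Ex \<sigma> (kernel xs ys \<phi>)"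
proof
  have \<chi>: "kernel xs ys \<phi> = balls ys (vars 2 k) (fsubst (psub ([Var (Suc k), Var k] @ happs [Nat] xs (vars (2 * k + 3) m) [Var (Suc k)] @ vars 0 k)
      (m + 2 * k + 3)) \<phi>)"
    by (simp add: kernel_def Let_def m k)
  let ?ts1 = "[Var k] @ happs [Nat] xs (vars (k + 1) m) [Var k] @ vars 0 k"
  let ?ts2 = "[Var k] @ vars (k + 1 + k) m @ vars 0 k"
  let ?A = "plug ?ts1 (k + 1 + m) (Ex \<sigma> (balls ys (vars 1 k) (plug ?ts2 (k + 1 + k + m) \<phi>)))"
  show "dst (AllSt Nat (Ex \<sigma> \<Phi>)) = (map (htype [Nat]) xs, Nat # map Seq ys, ?A)"
    using assms by (simp add: Let_def)
  let ?ts3 = "[Var 0] @ happs [Nat] xs (vars (k + 2) m) [Var 0] @ vars 1 k"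
  let ?\<theta> = "psub ([Var 0] @ vars 1 k) (k + 2)"
  have 1: "plug ([Var 0] @ vars 1 k) (k + 2) (plug ?ts1 (k + 1 + m) \<psi>) = fsubst (psub ?ts3 (m + k + 2)) \<psi>" for \<psi>
  proof -
    have "map (tsubst ?\<theta>) (vars (k + 1) m) = vars (k + 2) m"
      by (rule map_vars) (simp add: psub_def)
    moreover have "map (tsubst ?\<theta>) (vars 0 k) = vars 1 k"
      using map_psub_vars[of "[]" 0 "vars 1 k" k "[Var 0]"] by simp
    moreover have "?\<theta> k = Var 0"
      by (simp add: psub_def nth_append)
    ultimately have "map (tsubst ?\<theta>) ?ts1 = ?ts3"
      by simp
    moreover have "fsubst ?\<theta> (plug ?ts1 (k + 1 + m) \<psi>) = plug (map (tsubst ?\<theta>) ?ts1) (m + k + 2) \<psi>"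
      by (rule fsubst_plug) (simp add: psub_def)
    ultimately show ?thesis by (simp only: plug_psub)
  qed
  let ?H = "happs [Nat] xs (vars (2 * k + 3) m) [Var (Suc k)]"
  let ?ts4 = "[Var (Suc k)] @ ?H @ vars (k + 2) k @ vars 0 (Suc k)"
  have lH: "length ?H = m" by (simp add: m)
  have 2: "upn (Suc k) (psub ?ts3 (m + k + 2)) = psub ?ts4 (m + 2 * k + 3)"
  proof -
    have "map (tsubst (\<lambda>i. Var (i + Suc k))) (vars (k + 2) m) = vars (2 * k + 3) m"
      "map (tsubst (\<lambda>i. Var (i + Suc k))) (vars 1 k) = vars (k + 2) k"
      by (rule map_vars; simp)+
    then have "map (tsubst (\<lambda>i. Var (i + Suc k))) ?ts3 @ vars 0 (Suc k) = ?ts4"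
      by simp
    moreover have "m + k + 2 + Suc k = m + 2 * k + 3" by simp
    ultimately show ?thesis unfolding upn_psub by (rule arg_cong2)
  qed
  \<comment> \<open>The terms \<open>?ts3\<close> stand for \<open>n\<close>, \<open>x\<close>, \<open>y\<close>; below \<open>z\<close> and \<open>y'\<close> they have become \<open>?ts4\<close>, from which the matrix of \<open>\<Phi>\<close> picks its arguments.\<close>
  have 3: "(\<lambda>i. tsubst (psub ?ts4 (m + 2 * k + 3)) (psub ?ts2 (k + 1 + k + m) i)) =
      psub ([Var (Suc k), Var k] @ ?H @ vars 0 k) (m + 2 * k + 3)"
  proof -
    let ?\<theta> = "psub ?ts4 (m + 2 * k + 3)"
    have "map (tsubst ?\<theta>) (vars (k + 1 + k) m) = ?H"
      using map_psub_vars[of "vars (k + 2) k @ vars 0 (Suc k)" "k + 1 + k" ?H m "[Var (Suc k)]"] lH by simp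
    moreover have "map (tsubst ?\<theta>) (vars 0 k) = vars 0 k"
      by (rule map_vars) (simp add: psub_def nth_append rev_vars del: upt_Suc)
    moreover have "?\<theta> k = Var k"
      by (simp add: psub_def nth_append rev_vars del: upt_Suc)
    ultimately have "map (tsubst ?\<theta>) ?ts2 = [Var k] @ ?H @ vars 0 k" by simp
    moreover have "(\<lambda>i. tsubst ?\<theta> (psub ?ts2 (k + 1 + k + m) i)) =
        psub (Var (Suc k) # map (tsubst ?\<theta>) ?ts2) (m + 2 * k + 3)"
      by (rule psub_comp_Cons) (simp_all add: psub_def nth_append m[symmetric])
    ultimately show ?thesis by simp
  qed
  have "map (tsubst (up (psub ?ts3 (m + k + 2)))) (vars 1 k) = vars 2 k"
    by (rule map_vars) (simp add: psub_def nth_append rev_vars del: upt_Suc)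
  moreover have "length ys = length (vars 1 k)" by (simp add: k)
  moreover have "upn k (up (psub ?ts3 (m + k + 2))) = psub ?ts4 (m + 2 * k + 3)"
    unfolding upn_up by (rule 2)
  ultimately show "plug ([Var 0] @ vars 1 k) (k + 2) ?A = Ex \<sigma> (kernel xs ys \<phi>)"
    unfolding 1 \<chi> plug_psub[of ?ts2] fsubst.simps fsubst_balls[OF \<open>length ys = _\<close>] length_vars
    using 3 by (simp only: fsubst_fsubst)
qed

text \<open>
  The matrix for \<open>\<Phi>(n, f n)\<close> arises by three substitutions: \<open>tsA\<close> replaces \<open>z\<close> by \<open>f n\<close>, \<open>tsB\<close> introduces
  \<open>X[n]\<close>, and \<open>tsC\<close> moves the result below the bounded quantifiers over \<open>s\<close> and \<open>y\<close>. Their composition is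
  compared with substituting \<open>f n\<close> for \<open>z\<close> in the kernel.
\<close>

lemma Dst_Ex_AllSt_matrix:
  assumes d: "dst \<Phi> = (xs, ys, \<phi>)" and m: "m = length xs" and k: "k = length ys"
  shows "dst (Ex (Nat \<rightarrow> \<sigma>) (AllSt Nat (plug [Var 0, Var 1 \<cdot> Var 0] 2 \<Phi>))) =
    (map (htype [Nat]) xs, Seq Nat # map Seq ys,
      Ex (Nat \<rightarrow> \<sigma>) (ball Nat (Var (Suc k)) (plug [Var 0, Var 1 \<cdot> Var 0] 2 (kernel xs ys \<phi>))))"
proof -
  have \<chi>: "kernel xs ys \<phi> = balls ys (vars 2 k) (fsubst (psub ([Var (Suc k), Var k] @ happs [Nat] xs (vars (2 * k + 3) m) [Var (Suc k)] @ vars 0 k)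
      (m + 2 * k + 3)) \<phi>)"
    by (simp add: kernel_def Let_def m k)
  let ?tsA = "[Var (m + k), Var (Suc (m + k)) \<cdot> Var (m + k)] @ vars 0 (m + k)"
  let ?tsB = "[Var k] @ happs [Nat] xs (vars (k + 1) m) [Var k] @ vars 0 k"
  let ?tsC = "[Var (k + 1)] @ vars (k + 1 + 1 + (k + 1)) m @ vars 0 (k + 1)"
  let ?dC = "k + 1 + 1 + (k + 1) + m"
  let ?H = "happs [Nat] xs (vars (2 * k + 3) m) [Var k]"
  let ?ts = "[Var k, Var (Suc k) \<cdot> Var k] @ ?H @ vars 0 k"
  have lH: "length ?H = m" by (simp add: m)
  have "upn (m + k) (psub [Var 0, Var 1 \<cdot> Var 0] 2) = psub ?tsA (2 + (m + k))"
    unfolding upn_psub by (simp add: add.commute)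
  then have dA: "dst (plug [Var 0, Var 1 \<cdot> Var 0] 2 \<Phi>) = (xs, ys, fsubst (psub ?tsA (2 + (m + k))) \<phi>)"
    using dst_fsubst[OF d] by (simp add: plug_psub m k)
  have BC: "(\<lambda>i. tsubst (psub ?tsC ?dC) (psub ?tsB (k + 1 + m) i)) =
      psub (Var (Suc k) # [Var k] @ ?H @ vars 0 k) (m + 2 * k + 3)"
  proof -
    let ?\<theta> = "psub ?tsC ?dC"
    have "map (tsubst ?\<theta>) (vars (k + 1) m) = vars (2 * k + 3) m"
      using map_psub_vars[of "vars 0 (k + 1)" "k + 1" "vars (k + 1 + 1 + (k + 1)) m" m "[Var (k + 1)]" ?dC]
      by (simp add: eval_nat_numeral mult_2 add.assoc)
    moreover have "map (tsubst ?\<theta>) (vars 0 k) = vars 0 k"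
      by (rule map_vars) (simp add: psub_def nth_append rev_vars del: upt_Suc)
    moreover have "?\<theta> k = Var k"
      by (simp add: psub_def nth_append rev_vars del: upt_Suc)
    ultimately have "map (tsubst ?\<theta>) ?tsB = [Var k] @ ?H @ vars 0 k" by simp
    moreover have "(\<lambda>i. tsubst ?\<theta> (psub ?tsB (k + 1 + m) i)) =
        psub (Var (Suc k) # map (tsubst ?\<theta>) ?tsB) (m + 2 * k + 3)"
      by (rule psub_comp_Cons) (simp_all add: psub_def nth_append)
    ultimately show ?thesis by (simp only:)
  qed
  have ABC: "(\<lambda>i. tsubst (psub (Var (Suc k) # [Var k] @ ?H @ vars 0 k) (m + 2 * k + 3)) (psub ?tsA (2 + (m + k)) i)) =
      psub ?ts (m + 2 * k + 3)"
  proof -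
    let ?\<theta> = "psub (Var (Suc k) # [Var k] @ ?H @ vars 0 k) (m + 2 * k + 3)"
    have "map (tsubst ?\<theta>) (vars 0 (m + k)) = ?H @ vars 0 k"
      using map_psub_vars[of "[]" 0 "?H @ vars 0 k" "m + k" "[Var (Suc k), Var k]"] lH by simp
    moreover have "?\<theta> (m + k) = Var k" "?\<theta> (Suc (m + k)) = Var (Suc k)"
      by (simp_all add: psub_def nth_append m[symmetric])
    ultimately have "map (tsubst ?\<theta>) ?tsA = ?ts" by simp
    moreover have "(\<lambda>i. tsubst ?\<theta> (psub ?tsA (2 + (m + k)) i)) = psub (map (tsubst ?\<theta>) ?tsA) (m + 2 * k + 3)"
      by (rule psub_comp) (simp add: psub_def m[symmetric])
    ultimately show ?thesis by simp
  qed
  let ?\<theta> = "psub [Var 0, Var 1 \<cdot> Var 0] 2"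
  have D: "(\<lambda>i. tsubst (upn k ?\<theta>) (psub ([Var (Suc k), Var k] @ happs [Nat] xs (vars (2 * k + 3) m) [Var (Suc k)] @ vars 0 k)
      (m + 2 * k + 3) i)) = psub ?ts (m + 2 * k + 3)"
  proof -
    have u: "upn k ?\<theta> = psub ([Var k, Var (Suc k) \<cdot> Var k] @ vars 0 k) (2 + k)"
      unfolding upn_psub by simp
    let ?\<theta>' = "psub ([Var k, Var (Suc k) \<cdot> Var k] @ vars 0 k) (2 + k)"
    have "map (tsubst ?\<theta>') (vars (2 * k + 3) m) = vars (2 * k + 3) m"
      by (rule map_vars) (simp add: psub_def)
    moreover have "map (tsubst ?\<theta>') (vars 0 k) = vars 0 k"
      by (rule map_vars) (simp add: psub_def nth_append rev_vars del: upt_Suc)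
    moreover have "?\<theta>' k = Var (Suc k) \<cdot> Var k" "?\<theta>' (Suc k) = Var k"
      by (simp_all add: psub_def nth_append)
    moreover have "(\<lambda>i. tsubst ?\<theta>' (psub ts (m + 2 * k + 3) i)) = psub (map (tsubst ?\<theta>') ts) (m + 2 * k + 3)" for ts
      by (rule psub_comp) (simp add: psub_def)
    ultimately show ?thesis unfolding u by simp
  qed
  have "map (tsubst ?\<theta>) (vars 2 k) = vars 2 k"
    by (rule map_vars) (simp add: psub_def)
  moreover have l: "length ys = length (vars 2 k)" by (simp add: k)
  ultimately have R: "plug [Var 0, Var 1 \<cdot> Var 0] 2 (kernel xs ys \<phi>) = balls ys (vars 2 k) (fsubst (psub ?ts (m + 2 * k + 3)) \<phi>)"
    unfolding \<chi> plug_psub fsubst_balls[OF l] length_vars fsubst_fsubst D by simp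
  have v: "vars 1 (Suc k) = Var (Suc k) # vars 1 k" "map tlift (vars 1 k) = vars 2 k"
    by (simp add: vars_def) (rule map_vars, simp)
  have C: "fsubst (psub ?tsC ?dC) (fsubst (psub ?tsB (k + 1 + m)) (fsubst (psub ?tsA (2 + (m + k))) \<phi>)) =
      fsubst (psub ?ts (m + 2 * k + 3)) \<phi>"
    unfolding fsubst_fsubst[of "psub ?tsC ?dC"] BC unfolding fsubst_fsubst ABC ..
  have dB: "dst (AllSt Nat (plug [Var 0, Var 1 \<cdot> Var 0] 2 \<Phi>)) =
      (map (htype [Nat]) xs, Nat # ys, fsubst (psub ?tsB (k + 1 + m)) (fsubst (psub ?tsA (2 + (m + k))) \<phi>))"
    unfolding dst.simps dA by (simp add: plug_psub Let_def m k)
  have "dst (Ex (Nat \<rightarrow> \<sigma>) (AllSt Nat (plug [Var 0, Var 1 \<cdot> Var 0] 2 \<Phi>))) =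
      (map (htype [Nat]) xs, map Seq (Nat # ys),
       Ex (Nat \<rightarrow> \<sigma>) (balls (Nat # ys) (vars 1 (Suc k)) (fsubst (psub ?tsC ?dC)
         (fsubst (psub ?tsB (k + 1 + m)) (fsubst (psub ?tsA (2 + (m + k))) \<phi>)))))"
    unfolding dst.simps(8) dB by (simp add: plug_psub Let_def m k del: fsubst_fsubst)
  then show ?thesis
    unfolding C R v balls.simps by simp
qed

theorem theorem3p5:
  fixes \<Gamma> :: "ty list" and \<sigma> :: ty and \<Phi> :: fm
  assumes "wff (\<sigma> # Nat # \<Gamma>) \<Phi>"
  shows "H_proves \<Gamma> (CSAT \<sigma> \<Phi>)"
proof -
  obtain xs ys \<phi> where d: "dst \<Phi> = (xs, ys, \<phi>)" by (metis prod_cases3)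
  define m k where mk: "m = length xs" "k = length ys"
  define \<chi> where "\<chi> = kernel xs ys \<phi>"
  let ?P = "AllSt Nat (Ex \<sigma> \<Phi>)" and ?Q = "Ex (Nat \<rightarrow> \<sigma>) (AllSt Nat (plug [Var 0, Var 1 \<cdot> Var 0] 2 \<Phi>))"
  let ?X = "map Seq (map (htype [Nat]) xs)" and ?Y = "map Seq ys"
  let ?\<Gamma>1 = "rev ?X @ \<Gamma>"
  let ?\<Gamma>2 = "rev ?Y @ Seq Nat # ?\<Gamma>1"
  obtain A where dP: "dst ?P = (map (htype [Nat]) xs, Nat # ?Y, A)"
    and A: "plug ([Var 0] @ vars 1 k) (k + 2) A = Ex \<sigma> \<chi>"
    using Dst_AllSt_Ex_matrix[OF d mk] unfolding \<chi>_def by blast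
  let ?B = "Ex (Nat \<rightarrow> \<sigma>) (ball Nat (Var (Suc k)) (plug [Var 0, Var 1 \<cdot> Var 0] 2 \<chi>))"
  have dQ: "dst ?Q = (map (htype [Nat]) xs, Seq Nat # ?Y, ?B)"
    unfolding \<chi>_def by (rule Dst_Ex_AllSt_matrix[OF d mk])
  have wP: "wff \<Gamma> ?P" using assms by simp
  have wQ: "wff \<Gamma> ?Q"
    using assms by (auto intro!: wff_plug2[where G="[Nat, Nat \<rightarrow> \<sigma>]"] wt_AppI[of _ _ Nat])
  have wA: "wff (rev (Nat # ?Y) @ ?\<Gamma>1) A" using wff_dst[OF wP dP] by simp
  have wB: "wff ?\<Gamma>2 ?B" using wff_dst[OF wQ dQ] by simp
  have "wff (Nat # ?\<Gamma>2) (plug ([Var 0] @ vars 1 k) (k + 2) A)"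
  proof (rule wff_plug[where \<tau>s="Nat # ?Y" and G="Nat # rev ?Y @ [Seq Nat]" and \<Gamma>="?\<Gamma>1"])
    have "list_all2 (wt (Nat # ?\<Gamma>2)) (vars 1 k) ?Y"
      by (rule wt_vars[of _ "[Nat]"]) (simp_all add: mk)
    then show "list_all2 (wt (Nat # ?\<Gamma>2)) ([Var 0] @ vars 1 k) (Nat # ?Y)" by simp
  qed (use wA mk in auto)
  then have w\<chi>: "wff (\<sigma> # Nat # ?\<Gamma>2) \<chi>" unfolding A by simp
  have i\<chi>: "internal \<chi>" using internal_dst[OF d] by (simp add: \<chi>_def kernel_def Let_def)
  let ?DP = "foldr AllSt (Nat # ?Y) A" and ?DQ = "foldr AllSt (Seq Nat # ?Y) ?B"
  have "prv ?\<Gamma>1 [] (Imp ?DP ?DQ)"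
  proof (intro nd.ImpI prv_foldr_AllStI)
    let ?n = "length (Seq Nat # ?Y)"
    let ?\<Delta> = "map2 St (Seq Nat # ?Y) (vars 0 ?n) @ map (fsubst (\<lambda>i. Var (i + ?n))) [?DP]"
    let ?\<Gamma>' = "rev (Seq Nat # ?Y) @ ?\<Gamma>1"
    have \<Gamma>': "?\<Gamma>' = ?\<Gamma>2" by simp
    have n: "?n = Suc k" by (simp add: mk)
    have sn: "St (Seq Nat) (Var k) \<in> set ?\<Delta>"
      by (simp add: vars_0_Suc mk)
    show "prv ?\<Gamma>' ?\<Delta> ?B"
    proof -
      \<comment> \<open>In the scope \<open>X, s, y, n\<close>, instantiate the premise with \<open>n\<close> and \<open>y\<close>.\<close>
      have "prv (Nat # ?\<Gamma>2) (St Nat (Var 0) # map flift ?\<Delta>)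
        (fsubst (\<lambda>i. if i < length ([Var 0] @ vars 1 k) then rev ([Var 0] @ vars 1 k) ! i
            else Var (i - length ([Var 0] @ vars 1 k) + (k + 2))) A)"
      proof (rule prv_foldr_AllStE[where \<Gamma>'="?\<Gamma>1" and \<tau>s="Nat # ?Y"])
        have "flift (fsubst (\<lambda>i. Var (i + ?n)) ?DP) \<in> set (map flift ?\<Delta>)"
          by (rule flift_in) simp
        moreover have "flift (fsubst (\<lambda>i. Var (i + ?n)) \<psi>) = fsubst (\<lambda>i. Var (i + (k + 2))) \<psi>" for \<psi>
          by (simp add: mk)
        ultimately have "fsubst (\<lambda>i. Var (i + (k + 2))) ?DP \<in> set (St Nat (Var 0) # map flift ?\<Delta>)"
          by (metis list.set_intros(2))
        moreover have "wff ?\<Gamma>1 ?DP" using wA by simp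
        then have "wff (Nat # ?\<Gamma>2) (fsubst (\<lambda>i. Var (i + (k + 2))) ?DP)"
          by (rule wff_fsubst) (simp add: nth_append mk)
        ultimately show "prv (Nat # ?\<Gamma>2) (St Nat (Var 0) # map flift ?\<Delta>) (fsubst (\<lambda>i. Var (i + (k + 2))) ?DP)"
          by (rule nd.Asm)
        show "list_all2 (\<lambda>t \<tau>. wt (Nat # ?\<Gamma>2) t \<tau> \<and> prv (Nat # ?\<Gamma>2) (St Nat (Var 0) # map flift ?\<Delta>) (St \<tau> t))
           ([Var 0] @ vars 1 k) (Nat # ?Y)"
        proof -
          have wv: "list_all2 (wt (Nat # ?\<Gamma>2)) (vars 1 k) ?Y"
            by (rule wt_vars[of _ "[Nat]"]) (simp_all add: mk)
          have St: "prv (Nat # ?\<Gamma>2) (St Nat (Var 0) # map flift ?\<Delta>) (St (?Y ! j) (vars 1 k ! j))" if j: "j < k" for j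
          proof (rule nd.Asm)
            have "map2 St ?Y (vars 0 k) ! j = St (?Y ! j) (vars 0 k ! j)"
              using j by (simp add: mk)
            moreover have "map2 St ?Y (vars 0 k) ! j \<in> set (map2 St ?Y (vars 0 k))"
              by (rule nth_mem) (use j in \<open>simp add: mk\<close>)
            ultimately have "St (?Y ! j) (vars 0 k ! j) \<in> set ?\<Delta>"
              by (simp add: vars_0_Suc mk)
            from flift_in[OF this] have "St (?Y ! j) (tlift (vars 0 k ! j)) \<in> set (map flift ?\<Delta>)"
              by simp
            moreover have "tlift (vars 0 k ! j) = vars 1 k ! j"
              using j by (simp add: vars_def rev_nth del: upt_Suc)
            ultimately show "St (?Y ! j) (vars 1 k ! j) \<in> set (St Nat (Var 0) # map flift ?\<Delta>)"
              by simp
            show "wff (Nat # ?\<Gamma>2) (St (?Y ! j) (vars 1 k ! j))"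
              using list_all2_nthD[OF wv] j by simp
          qed
          have "list_all2 (\<lambda>t \<tau>. wt (Nat # ?\<Gamma>2) t \<tau> \<and>
              prv (Nat # ?\<Gamma>2) (St Nat (Var 0) # map flift ?\<Delta>) (St \<tau> t)) (vars 1 k) ?Y"
            unfolding list_all2_conv_all_nth
          proof (intro conjI allI impI)
            fix j assume "j < length (vars 1 k)"
            then have j: "j < k" by simp
            show "wt (Nat # ?\<Gamma>2) (vars 1 k ! j) (?Y ! j)"
              using list_all2_nthD[OF wv] j by simp
            show "prv (Nat # ?\<Gamma>2) (St Nat (Var 0) # map flift ?\<Delta>) (St (?Y ! j) (vars 1 k ! j))"
              by (rule St[OF j])
          qed (simp add: mk)
          moreover have "prv (Nat # ?\<Gamma>2) (St Nat (Var 0) # map flift ?\<Delta>) (St Nat (Var 0))"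
            by (rule nd.Asm) auto
          moreover have "wt (Nat # ?\<Gamma>2) (Var 0) Nat"
            by simp
          ultimately show ?thesis
            unfolding append.simps list_all2_Cons by blast
        qed
      qed (use wA in \<open>auto simp: nth_append mk\<close>)
      then have "prv (Nat # ?\<Gamma>2) (St Nat (Var 0) # map flift ?\<Delta>) (plug ([Var 0] @ vars 1 k) (k + 2) A)"
        unfolding plug_def .
      then have a: "prv ?\<Gamma>2 ?\<Delta> (AllSt Nat (Ex \<sigma> \<chi>))"
        unfolding A by (rule prv_AllStI[rotated]) (use w\<chi> in simp)
      have "prv ?\<Gamma>2 (AllSt Nat (Ex \<sigma> \<chi>) # ?\<Delta>)
          (Ex (Nat \<rightarrow> \<sigma>) (ball Nat (tlift (Var k)) (plug [Var 0, Var 1 \<cdot> Var 0] 2 \<chi>)))"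
        by (rule prv_choice_on_seq[OF w\<chi> i\<chi>]) (use sn in \<open>auto simp: nth_append mk\<close>)
      then have "prv ?\<Gamma>2 ?\<Delta> ?B"
        using prv_cut[OF a] w\<chi> by simp
      then show ?thesis unfolding \<Gamma>' .
    qed
  qed (use wA wB in simp_all)
  then have D: "prv \<Gamma> [] (Imp (Dst ?P) (Dst ?Q))"
    unfolding Dst_def dP dQ prod.case Let_def
    by (rule prv_foldr_ExSt_mono[rotated 2]) (use wA wB in simp_all)
  have char: "prv \<Gamma> \<Delta> (Iff \<Psi> (Dst \<Psi>))" if "wff \<Gamma> \<Psi>" for \<Psi> \<Delta>
    by (rule nd.Axm) (rule HAx.characterization[OF that])
  have "prv \<Gamma> [?P] ?P" by (rule nd.Asm) (use wP in auto)
  from prv_mp[OF nd.AndE1[OF char[OF wP]] this] have "prv \<Gamma> [?P] (Dst ?P)" .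
  from prv_mp[OF nd_weaken[OF D] this] have "prv \<Gamma> [?P] (Dst ?Q)" by simp
  from prv_mp[OF nd.AndE2[OF char[OF wQ]] this] have "prv \<Gamma> [?P] ?Q" .
  with wP have "prv \<Gamma> [] (Imp ?P ?Q)" by (rule nd.ImpI)
  then show ?thesis by (simp add: H_proves_def CSAT_def)
qed

end
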